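(* There is an open subset $\mathcal{O}$ of the $(e,t)$ plane $\mathbb{R}^2$, containing the segment $\{(e,t): e=\tfrac12,\ 0<t<\tfrac18\}$, such that: for every $(e,t)\in\mathcal{O}$ the unique (up to measure-preserving transformations of $[0,1]$) graphon maximizing $S$ among all graphons $g$ with $\varepsilon(g)=e$ and $\tau(g)=t$ is $$g_{e,t}(x,y)=\begin{cases} e-(e^3-t)^{1/3}, & 0<x,y<\tfrac12 \ \text{ or }\ \tfrac12<x,y<1,\\ e+(e^3-t)^{1/3}, & x<\tfrac12<y\ \text{ or }\ y<\tfrac12<x;\end{cases}$$ and the Boltzmann entropy $B(e,t)$ and, for every finite simple graph $F$, the density $t_F(g_{e,t})$ of $F$ are real analytic functions of $(e,t)$ on $\mathcal{O}$.
   Context: A graphon is a measurable symmetric function $g:[0,1]^2\to[0,1]$, with functions identified when they agree almost everywhere. Its edge density, triangle density and entropy are $$\varepsilon(g)=\iint g(x,y)\,dx\,dy,\qquad \tau(g)=\iiint g(x,y)g(y,z)g(z,x)\,dx\,dy\,dz,\qquad S(g)=\iint H[g(x,y)]\,dx\,dy,$$ where $H(u)=-[u\ln u+(1-u)\ln(1-u)]$ for $u\in[0,1]$ (with $0\ln 0=0$). Uniqueness "up to measure-preserving transformations" means: any two maximizers $g,h$ satisfy $g(\phi(x),\phi(y))=h(\psi(x),\psi(y))$ for a.e. $(x,y)$, for some measure-preserving maps $\phi,\psi:[0,1]\to[0,1]$. For a finite simple graph $F$ with vertex set $\{1,\dots,k\}$ and edge set $E(F)$, the density of $F$ in $g$ is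 $t_F(g)=\int_{[0,1]^k}\prod_{\{i,j\}\in E(F)}g(x_i,x_j)\,dx_1\cdots dx_k$. Boltzmann entropy: let $Z^{n,\delta}_{e,t}$ be the number of simple graphs on $n$ (labeled) nodes with edge density in $(e-\delta,e+\delta)$ and triangle density in $(t-\delta,t+\delta)$. Then $$B(e,t)=\lim_{\delta\searrow0}\ \lim_{n\to\infty}\frac1{n^2}\ln\big[Z^{n,\delta}_{e,t}\big].$$ *)

theory Defs
  imports "HOL-Analysis.Analysis"
begin

abbreviation unit_interval :: "real set" where
  "unit_interval \<equiv> {0..1}"

abbreviation unit_square :: "(real \<times> real) set" where
  "unit_square \<equiv> unit_interval \<times> unit_interval"

abbreviation unit_cube :: "(real \<times> real \<times> real) set" where
  "unit_cube \<equiv> unit_interval \<times> unit_interval \<times> unit_interval"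


text \<open>A graphon is represented by a function on all of the plane, of which only the restriction to
  the unit square matters. The identification of functions that agree almost everywhere is
  not built into the type; it is taken into account by \<open>graphon_equiv\<close> below.\<close>

definition graphon :: "(real \<Rightarrow> real \<Rightarrow> real) \<Rightarrow> bool" where
  "graphon g \<longleftrightarrow>
     (\<lambda>(x, y). g x y) \<in> borel_measurable (lebesgue_on unit_square) \<and>
     (\<forall>x\<in>unit_interval. \<forall>y\<in>unit_interval. g x y = g y x \<and> 0 \<le> g x y \<and> g x y \<le> 1)"

definition edge_density :: "(real \<Rightarrow> real \<Rightarrow> real) \<Rightarrow> real" where
  "edge_density g = (LINT (x, y)|lebesgue_on unit_square. g x y)"

definition triangle_density :: "(real \<Rightarrow> real \<Rightarrow> real) \<Rightarrow> real" where
  "triangle_density g = (LINT (x, y, z)|lebesgue_on unit_cube. g x y * g y z * g z x)"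

text \<open>Since \<open>0 * ln 0 = 0\<close> holds in HOL, no case distinction is needed at 0 and 1.\<close>

definition H :: "real \<Rightarrow> real" where
  "H u = - (u * ln u + (1 - u) * ln (1 - u))"

definition graphon_entropy :: "(real \<Rightarrow> real \<Rightarrow> real) \<Rightarrow> real" where
  "graphon_entropy g = (LINT (x, y)|lebesgue_on unit_square. H (g x y))"

definition entropy_maximizer :: "real \<Rightarrow> real \<Rightarrow> (real \<Rightarrow> real \<Rightarrow> real) \<Rightarrow> bool" where
  "entropy_maximizer e t g \<longleftrightarrow>
     graphon g \<and> edge_density g = e \<and> triangle_density g = t \<and>
     (\<forall>h. graphon h \<and> edge_density h = e \<and> triangle_density h = t
        \<longrightarrow> graphon_entropy h \<le> graphon_entropy g)"

definition measure_preserving_unit :: "(real \<Rightarrow> real) \<Rightarrow> bool" where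
  "measure_preserving_unit \<phi> \<longleftrightarrow>
     \<phi> \<in> lebesgue_on unit_interval \<rightarrow>\<^sub>M lebesgue_on unit_interval \<and>
     distr (lebesgue_on unit_interval) (lebesgue_on unit_interval) \<phi> = lebesgue_on unit_interval"

definition graphon_equiv :: "(real \<Rightarrow> real \<Rightarrow> real) \<Rightarrow> (real \<Rightarrow> real \<Rightarrow> real) \<Rightarrow> bool" where
  "graphon_equiv g h \<longleftrightarrow>
     (\<exists>\<phi> \<psi>. measure_preserving_unit \<phi> \<and> measure_preserving_unit \<psi> \<and>
        (AE (x, y) in lebesgue_on unit_square. g (\<phi> x) (\<phi> y) = h (\<psi> x) (\<psi> y)))"

text \<open>\<open>root 3\<close> is the real cube root. On the null set where \<open>x\<close> or \<open>y\<close> equals \<open>1/2\<close> the value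
  is immaterial; the second branch is used there.\<close>

definition bipodal_graphon :: "real \<Rightarrow> real \<Rightarrow> real \<Rightarrow> real \<Rightarrow> real" where
  "bipodal_graphon e t x y =
     (if x < 1/2 \<and> y < 1/2 \<or> 1/2 < x \<and> 1/2 < y
      then e - root 3 (e ^ 3 - t) else e + root 3 (e ^ 3 - t))"


text \<open>A simple graph with vertex set \<open>{1..n}\<close> is given by its set of edges.\<close>

definition simple_graph :: "nat \<Rightarrow> nat set set \<Rightarrow> bool" where
  "simple_graph n E \<longleftrightarrow> (\<forall>d\<in>E. d \<subseteq> {1..n} \<and> card d = 2)"

text \<open>The completion makes the base measure the Lebesgue measure on the \<open>k\<close>-dimensional unit cube,
  for which the integrand is measurable for every graphon. Each edge is counted once,
  as the pair of its end points in increasing order.\<close>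

definition subgraph_density :: "nat \<Rightarrow> nat set set \<Rightarrow> (real \<Rightarrow> real \<Rightarrow> real) \<Rightarrow> real" where
  "subgraph_density k E g =
     (LINT x|completion (\<Pi>\<^sub>M i\<in>{1..k}. lebesgue_on unit_interval).
        (\<Prod>(i, j)\<in>{(i, j). i < j \<and> {i, j} \<in> E}. g (x i) (x j)))"


text \<open>Edge and triangle density of a finite graph are the proportions of pairs and triples of
  vertices that span an edge or a triangle.\<close>

definition graph_edge_density :: "nat \<Rightarrow> nat set set \<Rightarrow> real" where
  "graph_edge_density n E = real (card E) / real (n choose 2)"

definition graph_triangles :: "nat \<Rightarrow> nat set set \<Rightarrow> nat set set" where
  "graph_triangles n E =
     {T. T \<subseteq> {1..n} \<and> card T = 3 \<and> (\<forall>i\<in>T. \<forall>j\<in>T. i \<noteq> j \<longrightarrow> {i, j} \<in> E)}"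

definition graph_triangle_density :: "nat \<Rightarrow> nat set set \<Rightarrow> real" where
  "graph_triangle_density n E = real (card (graph_triangles n E)) / real (n choose 3)"

definition graph_count :: "nat \<Rightarrow> real \<Rightarrow> real \<Rightarrow> real \<Rightarrow> nat" where
  "graph_count n \<delta> e t =
     card {E. simple_graph n E \<and>
              graph_edge_density n E \<in> {e - \<delta><..<e + \<delta>} \<and>
              graph_triangle_density n E \<in> {t - \<delta><..<t + \<delta>}}"

text \<open>The iterated limit exists and equals the real number \<open>s\<close>. Only small \<open>\<delta>\<close> matter. Since
  \<open>ln 0 = 0\<close> in HOL whereas \<open>ln 0\<close> should count as minus infinity here, the count is required to be
  positive for large \<open>n\<close>.\<close>

definition has_boltzmann_entropy :: "real \<Rightarrow> real \<Rightarrow> real \<Rightarrow> bool" where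
  "has_boltzmann_entropy e t s \<longleftrightarrow>
     (\<exists>L. (\<forall>\<^sub>F \<delta> in at_right 0.
              (\<forall>\<^sub>F n in sequentially. graph_count n \<delta> e t > 0) \<and>
              (\<lambda>n. ln (real (graph_count n \<delta> e t)) / (real n)\<^sup>2) \<longlonglongrightarrow> L \<delta>) \<and>
          (L \<longlongrightarrow> s) (at_right 0))"

lemma has_boltzmann_entropy_unique:
  assumes "has_boltzmann_entropy e t s" "has_boltzmann_entropy e t s'"
  shows "s = s'"
proof -
  let ?a = "\<lambda>\<delta> n. ln (real (graph_count n \<delta> e t)) / (real n)\<^sup>2"
  obtain L where L: "\<forall>\<^sub>F \<delta> in at_right 0. ?a \<delta> \<longlonglongrightarrow> L \<delta>" "(L \<longlongrightarrow> s) (at_right 0)"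
    using assms(1) unfolding has_boltzmann_entropy_def by (auto simp: eventually_conj_iff)
  obtain L' where L': "\<forall>\<^sub>F \<delta> in at_right 0. ?a \<delta> \<longlonglongrightarrow> L' \<delta>" "(L' \<longlongrightarrow> s') (at_right 0)"
    using assms(2) unfolding has_boltzmann_entropy_def by (auto simp: eventually_conj_iff)
  have "\<forall>\<^sub>F \<delta> in at_right 0. L \<delta> = L' \<delta>"
    using L(1) L'(1) by eventually_elim (rule LIMSEQ_unique)
  then have "(L' \<longlongrightarrow> s) (at_right 0)"
    using L(2) by (simp add: tendsto_cong)
  then show ?thesis
    using L'(2) tendsto_unique trivial_limit_at_right_real by blast
qed

definition boltzmann_entropy :: "real \<Rightarrow> real \<Rightarrow> real" where
  "boltzmann_entropy e t = (THE s. has_boltzmann_entropy e t s)"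

lemma boltzmann_entropy_eq: "has_boltzmann_entropy e t s \<Longrightarrow> boltzmann_entropy e t = s"
  unfolding boltzmann_entropy_def by (blast intro: has_boltzmann_entropy_unique)


text \<open>Real analyticity in two variables on an open set: near every point, the function is the sum
  of a convergent double power series (for real series, \<open>has_sum\<close> is absolute convergence).\<close>

definition real_analytic_on :: "(real \<Rightarrow> real \<Rightarrow> real) \<Rightarrow> (real \<times> real) set \<Rightarrow> bool" where
  "real_analytic_on f U \<longleftrightarrow>
     (\<forall>(a, b)\<in>U. \<exists>r>0. \<exists>c :: nat \<Rightarrow> nat \<Rightarrow> real.
        \<forall>x y. \<bar>x - a\<bar> < r \<and> \<bar>y - b\<bar> < r \<longrightarrow>
          ((\<lambda>(i, j). c i j * (x - a) ^ i * (y - b) ^ j) has_sum f x y) UNIV)"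

end

theory Submission
  imports Defs "HOL-Real_Asymp.Real_Asymp" "HOL-Probability.Probability"
begin

text \<open>Write \<open>a = (e\<^sup>3 - t)\<^sup>1\<^sup>/\<^sup>3\<close> and \<open>g = e + h\<close>, where \<open>h\<close> has mean zero. If \<open>d\<close> is the degree function of \<open>h\<close>,
  the triangle density of \<open>g\<close> is \<open>t\<close> iff \<open>3 e \<parallel>d\<parallel>\<^sup>2 + tr h\<^sup>3 = - a\<^sup>3\<close>, which forces
  \<open>\<integral> h\<^sup>2 \<ge> a\<^sup>2\<close>. The cubic Hermite interpolant of \<open>u \<mapsto> H (e + u)\<close> at \<open>\<plusminus> a\<close> majorizes this function
  with a quartic gain, so integrating it bounds the entropy up to its odd part. When the excess of
  \<open>\<integral> h\<^sup>2\<close> is small, \<open>h\<close> is close to \<open>- a v \<otimes> v\<close> with \<open>v = \<plusminus> 1\<close> of mean zero, and the odd part,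
  whose coefficient vanishes at \<open>e = 1/2\<close>, is absorbed by the quartic gain and this stability for
  \<open>e\<close> near \<open>1/2\<close>. In the case of equality \<open>h = - a v \<otimes> v\<close>, and a rearrangement of \<open>v\<close> gives uniqueness.

  For the Boltzmann entropy, weak regularity reduces the upper bound to the same variational
  problem for block densities of partitions of the vertices, and Chebyshev's inequality for a random
  graph with bipodal edge probabilities gives the lower bound. Hence the limit is half of the maximal
  entropy, an explicit analytic function of \<open>(e, t)\<close>.\<close>

section \<open>The entropy function\<close>

text \<open>The constraint pushes the integral of h^2 up because |tr h^3| is at most the cube of the
  Hilbert-Schmidt norm of h, with equality only in rank at most one; the nonnegative term 3 e |d|^2
  makes the trace still more negative. At e = 1/2 the function H (e + u) is even in u, and the even
  part of the majorant alone gives the bound. Away from e = 1/2 the integral of h^3 enters, and its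
  sign is not under control. It has to be bounded by the very quantities that the majorant gains:
  the excess E of the integral of h^2 over a^2, and the integral W of (h^2 - a^2)^2. Both vanish at
  the optimum, so an estimate linear in E + W is needed, with constants depending on e and a only. E
  alone yields closeness to a rank one kernel; W turns the rank one kernel into a sign kernel. The
  open set of the theorem is accordingly given by explicit inequalities, which say that the cubic
  coefficient is small compared with both gains.\<close>

definition H' :: "real \<Rightarrow> real" where
  "H' x = ln (1 - x) - ln x"

lemma has_real_derivative_H:
  assumes "0 < x" "x < 1"
  shows "(H has_real_derivative H' x) (at x)"
  unfolding H_def[abs_def] H'_def
  by (rule derivative_eq_intros refl | use assms in \<open>simp add: field_simps\<close>)+

lemma continuous_on_H: "continuous_on {0..1} H"
proof -
  have xlnx: "continuous_on {0..} (\<lambda>x::real. x * ln x)"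
  proof -
    have "continuous (at x within {0..}) (\<lambda>x::real. x * ln x)" if "x \<ge> 0" for x
    proof (cases "x = 0")
      case True
      have "((\<lambda>x::real. x * ln x) \<longlongrightarrow> 0) (at_right 0)" by real_asymp
      then have "((\<lambda>x::real. x * ln x) \<longlongrightarrow> 0) (at 0 within {0..})"
        by (simp add: at_within_Ici_at_right)
      then show ?thesis using True by (simp add: continuous_within)
    next
      case False
      then show ?thesis
        by (intro continuous_at_imp_continuous_at_within[OF isCont_mult] isCont_ln continuous_ident)
    qed
    then show ?thesis by (simp add: continuous_on_eq_continuous_within)
  qed
  have c1: "continuous_on {0..1} (\<lambda>x::real. x * ln x)"
    by (rule continuous_on_subset[OF xlnx]) auto
  have c2: "continuous_on {0..1} (\<lambda>x::real. (1 - x) * ln (1 - x))"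
    by (rule continuous_on_compose2[OF xlnx, of _ "\<lambda>x. 1 - x"])
      (simp_all add: continuous_on_diff image_subset_iff)
  show ?thesis
    using continuous_on_minus[OF continuous_on_add[OF c1 c2]] by (simp add: H_def[abs_def])
qed

lemma H_nonneg:
  assumes "0 \<le> x" "x \<le> 1"
  shows "0 \<le> H x"
proof -
  have "x * ln x \<le> 0" if "0 \<le> x" "x \<le> 1" for x :: real
    using that by (cases "x = 0") (auto simp: mult_nonneg_nonpos)
  from this[of x] this[of "1 - x"] show ?thesis using assms by (simp add: H_def)
qed

lemma H_le_1:
  assumes "0 \<le> x" "x \<le> 1"
  shows "H x \<le> 1"
proof -
  have *: "- (x * ln x) \<le> 1 - x" if "0 \<le> x" for x :: real
  proof (cases "x = 0")
    case False
    then have "ln (1/x) \<le> 1/x - 1" using that by (intro ln_le_minus_one) auto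
    then have "x * ln (1/x) \<le> x * (1/x - 1)" using that by (intro mult_left_mono)
    then show ?thesis using False that by (simp add: ln_div right_diff_distrib)
  qed auto
  from *[of x] *[of "1 - x"] show ?thesis using assms by (simp add: H_def)
qed

lemma borel_measurable_H [measurable]: "H \<in> borel_measurable borel"
  unfolding H_def[abs_def] by measurable

lemma H_one_minus: "H (1 - x) = H x" and H'_one_minus: "H' (1 - x) = - H' x"
  by (simp_all add: H_def H'_def)

lemma Rolle_real:
  fixes f f' :: "real \<Rightarrow> real"
  assumes "a < b" "f a = f b" "continuous_on {a..b} f"
    "\<And>x. a < x \<Longrightarrow> x < b \<Longrightarrow> (f has_real_derivative f' x) (at x)"
  obtains z where "a < z" "z < b" "f' z = 0"
proof -
  have diff: "f differentiable (at x)" if "a < x" "x < b" for x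
    using assms(4)[OF that] real_differentiable_def by blast
  obtain z where z: "a < z" "z < b" "DERIV f z :> 0"
    using Rolle[OF assms(1-3) diff] by blast
  then show thesis using that[OF z(1,2)] DERIV_unique[OF z(3) assms(4)[OF z(1,2)]] by simp
qed

text \<open>Rolle applied three times. It will be used for the first derivative of the interpolation
  error, whose four zeros lie strictly inside the interval where \<open>H\<close> is smooth; at the
  end points \<open>H\<close> is only continuous.\<close>

lemma third_derivative_zero:
  fixes f :: "real \<Rightarrow> real"
  assumes ord: "l < x1" "x1 < x2" "x2 < x3" "x3 < x4" "x4 < r"
    and z: "f x1 = 0" "f x2 = 0" "f x3 = 0" "f x4 = 0"
    and d: "\<And>x. l < x \<Longrightarrow> x < r \<Longrightarrow> (f has_real_derivative f1 x) (at x)"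
      "\<And>x. l < x \<Longrightarrow> x < r \<Longrightarrow> (f1 has_real_derivative f2 x) (at x)"
      "\<And>x. l < x \<Longrightarrow> x < r \<Longrightarrow> (f2 has_real_derivative f3 x) (at x)"
  shows "\<exists>x. l < x \<and> x < r \<and> f3 x = 0"
proof -
  have *: "\<exists>z. a < z \<and> z < b \<and> l < z \<and> z < r \<and> g' z = 0"
    if "l < a" "a < b" "b < r" "g a = 0" "g b = 0"
      and dg: "\<forall>x\<in>{l<..<r}. (g has_real_derivative g' x) (at x)" for a b g g'
  proof -
    have "continuous_on {a..b} g"
      using that by (intro continuous_at_imp_continuous_on ballI DERIV_isCont[OF dg[rule_format]]) auto
    moreover have "(g has_real_derivative g' x) (at x)" if "a < x" "x < b" for x
      using that \<open>l < a\<close> \<open>b < r\<close> by (intro dg[rule_format]) auto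
    ultimately obtain z where "a < z" "z < b" "g' z = 0"
      using Rolle_real[of a b g g'] \<open>a < b\<close> \<open>g a = 0\<close> \<open>g b = 0\<close> by metis
    then show ?thesis using that(1,3) by (intro exI[of _ z]) auto
  qed
  have d': "\<forall>x\<in>{l<..<r}. (f has_real_derivative f1 x) (at x)"
      "\<forall>x\<in>{l<..<r}. (f1 has_real_derivative f2 x) (at x)"
      "\<forall>x\<in>{l<..<r}. (f2 has_real_derivative f3 x) (at x)"
    using d by auto
  have ord': "l < x2" "l < x3" "x2 < r" "x3 < r" using ord by auto
  obtain y1 where y1: "x1 < y1" "y1 < x2" "l < y1" "y1 < r" "f1 y1 = 0"
    using *[OF ord(1,2) ord'(3) z(1,2) d'(1)] by blast
  obtain y2 where y2: "x2 < y2" "y2 < x3" "l < y2" "y2 < r" "f1 y2 = 0"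
    using *[OF ord'(1) ord(3) ord'(4) z(2,3) d'(1)] by blast
  obtain y3 where y3: "x3 < y3" "y3 < x4" "l < y3" "y3 < r" "f1 y3 = 0"
    using *[OF ord'(2) ord(4,5) z(3,4) d'(1)] by blast
  have y: "y1 < y2" "y2 < y3" using y1 y2 y3 by auto
  obtain w1 where w1: "y1 < w1" "w1 < y2" "l < w1" "w1 < r" "f2 w1 = 0"
    using *[OF y1(3) y(1) y2(4) y1(5) y2(5) d'(2)] by blast
  obtain w2 where w2: "y2 < w2" "w2 < y3" "l < w2" "w2 < r" "f2 w2 = 0"
    using *[OF y2(3) y(2) y3(4) y2(5) y3(5) d'(2)] by blast
  have "w1 < w2" using w1 w2 by auto
  then show ?thesis
    using *[OF w1(3) _ w2(4) w1(5) w2(5) d'(3)] by blast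
qed

text \<open>Chosen so that \<open>- even_coeff e a * (u\<^sup>2 - a\<^sup>2)\<close> has the same
  derivative at \<open>u = a\<close> as the even part of \<open>H (e + u)\<close>.\<close>

definition even_coeff :: "real \<Rightarrow> real \<Rightarrow> real" where
  "even_coeff e a = (H' (e - a) - H' (e + a)) / (4 * a)"

text \<open>The cubic coefficient of the polynomial \<open>B * u + D * u ^ 3\<close> that agrees
  with the odd part of \<open>H (e + u)\<close> in value and derivative at
  \<open>u = a\<close>.\<close>

definition odd_coeff :: "real \<Rightarrow> real \<Rightarrow> real" where
  "odd_coeff e a = (a * (H' (e + a) + H' (e - a)) - (H (e + a) - H (e - a))) / (4 * a ^ 3)"

text \<open>The left side is minus the fourth derivative of \<open>H\<close>, and 12 is the fourth
  derivative of \<open>(u\<^sup>2 - a\<^sup>2)\<^sup>2 / 2\<close>. One of \<open>x\<close> and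
  \<open>1 - x\<close> is at most 1/2 and already contributes 16.\<close>

lemma sum_inverse_cubes_gt:
  assumes "0 < x" "x < (1::real)"
  shows "2 / x ^ 3 + 2 / (1 - x) ^ 3 > 12"
proof -
  have *: "2 / y ^ 3 \<ge> 16" if "0 < y" "y \<le> 1/2" for y :: real
  proof -
    have "y ^ 3 \<le> (1/2) ^ 3" using that by (intro power_mono) auto
    then show ?thesis using that by (simp add: field_simps power3_eq_cube)
  qed
  have "2 / x ^ 3 > 0" "2 / (1 - x) ^ 3 > 0" using assms by auto
  then show ?thesis using *[of x] *[of "1 - x"] assms by (cases "x \<le> 1/2") linarith+
qed

text \<open>The majorant is the cubic Hermite interpolant of \<open>\<lambda>u. H (e + u)\<close> at \<open>\<plusminus> a\<close>; the
  quartic gain comes from the interpolation error, the fourth derivative of \<open>H\<close> being below \<open>-12\<close>.\<close>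

lemma H_le_Hermite:
  assumes a: "0 < a" "a < e" "a < 1 - e" and u: "0 \<le> e + u" "e + u \<le> 1"
  shows "H (e + u) \<le> (H (e - a) + H (e + a)) / 2 - even_coeff e a * (u\<^sup>2 - a\<^sup>2)
     + ((H (e + a) - H (e - a)) / (2 * a) - odd_coeff e a * a\<^sup>2) * u
     + odd_coeff e a * u ^ 3 - (u\<^sup>2 - a\<^sup>2)\<^sup>2 / 2"
proof (rule ccontr)
  define C where "C = even_coeff e a"
  define D where "D = odd_coeff e a"
  define B where "B = (H (e + a) - H (e - a)) / (2 * a) - D * a\<^sup>2"
  define S where "S = (H (e - a) + H (e + a)) / 2"
  \<comment> \<open>The parameter \<open>l\<close> is a free multiple of the squared node
    polynomial, as in the classical error formula for interpolation. It preserves the double zeros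
    at \<open>a\<close> and \<open>-a\<close> and is chosen below to create a further zero at
    \<open>u\<close>.\<close>
  define f where "f l x = H (e + x) - S + C * (x\<^sup>2 - a\<^sup>2) - B * x - D * x ^ 3 + (1/2 - l) * (x\<^sup>2 - a\<^sup>2)\<^sup>2"
    for l x
  define f1 where "f1 l x = H' (e + x) + 2 * C * x - B - 3 * D * x\<^sup>2 + (1/2 - l) * 4 * x * (x\<^sup>2 - a\<^sup>2)" for l x
  define f2 where "f2 l x = - 1 / (1 - (e + x)) - 1 / (e + x) + 2 * C - 6 * D * x
     + (1/2 - l) * (12 * x\<^sup>2 - 4 * a\<^sup>2)" for l x
  define f3 where "f3 l x = - 1 / (1 - (e + x))\<^sup>2 + 1 / (e + x)\<^sup>2 - 6 * D + (1/2 - l) * 24 * x" for l x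
  define f4 where "f4 l x = - 2 / (1 - (e + x)) ^ 3 - 2 / (e + x) ^ 3 + (1/2 - l) * 24" for l x
  assume "\<not> ?thesis"
  then have pos: "f 0 u > 0"
    by (simp add: f_def S_def C_def D_def B_def algebra_simps)
  have C: "4 * a * C = H' (e - a) - H' (e + a)"
    using a by (simp add: C_def even_coeff_def)
  have D: "4 * a ^ 3 * D = a * (H' (e + a) + H' (e - a)) - (H (e + a) - H (e - a))"
    using a by (simp add: D_def odd_coeff_def)
  have B: "2 * a * B = (H (e + a) - H (e - a)) - 2 * a ^ 3 * D"
    using a by (simp add: B_def field_simps power2_eq_square power3_eq_cube)
  have fa: "f l a = 0" "f l (-a) = 0" for l
  proof -
    have "2 * f l a = (H (e + a) - H (e - a)) - 2 * a * B - 2 * a ^ 3 * D"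
      by (simp add: f_def S_def field_simps)
    then show "f l a = 0" using B by simp
    have "2 * f l (-a) = - (H (e + a) - H (e - a)) + 2 * a * B + 2 * a ^ 3 * D"
      by (simp add: f_def S_def field_simps)
    then show "f l (-a) = 0" using B by simp
  qed
  have "2 * a * f1 l a = 0" "2 * a * f1 l (-a) = 0" for l
  proof -
    have "4 * a * f1 l a = 4 * a * H' (e + a) + 2 * a * (4 * a * C) - 2 * (2 * a * B) - 12 * a^3 * D"
      by (simp add: f1_def algebra_simps power2_eq_square power3_eq_cube)
    also have "\<dots> = 0" unfolding C B using D by (simp add: algebra_simps)
    finally show "2 * a * f1 l a = 0" by simp
    have "4 * a * f1 l (-a) = 4 * a * H' (e - a) - 2 * a * (4 * a * C) - 2 * (2 * a * B) - 12 * a^3 * D"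
      by (simp add: f1_def algebra_simps power2_eq_square power3_eq_cube)
    also have "\<dots> = 0" unfolding C B using D by (simp add: algebra_simps)
    finally show "2 * a * f1 l (-a) = 0" by simp
  qed
  then have f1a: "f1 l a = 0" "f1 l (-a) = 0" for l using a by auto
  have ua: "u \<noteq> a" "u \<noteq> -a" using pos fa by auto
  then have w: "(u\<^sup>2 - a\<^sup>2)\<^sup>2 > 0" by (auto simp: power2_eq_iff)
  define l where "l = f 0 u / (u\<^sup>2 - a\<^sup>2)\<^sup>2"
  have l: "l > 0" using pos w by (simp add: l_def)
  have fu: "f l u = 0"
  proof -
    have "f l u = f 0 u - l * (u\<^sup>2 - a\<^sup>2)\<^sup>2"
      unfolding f_def left_diff_distrib by simp
    also have "l * (u\<^sup>2 - a\<^sup>2)\<^sup>2 = f 0 u" using w unfolding l_def by simp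
    finally show ?thesis by simp
  qed
  have d1: "(f l has_real_derivative f1 l x) (at x)" if "-e < x" "x < 1 - e" for x
  proof -
    have "((\<lambda>x. H (e + x)) has_real_derivative H' (e + x) * 1) (at x)"
      using that by (intro DERIV_chain2[OF has_real_derivative_H]) (auto intro!: derivative_eq_intros)
    moreover have "((\<lambda>x. - S + C * (x\<^sup>2 - a\<^sup>2) - B * x - D * x ^ 3 + (1/2 - l) * (x\<^sup>2 - a\<^sup>2)\<^sup>2)
        has_real_derivative 2 * C * x - B - 3 * D * x\<^sup>2 + (1/2 - l) * 4 * x * (x\<^sup>2 - a\<^sup>2)) (at x)"
      by (rule derivative_eq_intros refl)+ (simp add: power2_eq_square)
    ultimately have "((\<lambda>x. H (e + x) + (- S + C * (x\<^sup>2 - a\<^sup>2) - B * x - D * x ^ 3 + (1/2 - l) * (x\<^sup>2 - a\<^sup>2)\<^sup>2))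
        has_real_derivative H' (e + x) * 1 + (2 * C * x - B - 3 * D * x\<^sup>2 + (1/2 - l) * 4 * x * (x\<^sup>2 - a\<^sup>2))) (at x)"
      by (rule DERIV_add)
    moreover have "f l = (\<lambda>x. H (e + x) + (- S + C * (x\<^sup>2 - a\<^sup>2) - B * x - D * x ^ 3 + (1/2 - l) * (x\<^sup>2 - a\<^sup>2)\<^sup>2))"
      by (auto simp: f_def)
    moreover have "f1 l x = H' (e + x) * 1 + (2 * C * x - B - 3 * D * x\<^sup>2 + (1/2 - l) * 4 * x * (x\<^sup>2 - a\<^sup>2))"
      by (simp add: f1_def)
    ultimately show ?thesis by simp
  qed
  have d2: "(f1 l has_real_derivative f2 l x) (at x)" if "-e < x" "x < 1 - e" for x
  proof -
    have pos: "e + x > 0" "1 - (e + x) > 0" using that by auto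
    have "((\<lambda>x. ln (1 - (e + x))) has_real_derivative 1 / (1 - (e + x)) * (- 1)) (at x)"
      using pos by (intro DERIV_chain2[OF DERIV_ln_divide]) (auto intro!: derivative_eq_intros)
    moreover have "((\<lambda>x. ln (e + x)) has_real_derivative 1 / (e + x) * 1) (at x)"
      using pos by (intro DERIV_chain2[OF DERIV_ln_divide]) (auto intro!: derivative_eq_intros)
    ultimately have "((\<lambda>x. H' (e + x)) has_real_derivative (1 / (1 - (e + x)) * (- 1) - 1 / (e + x) * 1)) (at x)"
      unfolding H'_def by (rule DERIV_diff)
    moreover have "((\<lambda>x. 2 * C * x - B - 3 * D * x\<^sup>2 + (1/2 - l) * 4 * x * (x\<^sup>2 - a\<^sup>2))
        has_real_derivative 2 * C - 6 * D * x + (1/2 - l) * (12 * x\<^sup>2 - 4 * a\<^sup>2)) (at x)"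
      by (rule derivative_eq_intros refl)+ (simp add: power2_eq_square algebra_simps)
    ultimately have "((\<lambda>x. H' (e + x) + (2 * C * x - B - 3 * D * x\<^sup>2 + (1/2 - l) * 4 * x * (x\<^sup>2 - a\<^sup>2)))
        has_real_derivative (1 / (1 - (e + x)) * (- 1) - 1 / (e + x) * 1)
          + (2 * C - 6 * D * x + (1/2 - l) * (12 * x\<^sup>2 - 4 * a\<^sup>2))) (at x)"
      by (rule DERIV_add)
    moreover have "f1 l = (\<lambda>x. H' (e + x) + (2 * C * x - B - 3 * D * x\<^sup>2 + (1/2 - l) * 4 * x * (x\<^sup>2 - a\<^sup>2)))"
      by (auto simp: f1_def)
    moreover have "f2 l x = (1 / (1 - (e + x)) * (- 1) - 1 / (e + x) * 1)
          + (2 * C - 6 * D * x + (1/2 - l) * (12 * x\<^sup>2 - 4 * a\<^sup>2))"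
      by (simp add: f2_def)
    ultimately show ?thesis by simp
  qed
  have d3: "(f2 l has_real_derivative f3 l x) (at x)" if "-e < x" "x < 1 - e" for x
  proof -
    have pos: "e + x > 0" "1 - (e + x) > 0" using that by auto
    have inv: "((\<lambda>y::real. - 1 / y) has_real_derivative 1 / y\<^sup>2) (at y)" if "y > 0" for y
      using that by (auto intro!: derivative_eq_intros simp: power2_eq_square)
    have "((\<lambda>x. - 1 / (1 - (e + x))) has_real_derivative 1 / (1 - (e + x))\<^sup>2 * (- 1)) (at x)"
      using pos by (intro DERIV_chain2[OF inv]) (auto intro!: derivative_eq_intros)
    moreover have "((\<lambda>x. - 1 / (e + x)) has_real_derivative 1 / (e + x)\<^sup>2 * 1) (at x)"
      using pos by (intro DERIV_chain2[OF inv]) (auto intro!: derivative_eq_intros)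
    ultimately have "((\<lambda>x. - 1 / (1 - (e + x)) + - 1 / (e + x)) has_real_derivative
        1 / (1 - (e + x))\<^sup>2 * (- 1) + 1 / (e + x)\<^sup>2 * 1) (at x)"
      by (rule DERIV_add)
    moreover have "((\<lambda>x. 2 * C - 6 * D * x + (1/2 - l) * (12 * x\<^sup>2 - 4 * a\<^sup>2))
        has_real_derivative - 6 * D + (1/2 - l) * 24 * x) (at x)"
      by (rule derivative_eq_intros refl)+ simp
    ultimately have "((\<lambda>x. - 1 / (1 - (e + x)) + - 1 / (e + x) + (2 * C - 6 * D * x + (1/2 - l) * (12 * x\<^sup>2 - 4 * a\<^sup>2)))
        has_real_derivative 1 / (1 - (e + x))\<^sup>2 * (- 1) + 1 / (e + x)\<^sup>2 * 1 + (- 6 * D + (1/2 - l) * 24 * x)) (at x)"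
      by (rule DERIV_add)
    moreover have "f2 l = (\<lambda>x. - 1 / (1 - (e + x)) + - 1 / (e + x) + (2 * C - 6 * D * x + (1/2 - l) * (12 * x\<^sup>2 - 4 * a\<^sup>2)))"
      by (auto simp: f2_def)
    moreover have "f3 l x = 1 / (1 - (e + x))\<^sup>2 * (- 1) + 1 / (e + x)\<^sup>2 * 1 + (- 6 * D + (1/2 - l) * 24 * x)"
      by (simp add: f3_def)
    ultimately show ?thesis by simp
  qed
  have d4: "(f3 l has_real_derivative f4 l x) (at x)" if "-e < x" "x < 1 - e" for x
  proof -
    have e: "e + x > 0" "1 - (e + x) > 0" using that by auto
    have sq: "((\<lambda>y::real. 1 / y^2) has_real_derivative - 2 / y ^ 3) (at y)" if "y > 0" for y
      using that by (auto intro!: derivative_eq_intros simp: field_simps power2_eq_square power3_eq_cube)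
    have i1: "((\<lambda>x. 1 / (e + x)^2) has_real_derivative - 2 / (e + x) ^ 3) (at x)"
      using DERIV_chain2[OF sq, of "\<lambda>x. e + x" x 1] e DERIV_add[OF DERIV_const[of e] DERIV_ident] by simp
    have "((\<lambda>x. 1 / (1 - (e + x))^2) has_real_derivative - 2 / (1 - (e + x)) ^ 3 * (- 1)) (at x)"
      using e by (intro DERIV_chain2[OF sq, of "\<lambda>x. 1 - (e + x)" x "- 1"]) (auto intro!: derivative_eq_intros)
    from DERIV_minus[OF this]
    have i2: "((\<lambda>x. - 1 / (1 - (e + x))^2) has_real_derivative - 2 / (1 - (e + x)) ^ 3) (at x)"
      by simp
    have i3: "((\<lambda>x. - 6 * D + (1/2 - l) * 24 * x) has_real_derivative (1/2 - l) * 24) (at x)"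
      by (auto intro!: derivative_eq_intros)
    have "f3 l = (\<lambda>x. - 1 / (1 - (e + x))^2 + 1 / (e + x)^2 + (- 6 * D + (1/2 - l) * 24 * x))"
      by (auto simp: f3_def)
    moreover have "f4 l x = - 2 / (1 - (e + x)) ^ 3 + - 2 / (e + x) ^ 3 + (1/2 - l) * 24"
      by (simp add: f4_def)
    ultimately show ?thesis using DERIV_add[OF DERIV_add[OF i2 i1] i3] by simp
  qed
  have cont: "continuous_on {-e..1-e} (f l)"
    unfolding f_def[abs_def]
    by (intro continuous_intros continuous_on_compose2[OF continuous_on_H]) auto
  have R: "\<exists>z. x < z \<and> z < y \<and> f1 l z = 0" if "-e \<le> x" "x < y" "y \<le> 1 - e" "f l x = 0" "f l y = 0" for x y
  proof -
    have "f l x = f l y" using that by simp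
    moreover have "continuous_on {x..y} (f l)" using that by (intro continuous_on_subset[OF cont]) auto
    moreover have "(f l has_real_derivative f1 l v) (at v)" if "x < v" "v < y" for v
      using that \<open>-e \<le> x\<close> \<open>y \<le> 1 - e\<close> by (intro d1) auto
    ultimately show ?thesis using Rolle_real[of x y "f l" "f1 l"] \<open>x < y\<close> by blast
  qed
  have ends: "-e \<le> u" "u \<le> 1 - e" "-e < -a" "a < 1 - e" "-a < a" "-e \<le> -a" "a \<le> 1 - e" using u a by auto
  \<comment> \<open>Rolle between neighbouring points among \<open>-a\<close>, \<open>a\<close>,
    \<open>u\<close> gives two zeros of \<open>f1 l\<close>; the double zeros at \<open>-a\<close>
    and \<open>a\<close> give two more. The cases differ in the order of the points. Although
    \<open>u\<close> may be an end point of the domain, all four zeros are interior.\<close>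
  have "\<exists>y1 y2 y3 y4. -e < y1 \<and> y1 < y2 \<and> y2 < y3 \<and> y3 < y4 \<and> y4 < 1 - e \<and>
      f1 l y1 = 0 \<and> f1 l y2 = 0 \<and> f1 l y3 = 0 \<and> f1 l y4 = 0"
  proof (cases "u < -a")
    case True
    have "a \<le> 1 - e" "-a \<le> 1 - e" using a by auto
    obtain z where z: "u < z" "z < -a" "f1 l z = 0"
      using R[OF ends(1) True \<open>-a \<le> 1 - e\<close> fu fa(2)] by blast
    obtain w where w: "-a < w" "w < a" "f1 l w = 0"
      using R[OF ends(6,5,7) fa(2,1)] by blast
    have "-e < z" using ends(1) z(1) by linarith
    then show ?thesis using z w f1a ends(4) by blast
  next
    case False
    then have ua1: "-a < u" using ua by linarith
    show ?thesis
    proof (cases "u < a")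
      case True
      obtain z where z: "-a < z" "z < u" "f1 l z = 0"
        using R[OF ends(6) ua1 ends(2) fa(2) fu] by blast
      obtain w where w: "u < w" "w < a" "f1 l w = 0"
        using R[OF ends(1) True ends(7) fu fa(1)] by blast
      have "z < w" using z w by linarith
      then show ?thesis using z w f1a ends(3,4) by blast
    next
      case False
      then have ua2: "a < u" using ua by linarith
      have ea: "-e \<le> a" using a by linarith
      obtain z where z: "-a < z" "z < a" "f1 l z = 0"
        using R[OF ends(6,5,7) fa(2,1)] by blast
      obtain w where w: "a < w" "w < u" "f1 l w = 0"
        using R[OF ea ua2 ends(2) fa(1) fu] by blast
      have "w < 1 - e" using w ends(2) by linarith
      then show ?thesis using z w f1a ends(3) by blast
    qed
  qed
  then obtain y1 y2 y3 y4 where y: "-e < y1" "y1 < y2" "y2 < y3" "y3 < y4" "y4 < 1 - e"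
      "f1 l y1 = 0" "f1 l y2 = 0" "f1 l y3 = 0" "f1 l y4 = 0" by blast
  have "\<exists>x. -e < x \<and> x < 1 - e \<and> f4 l x = 0"
    by (rule third_derivative_zero[OF y]) (fact d2 d3 d4)+
  then obtain x where x: "-e < x" "x < 1 - e" "f4 l x = 0" by blast
  have "f4 l x = - (2 / (1 - (e + x)) ^ 3) - 2 / (e + x) ^ 3 + 12 - 24 * l"
    unfolding f4_def left_diff_distrib by simp
  then show False
    using sum_inverse_cubes_gt[of "e + x"] l x by linarith
qed

section \<open>Kernels on a probability space\<close>

text \<open>The bound holds at every point and not only on the space of \<open>M\<close>, so that
  compositions and sections inherit it without side conditions.\<close>

definition bounded_measurable :: "'a measure \<Rightarrow> ('a \<Rightarrow> real) \<Rightarrow> bool" where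
  "bounded_measurable M f \<longleftrightarrow> f \<in> borel_measurable M \<and> (\<exists>B. \<forall>x. \<bar>f x\<bar> \<le> B)"

lemma bounded_measurableI:
  "f \<in> borel_measurable M \<Longrightarrow> (\<And>x. \<bar>f x\<bar> \<le> B) \<Longrightarrow> bounded_measurable M f"
  unfolding bounded_measurable_def by blast

lemma bounded_measurable_measurable: "bounded_measurable M f \<Longrightarrow> f \<in> borel_measurable M"
  unfolding bounded_measurable_def by blast

named_theorems bm_intros

lemma bounded_measurable_const [bm_intros]: "bounded_measurable M (\<lambda>_. c)"
  by (rule bounded_measurableI[of _ _ "\<bar>c\<bar>"]) auto

lemma bounded_measurable_uminus [bm_intros]:
  "bounded_measurable M f \<Longrightarrow> bounded_measurable M (\<lambda>x. - f x)"
  unfolding bounded_measurable_def by simp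

lemma bounded_measurable_add [bm_intros]:
  assumes "bounded_measurable M f" "bounded_measurable M g"
  shows "bounded_measurable M (\<lambda>x. f x + g x)"
proof -
  obtain B C where BC: "\<And>x. \<bar>f x\<bar> \<le> B" "\<And>x. \<bar>g x\<bar> \<le> C"
    using assms unfolding bounded_measurable_def by blast
  have "\<bar>f x + g x\<bar> \<le> B + C" for x using BC[of x] by linarith
  then show ?thesis
    by (intro bounded_measurableI[of _ _ "B + C"] borel_measurable_add assms[THEN bounded_measurable_measurable])
qed

lemma bounded_measurable_diff [bm_intros]:
  assumes "bounded_measurable M f" "bounded_measurable M g"
  shows "bounded_measurable M (\<lambda>x. f x - g x)"
  using bounded_measurable_add[OF assms(1) bounded_measurable_uminus[OF assms(2)]] by simp

lemma bounded_measurable_mult [bm_intros]: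
  assumes "bounded_measurable M f" "bounded_measurable M g"
  shows "bounded_measurable M (\<lambda>x. f x * g x)"
proof -
  obtain B C where BC: "\<And>x. \<bar>f x\<bar> \<le> B" "\<And>x. \<bar>g x\<bar> \<le> C"
    using assms unfolding bounded_measurable_def by blast
  have "\<bar>f x * g x\<bar> \<le> B * C" for x
    using BC[of x] by (simp add: abs_mult mult_mono')
  then show ?thesis
    by (intro bounded_measurableI[of _ _ "B * C"] borel_measurable_times assms[THEN bounded_measurable_measurable])
qed

lemma bounded_measurable_power [bm_intros]:
  assumes "bounded_measurable M f"
  shows "bounded_measurable M (\<lambda>x. f x ^ n)"
proof (induction n)
  case (Suc n)
  from bounded_measurable_mult[OF assms Suc] show ?case by simp
qed (simp add: bounded_measurable_const)

lemma bounded_measurable_compose: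
  assumes "bounded_measurable M f" "g \<in> N \<rightarrow>\<^sub>M M"
  shows "bounded_measurable N (\<lambda>x. f (g x))"
proof -
  obtain B where B: "\<And>x. \<bar>f x\<bar> \<le> B"
    using assms(1) unfolding bounded_measurable_def by blast
  show ?thesis
    by (rule bounded_measurableI[OF measurable_compose[OF assms(2)], of _ B])
      (use assms(1) B bounded_measurable_measurable in auto)
qed

lemma (in finite_measure) bounded_measurable_integrable:
  assumes "bounded_measurable M f"
  shows "integrable M f"
proof -
  obtain B where B: "\<And>x. \<bar>f x\<bar> \<le> B"
    using assms unfolding bounded_measurable_def by blast
  show ?thesis
    by (rule integrable_const_bound[of _ B]) (simp_all add: B bounded_measurable_measurable[OF assms])
qed

lemma (in prob_space) abs_integral_le:
  fixes f :: "'a \<Rightarrow> real"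
  assumes "f \<in> borel_measurable M" and B: "\<And>x. \<bar>f x\<bar> \<le> B"
  shows "\<bar>\<integral>x. f x \<partial>M\<bar> \<le> B"
proof -
  have i: "integrable M f"
    by (rule bounded_measurable_integrable[OF bounded_measurableI]) (use assms in auto)
  have "\<bar>\<integral>x. f x \<partial>M\<bar> \<le> (\<integral>x. \<bar>f x\<bar> \<partial>M)" by (rule integral_abs_bound)
  also have "\<dots> \<le> (\<integral>x. B \<partial>M)"
    by (rule integral_mono) (use i B in auto)
  finally show ?thesis by (simp add: prob_space)
qed

lemma bounded_measurable_integral:
  assumes "prob_space M" and f: "bounded_measurable (N \<Otimes>\<^sub>M M) (\<lambda>p. f (fst p) (snd p))"
  shows "bounded_measurable N (\<lambda>x. \<integral>y. f x y \<partial>M)"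
proof -
  interpret prob_space M by fact
  obtain B where "\<And>p. \<bar>f (fst p) (snd p)\<bar> \<le> B"
    using f unfolding bounded_measurable_def by blast
  from this[of "(_, _)"] have B: "\<bar>f x y\<bar> \<le> B" for x y by simp
  then have B0: "B \<ge> 0" using abs_ge_zero order_trans by blast
  have "(\<lambda>(x, y). f x y) \<in> borel_measurable (N \<Otimes>\<^sub>M M)"
    using bounded_measurable_measurable[OF f] by (simp add: split_def)
  then have m: "(\<lambda>x. \<integral>y. f x y \<partial>M) \<in> borel_measurable N"
    by (rule borel_measurable_lebesgue_integral)
  have "\<bar>\<integral>y. f x y \<partial>M\<bar> \<le> B" for x
  proof (cases "f x \<in> borel_measurable M")
    case True
    then show ?thesis using B by (intro abs_integral_le) auto
  next
    \<comment> \<open>This can only happen outside the space of \<open>N\<close>. A function that is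
      not integrable has integral 0, so the bound survives.\<close>
    case False
    then have "\<not> integrable M (f x)" by (auto dest: borel_measurable_integrable)
    then show ?thesis using B0 by (simp add: not_integrable_integral_eq)
  qed
  with m show ?thesis by (rule bounded_measurableI)
qed

text \<open>Symmetry and boundedness are imposed everywhere instead of almost everywhere; a graphon
  is first replaced by a version with these properties.\<close>

locale kernel = prob_space M for M :: "'a measure" +
  fixes h :: "'a \<Rightarrow> 'a \<Rightarrow> real"
  assumes measurable_kernel: "(\<lambda>p. h (fst p) (snd p)) \<in> borel_measurable (M \<Otimes>\<^sub>M M)"
    and kernel_sym: "h x y = h y x"
    and kernel_le_1: "\<bar>h x y\<bar> \<le> 1"
begin

abbreviation P where "P \<equiv> M \<Otimes>\<^sub>M M"

sublocale MM: pair_prob_space M M ..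
sublocale PM: pair_prob_space "M \<Otimes>\<^sub>M M" M ..

lemma bm_kernel [bm_intros]:
  assumes "f \<in> N \<rightarrow>\<^sub>M M" "g \<in> N \<rightarrow>\<^sub>M M"
  shows "bounded_measurable N (\<lambda>p. h (f p) (g p))"
proof -
  have "(\<lambda>p. (f p, g p)) \<in> N \<rightarrow>\<^sub>M M \<Otimes>\<^sub>M M" using assms by measurable
  from measurable_compose[OF this measurable_kernel] show ?thesis
    by (intro bounded_measurableI[of _ _ 1] kernel_le_1) simp
qed

lemmas bm_integral [bm_intros] = bounded_measurable_integral[OF prob_space_axioms]

lemma bm_integral_P [bm_intros]:
  "bounded_measurable (N \<Otimes>\<^sub>M P) (\<lambda>p. f (fst p) (snd p)) \<Longrightarrow> bounded_measurable N (\<lambda>x. \<integral>y. f x y \<partial>P)"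
  by (rule bounded_measurable_integral) unfold_locales

lemmas ibl_M = bounded_measurable_integrable
lemmas ibl_P = MM.bounded_measurable_integrable

lemma integral_P_iterated:
  assumes "bounded_measurable P (\<lambda>p. f (fst p) (snd p))"
  shows "(\<integral>p. f (fst p) (snd p) \<partial>P) = (\<integral>x. (\<integral>y. f x y \<partial>M) \<partial>M)"
    and "(\<integral>p. f (fst p) (snd p) \<partial>P) = (\<integral>y. (\<integral>x. f x y \<partial>M) \<partial>M)"
proof -
  have "integrable P (case_prod f)" using ibl_P[OF assms] by (simp add: split_def)
  from MM.integral_fst[OF this] MM.integral_snd[OF this]
  show "(\<integral>p. f (fst p) (snd p) \<partial>P) = (\<integral>x. (\<integral>y. f x y \<partial>M) \<partial>M)"
    "(\<integral>p. f (fst p) (snd p) \<partial>P) = (\<integral>y. (\<integral>x. f x y \<partial>M) \<partial>M)"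
    by (simp_all add: split_def)
qed

lemma integral_P_product:
  assumes "bounded_measurable M f" "bounded_measurable M g"
  shows "(\<integral>p. f (fst p) * g (snd p) \<partial>P) = (\<integral>x. f x \<partial>M) * (\<integral>x. g x \<partial>M)"
proof -
  have "bounded_measurable P (\<lambda>p. f (fst p) * g (snd p))"
    by (intro bm_intros bounded_measurable_compose[OF assms(1)] bounded_measurable_compose[OF assms(2)]) auto
  then have "(\<integral>p. f (fst p) * g (snd p) \<partial>P) = (\<integral>x. (\<integral>y. f x * g y \<partial>M) \<partial>M)"
    by (rule integral_P_iterated(1))
  then show ?thesis by simp
qed

lemma integral_PM_swap:
  assumes "bounded_measurable (P \<Otimes>\<^sub>M M) (\<lambda>p. f (fst p) (snd p))"
  shows "(\<integral>p. (\<integral>z. f p z \<partial>M) \<partial>P) = (\<integral>z. (\<integral>p. f p z \<partial>P) \<partial>M)"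
proof -
  have "integrable (P \<Otimes>\<^sub>M M) (case_prod f)"
    using PM.bounded_measurable_integrable[OF assms] by (simp add: split_def)
  from PM.Fubini_integral[OF this] show ?thesis by simp
qed

definition degree_fun :: "'a \<Rightarrow> real" where
  "degree_fun x = (\<integral>y. h x y \<partial>M)"

text \<open>The squared Hilbert-Schmidt norm of the integral operator with kernel \<open>h\<close>;
  \<open>trace3\<close> below is the trace of the cube of this operator.\<close>

definition sq_norm :: real where
  "sq_norm = (\<integral>p. (h (fst p) (snd p))\<^sup>2 \<partial>P)"

definition sq_degree :: real where
  "sq_degree = (\<integral>x. (degree_fun x)\<^sup>2 \<partial>M)"

definition trace3 :: real where
  "trace3 = (\<integral>p. h (fst p) (snd p) * (\<integral>z. h (snd p) z * h z (fst p) \<partial>M) \<partial>P)"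

definition row_norm :: "'a \<Rightarrow> real" where
  "row_norm z = (\<integral>x. (h x z)\<^sup>2 \<partial>M)"

text \<open>The quadratic form of the operator with kernel \<open>h\<close> at the row
  \<open>h z\<close>. As \<open>row_norm z\<close> is the squared norm of that row,
  \<open>row_form z / row_norm z\<close> is a Rayleigh quotient.\<close>

definition row_form :: "'a \<Rightarrow> real" where
  "row_form z = (\<integral>p. h (fst p) (snd p) * h (snd p) z * h z (fst p) \<partial>P)"

lemma bm_degree_fun [bm_intros]: "bounded_measurable M degree_fun"
  unfolding degree_fun_def[abs_def] by (intro bm_intros) auto

lemma bm_row_norm [bm_intros]: "bounded_measurable M row_norm"
  unfolding row_norm_def[abs_def] by (intro bm_intros) auto

lemma bm_row_form [bm_intros]: "bounded_measurable M row_form"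
  unfolding row_form_def[abs_def] by (intro bm_intros) auto

lemma integral_row_norm: "(\<integral>z. row_norm z \<partial>M) = sq_norm"
  unfolding row_norm_def sq_norm_def
  by (rule integral_P_iterated(2)[symmetric]) (intro bm_intros; simp)

lemma integral_row_form: "(\<integral>z. row_form z \<partial>M) = trace3"
proof -
  have "trace3 = (\<integral>p. (\<integral>z. h (fst p) (snd p) * h (snd p) z * h z (fst p) \<partial>M) \<partial>P)"
    unfolding trace3_def by (simp add: mult.assoc)
  also have "\<dots> = (\<integral>z. row_form z \<partial>M)"
    unfolding row_form_def by (rule integral_PM_swap) (intro bm_intros; simp)
  finally show ?thesis ..
qed

text \<open>A quadratic polynomial in \<open>c\<close>. Its nonnegativity gives the Cauchy-Schwarz
  inequality below, and its minimum is the distance from \<open>h\<close> to the multiples of the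
  rank one kernel built from the row \<open>h z\<close>.\<close>

lemma sq_norm_shift:
  assumes z: "z \<in> space M"
  shows "(\<integral>p. (h (fst p) (snd p) + c * (h z (fst p) * h z (snd p)))\<^sup>2 \<partial>P)
    = sq_norm + 2 * c * row_form z + c\<^sup>2 * (row_norm z)\<^sup>2"
proof -
  have bz: "bounded_measurable M (\<lambda>x. (h z x)\<^sup>2)" using z by (intro bm_intros) auto
  have i: "integrable P (\<lambda>p. (h (fst p) (snd p))\<^sup>2)"
    "integrable P (\<lambda>p. 2 * c * (h (fst p) (snd p) * h (snd p) z * h z (fst p)))"
    "integrable P (\<lambda>p. c\<^sup>2 * ((h z (fst p))\<^sup>2 * (h z (snd p))\<^sup>2))"
    using z by (intro ibl_P bm_intros; simp)+
  have "(\<integral>p. (h (fst p) (snd p) + c * (h z (fst p) * h z (snd p)))\<^sup>2 \<partial>P)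
    = (\<integral>p. (h (fst p) (snd p))\<^sup>2 + 2 * c * (h (fst p) (snd p) * h (snd p) z * h z (fst p))
        + c\<^sup>2 * ((h z (fst p))\<^sup>2 * (h z (snd p))\<^sup>2) \<partial>P)"
    by (intro Bochner_Integration.integral_cong)
      (simp_all add: kernel_sym[of _ z] power2_eq_square algebra_simps)
  also have "\<dots> = sq_norm + 2 * c * row_form z + c\<^sup>2 * ((\<integral>x. (h z x)\<^sup>2 \<partial>M) * (\<integral>x. (h z x)\<^sup>2 \<partial>M))"
    using i integral_P_product[OF bz bz] by (simp add: sq_norm_def row_form_def)
  also have "(\<integral>x. (h z x)\<^sup>2 \<partial>M) = row_norm z"
    by (simp add: row_norm_def kernel_sym[of _ z])
  finally show ?thesis by (simp add: power2_eq_square)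
qed

text \<open>Cauchy-Schwarz for \<open>h\<close> and the rank one kernel of the row
  \<open>h z\<close>, whose Hilbert-Schmidt norm is \<open>row_norm z\<close>.\<close>

lemma row_form_sq_le:
  assumes z: "z \<in> space M"
  shows "(row_form z)\<^sup>2 \<le> sq_norm * (row_norm z)\<^sup>2"
proof (cases "row_norm z = 0")
  case True
  have q: "0 \<le> sq_norm + 2 * c * row_form z" for c
  proof -
    have "0 \<le> (\<integral>p. (h (fst p) (snd p) + c * (h z (fst p) * h z (snd p)))\<^sup>2 \<partial>P)" by simp
    then show ?thesis unfolding sq_norm_shift[OF z] using True by simp
  qed
  have "row_form z = 0"
  proof (rule ccontr)
    assume nz: "row_form z \<noteq> 0"
    \<comment> \<open>With this \<open>c\<close> the affine function of \<open>q\<close> takes the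
      negative value \<open>- sq_norm - 2\<close>.\<close>
    have "0 \<le> sq_norm - 2 * (sq_norm + 1)"
      using q[of "- (sq_norm + 1) / row_form z"] nz by simp
    moreover have "sq_norm \<ge> 0" unfolding sq_norm_def by simp
    ultimately show False by simp
  qed
  then show ?thesis using True by simp
next
  case False
  define c where "c = - row_form z / (row_norm z)\<^sup>2"
  have "0 \<le> (\<integral>p. (h (fst p) (snd p) + c * (h z (fst p) * h z (snd p)))\<^sup>2 \<partial>P)" by simp
  then have "0 \<le> sq_norm + 2 * c * row_form z + c\<^sup>2 * (row_norm z)\<^sup>2"
    unfolding sq_norm_shift[OF z] .
  also have "\<dots> = sq_norm - (row_form z)\<^sup>2 / (row_norm z)\<^sup>2"
    using False by (simp add: c_def field_simps power2_eq_square)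
  finally show ?thesis using False by (simp add: field_simps)
qed

lemma sq_norm_le_1: "sq_norm \<le> 1"
proof -
  have "\<bar>sq_norm\<bar> \<le> 1"
    unfolding sq_norm_def
    by (intro MM.abs_integral_le bounded_measurable_measurable bm_intros)
      (auto simp: abs_square_le_1 kernel_le_1)
  then show ?thesis by simp
qed

lemma sq_degree_nonneg: "sq_degree \<ge> 0"
  unfolding sq_degree_def by simp

text \<open>Averaging \<open>row_form\<close> over \<open>z\<close> replaces the spectral theorem: some row \<open>h z\<close> is nearly
  an eigenvector for the lowest eigenvalue.\<close>

lemma good_row:
  assumes T: "trace3 < 0"
  shows "sq_norm > 0"
    and "\<exists>z\<in>space M. row_norm z > 0 \<and> - row_form z * sq_norm \<ge> - trace3 * row_norm z"
proof -
  have nn: "row_norm z \<ge> 0" for z unfolding row_norm_def by simp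
  have N0: "sq_norm \<ge> 0" unfolding sq_norm_def by simp
  have N: "sq_norm > 0"
  proof (rule ccontr)
    assume "\<not> ?thesis"
    then have "sq_norm = 0" using N0 by simp
    then have "(\<integral>z. row_form z \<partial>M) = (\<integral>z. 0 \<partial>M)"
      using row_form_sq_le by (intro Bochner_Integration.integral_cong) auto
    then show False using integral_row_form T by simp
  qed
  \<comment> \<open>If no row is good, \<open>F\<close> is positive where \<open>row_norm\<close> is
    positive and zero elsewhere. But its integral is
    \<open>- trace3 * sq_norm + trace3 * sq_norm = 0\<close>, so \<open>row_norm\<close> would
    vanish almost everywhere, against \<open>sq_norm > 0\<close>.\<close>
  define F where "F z = - trace3 * row_norm z + row_form z * sq_norm" for z
  have iF: "integrable M F" unfolding F_def[abs_def] by (intro ibl_M bm_intros)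
  have "integrable M row_norm" "integrable M row_form" by (intro ibl_M bm_intros)+
  then have F0: "(\<integral>z. F z \<partial>M) = 0"
    unfolding F_def by (simp add: integral_row_norm integral_row_form)
  show "sq_norm > 0" by (rule N)
  show "\<exists>z\<in>space M. row_norm z > 0 \<and> - row_form z * sq_norm \<ge> - trace3 * row_norm z"
  proof (rule ccontr)
    assume no: "\<not> ?thesis"
    have neg: "F z > 0" if "z \<in> space M" "row_norm z > 0" for z
    proof -
      have "\<not> - row_form z * sq_norm \<ge> - trace3 * row_norm z" using no that by blast
      then show ?thesis by (simp add: F_def)
    qed
    have zero: "F z = 0" if "z \<in> space M" "row_norm z = 0" for z
      using row_form_sq_le[OF that(1)] that(2) by (simp add: F_def)
    have F_nn: "F z \<ge> 0" if "z \<in> space M" for z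
    proof (cases "row_norm z = 0")
      case False
      then have "row_norm z > 0" using nn[of z] by linarith
      from neg[OF that this] show ?thesis by linarith
    qed (simp add: zero that)
    have "AE z in M. F z = 0"
      using integral_nonneg_eq_0_iff_AE[OF iF] F_nn F0 by auto
    then have "AE z in M. row_norm z = 0"
    proof (rule AE_mp, intro AE_I2 impI)
      fix z assume "z \<in> space M" "F z = 0"
      then have "\<not> row_norm z > 0" using neg[of z] by force
      then show "row_norm z = 0" using nn[of z] by linarith
    qed
    then have "(\<integral>z. row_norm z \<partial>M) = (\<integral>z. 0 \<partial>M)"
      by (intro integral_cong_AE bounded_measurable_measurable bm_intros) auto
    then show False using integral_row_norm N by simp
  qed
qed

end

text \<open>Hypothesis \<open>c\<close> is the inequality between trace and Hilbert-Schmidt norm,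
  with \<open>a ^ 3 + X\<close> as minus the trace. For \<open>s = sqrt N\<close> it reads
  \<open>a ^ 3 + X \<le> s ^ 3\<close>, and \<open>s ^ 3 - a ^ 3\<close> is at most a multiple of
  \<open>s - a\<close>, hence of the excess \<open>N - a\<^sup>2\<close>.\<close>

lemma sqrt_stability:
  fixes a N X :: real
  assumes a: "0 < a" and N: "0 \<le> N" "N \<le> 1" and X: "0 \<le> X" and c: "(a ^ 3 + X)\<^sup>2 \<le> N ^ 3"
  shows "a\<^sup>2 \<le> N" "X \<le> 3 * (N - a\<^sup>2) / a"
proof -
  define s where "s = sqrt N"
  have s: "0 \<le> s" "s \<le> 1" "s\<^sup>2 = N" using N by (auto simp: s_def)
  have "(a ^ 3 + X)\<^sup>2 \<le> (s ^ 3)\<^sup>2" using c by (simp add: s(3)[symmetric] flip: power_mult)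
  then have le: "a ^ 3 + X \<le> s ^ 3"
    by (rule power2_le_imp_le) (use s in simp)
  then have "a ^ 3 \<le> s ^ 3" using X by linarith
  then have as: "a \<le> s" using a s by (simp add: power_mono_iff)
  then show "a\<^sup>2 \<le> N" using a s(3) by (metis less_imp_le power_mono)
  have "s ^ 3 - a ^ 3 = (s - a) * (s\<^sup>2 + s * a + a\<^sup>2)"
    by (simp add: power2_eq_square power3_eq_cube algebra_simps)
  also have "\<dots> \<le> (s - a) * 3"
  proof (rule mult_left_mono)
    have "s\<^sup>2 \<le> 1" "a\<^sup>2 \<le> 1" "s * a \<le> 1"
      using s a as by (auto intro: power_le_one mult_le_one)
    then show "s\<^sup>2 + s * a + a\<^sup>2 \<le> 3" by linarith
  qed (use as in simp)
  finally have X1: "X \<le> 3 * (s - a)" using le by linarith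
  have "a * (s - a) \<le> (s + a) * (s - a)"
    using as s a by (intro mult_right_mono) auto
  also have "\<dots> = N - a\<^sup>2" using s(3) by (simp add: power2_eq_square algebra_simps)
  finally have "s - a \<le> (N - a\<^sup>2) / a" using a by (simp add: pos_le_divide_eq mult.commute)
  then have "3 * (s - a) \<le> 3 * ((N - a\<^sup>2) / a)" by (rule mult_left_mono) simp
  with X1 have "X \<le> 3 * ((N - a\<^sup>2) / a)" by (rule order_trans)
  then show "X \<le> 3 * (N - a\<^sup>2) / a" by simp
qed

text \<open>\<open>m\<close> will be minus the Rayleigh quotient of a good row, and
  \<open>N - m\<^sup>2\<close> the squared distance to a rank one kernel. Multiplied by
  \<open>N\<^sup>2\<close> it is at most \<open>N ^ 3 - a ^ 6\<close>, a difference of cubes with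
  the factor \<open>N - a\<^sup>2\<close>.\<close>

lemma rank_one_defect:
  fixes a N m :: real
  assumes a: "0 < a" "a\<^sup>2 \<le> N" and m: "a ^ 3 \<le> m * N"
  shows "N - m\<^sup>2 \<le> 3 * (N - a\<^sup>2)"
proof -
  have N: "N > 0" using a by (smt (verit) zero_less_power)
  have "(a ^ 3)\<^sup>2 \<le> (m * N)\<^sup>2" using m a by (intro power_mono) auto
  then have m2: "a ^ 6 \<le> m\<^sup>2 * N\<^sup>2" by (simp add: power_mult_distrib flip: power_mult)
  define b where "b = a\<^sup>2"
  have b: "0 < b" "b \<le> N" "a ^ 6 = b ^ 3" using a by (auto simp: b_def simp flip: power_mult)
  have "(N - m\<^sup>2) * N\<^sup>2 \<le> N ^ 3 - b ^ 3"
    using m2 b by (simp add: power2_eq_square power3_eq_cube algebra_simps)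
  also have "\<dots> = (N - b) * (N\<^sup>2 + N * b + b\<^sup>2)"
    by (simp add: power2_eq_square power3_eq_cube algebra_simps)
  also have "\<dots> \<le> (N - b) * (3 * N\<^sup>2)"
  proof (rule mult_left_mono)
    have "N * b \<le> N * N" "b * b \<le> N * N" using b by (auto intro: mult_mono)
    then show "N\<^sup>2 + N * b + b\<^sup>2 \<le> 3 * N\<^sup>2" by (simp add: power2_eq_square)
  qed (use b in simp)
  finally have "(N - m\<^sup>2) * N\<^sup>2 \<le> (3 * (N - b)) * N\<^sup>2" by (simp add: algebra_simps)
  then show ?thesis using N by (simp add: b_def)
qed

text \<open>The pointwise passage from rank one to signs: \<open>p\<close> is a value of the kernel,
  \<open>- k\<close> that of its rank one approximation, and \<open>b\<close> a sign compatible with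
  \<open>k\<close>. If \<open>p * b \<le> 0\<close>, then \<open>p\<^sup>2 - a\<^sup>2\<close> is
  \<open>p + a * b\<close> times a factor of modulus at least \<open>a\<close>. Otherwise
  \<open>p\<close> and \<open>k\<close> do not have opposite signs, so
  \<open>(p + k)\<^sup>2 \<ge> p\<^sup>2\<close>, and \<open>p\<^sup>2\<close> cannot be close both
  to 0 and to \<open>a\<^sup>2\<close>.\<close>

lemma sign_defect:
  fixes a p k b :: real
  assumes a: "0 < a" "a \<le> 1" and p: "\<bar>p\<bar> \<le> 1" and b: "b = 1 \<or> b = -1" and k: "0 \<le> k * b"
  shows "(p + a * b)\<^sup>2 \<le> 8 / a ^ 4 * ((p + k)\<^sup>2 + (p\<^sup>2 - a\<^sup>2)\<^sup>2)"
proof -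
  have a4: "a ^ 4 \<le> 1" "a ^ 4 > 0" "a\<^sup>2 \<le> 1" "a\<^sup>2 > 0" using a by (auto intro: power_le_one)
  have aux1: "X \<le> 8 * (Y + X)" if "0 \<le> X" "0 \<le> Y" for X Y :: real using that by simp
  have aux2: "A \<le> 8 * (Y + X)" if "A \<le> q * 4" "q \<le> 2 * Y + 2 * X" for A q X Y :: real
    using that by simp
  have main: "a ^ 4 * (p + a * b)\<^sup>2 \<le> 8 * ((p + k)\<^sup>2 + (p\<^sup>2 - a\<^sup>2)\<^sup>2)"
  proof (cases "p * b \<le> 0")
    case True
    define s where "s = p - a * b"
    have "p\<^sup>2 - a\<^sup>2 = (p + a * b) * s"
      using b by (auto simp: s_def power2_eq_square algebra_simps)
    then have w: "(p\<^sup>2 - a\<^sup>2)\<^sup>2 = (p + a * b)\<^sup>2 * s\<^sup>2" by (simp add: power_mult_distrib)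
    have "a\<^sup>2 \<le> s\<^sup>2"
    proof -
      have "s\<^sup>2 = p\<^sup>2 - 2 * (a * (p * b)) + a\<^sup>2" using b by (auto simp: s_def power2_eq_square algebra_simps)
      moreover have "a * (p * b) \<le> 0" using True a by (simp add: mult_nonneg_nonpos)
      ultimately show ?thesis using zero_le_power2[of p] by linarith
    qed
    moreover have "a ^ 4 \<le> a\<^sup>2" using a by (intro power_decreasing) auto
    ultimately have "a ^ 4 \<le> s\<^sup>2" by linarith
    then have "a ^ 4 * (p + a * b)\<^sup>2 \<le> s\<^sup>2 * (p + a * b)\<^sup>2" by (rule mult_right_mono) simp
    also have "\<dots> = (p\<^sup>2 - a\<^sup>2)\<^sup>2" using w by simp
    also have "\<dots> \<le> 8 * ((p + k)\<^sup>2 + (p\<^sup>2 - a\<^sup>2)\<^sup>2)"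
      by (rule aux1) simp_all
    finally show ?thesis .
  next
    case False
    have pk: "0 \<le> p * k"
    proof (cases "b = 1")
      case True
      then show ?thesis using False k by simp
    next
      case False
      then have "b = -1" using b by simp
      then show ?thesis using \<open>\<not> p * b \<le> 0\<close> k by (simp add: mult_nonpos_nonpos)
    qed
    have "p\<^sup>2 \<le> (p + k)\<^sup>2"
      using pk zero_le_power2[of k] by (simp add: power2_sum mult.assoc)
    have p2: "p\<^sup>2 \<le> 1" using p by (simp add: abs_square_le_1)
    have "(p\<^sup>2)\<^sup>2 \<le> p\<^sup>2" using p2 by (simp add: power2_eq_square mult_left_le)
    have "(a\<^sup>2)\<^sup>2 \<le> 2 * (p\<^sup>2)\<^sup>2 + 2 * (p\<^sup>2 - a\<^sup>2)\<^sup>2"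
      using zero_le_power2[of "2 * p\<^sup>2 - a\<^sup>2"] by (simp add: power2_eq_square algebra_simps)
    then have a4le: "a ^ 4 \<le> 2 * (p + k)\<^sup>2 + 2 * (p\<^sup>2 - a\<^sup>2)\<^sup>2"
      using \<open>p\<^sup>2 \<le> (p + k)\<^sup>2\<close> \<open>(p\<^sup>2)\<^sup>2 \<le> p\<^sup>2\<close> by (simp flip: power_mult)
    have "\<bar>p + a * b\<bar> \<le> 2" using p a b by auto
    then have "(p + a * b)\<^sup>2 \<le> 4" using power_mono[of "\<bar>p + a * b\<bar>" 2 2] by simp
    then have "a ^ 4 * (p + a * b)\<^sup>2 \<le> a ^ 4 * 4" using a4 by (intro mult_left_mono) auto
    then show ?thesis using a4le by (rule aux2)
  qed
  have "(p + a * b)\<^sup>2 \<le> 8 * ((p + k)\<^sup>2 + (p\<^sup>2 - a\<^sup>2)\<^sup>2) / a ^ 4"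
    using main a4 by (simp add: pos_le_divide_eq mult.commute)
  then show ?thesis by simp
qed

text \<open>Taylor expansion of the cube at \<open>- a * b\<close>, using
  \<open>b\<^sup>2 = 1\<close>. The linear part is kept because its integral can be computed
  exactly.\<close>

lemma cube_defect:
  fixes a p b :: real
  assumes "0 < a" "a \<le> 1" "\<bar>p\<bar> \<le> 1" and b: "b = 1 \<or> b = -1"
  shows "\<bar>p ^ 3 - (- (a ^ 3) * b + 3 * a\<^sup>2 * (p + a * b))\<bar> \<le> 5 * (p + a * b)\<^sup>2"
proof -
  define r where "r = p + a * b"
  have "p ^ 3 - (- (a ^ 3) * b + 3 * a\<^sup>2 * r) = (r - 3 * a * b) * r\<^sup>2"
    using b by (auto simp: r_def power2_eq_square power3_eq_cube algebra_simps)
  moreover have "\<bar>r - 3 * a * b\<bar> \<le> 5" using assms by (auto simp: r_def)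
  ultimately show ?thesis
    using mult_right_mono[of "\<bar>r - 3 * a * b\<bar>" 5 "r\<^sup>2"] by (simp add: abs_mult r_def)
qed

section \<open>Closeness of a kernel to a sign kernel\<close>

context kernel
begin

definition quartic_defect :: "real \<Rightarrow> real" where
  "quartic_defect a = (\<integral>p. ((h (fst p) (snd p))\<^sup>2 - a\<^sup>2)\<^sup>2 \<partial>P)"

definition sign_dist :: "real \<Rightarrow> ('a \<Rightarrow> real) \<Rightarrow> real" where
  "sign_dist a v = (\<integral>p. (h (fst p) (snd p) + a * (v (fst p) * v (snd p)))\<^sup>2 \<partial>P)"

lemma bm_sign:
  assumes "v \<in> borel_measurable M" "\<And>x. v x = 1 \<or> v x = (-1::real)"
  shows "bounded_measurable M v"
  using assms(2) by (intro bounded_measurableI[OF assms(1), of 1]) (metis abs_1 abs_minus_cancel order_refl)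

lemma integral_square_le:
  assumes "bounded_measurable M f"
  shows "(\<integral>x. f x \<partial>M)\<^sup>2 \<le> (\<integral>x. (f x)\<^sup>2 \<partial>M)"
proof -
  define c where "c = (\<integral>x. f x \<partial>M)"
  have i: "integrable M f" "integrable M (\<lambda>x. (f x)\<^sup>2)"
    using assms by (intro ibl_M bm_intros; assumption)+
  have "0 \<le> (\<integral>x. (f x - c)\<^sup>2 \<partial>M)" by simp
  also have "\<dots> = (\<integral>x. (f x)\<^sup>2 - 2 * c * f x + c\<^sup>2 \<partial>M)"
    by (intro Bochner_Integration.integral_cong) (auto simp: power2_eq_square algebra_simps)
  also have "\<dots> = (\<integral>x. (f x)\<^sup>2 \<partial>M) - c\<^sup>2"
    using i by (simp add: prob_space power2_eq_square flip: c_def)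
  finally show ?thesis by (simp add: c_def)
qed

text \<open>\<open>X\<close> will be \<open>3 * e * sq_degree\<close>. The degrees, the distance to
  a sign kernel, the mean of the signs and the cubic integral are all controlled by the excess
  \<open>sq_norm - a\<^sup>2\<close> and by \<open>quartic_defect a\<close>, the two quantities in
  which the majorant of the entropy gains.\<close>

lemma near_extremal:
  assumes a: "0 < a" "a \<le> 1" and X: "0 \<le> X"
    and mean: "(\<integral>p. h (fst p) (snd p) \<partial>P) = 0"
    and T: "trace3 = - (a ^ 3 + X)"
  obtains v where "v \<in> borel_measurable M" "\<forall>x. v x = 1 \<or> v x = -1"
    "a\<^sup>2 \<le> sq_norm" "X \<le> 3 * (sq_norm - a\<^sup>2) / a"
    "sign_dist a v \<le> 8 / a ^ 4 * (3 * (sq_norm - a\<^sup>2) + quartic_defect a)"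
    "(a * (\<integral>x. v x \<partial>M))\<^sup>2 \<le> 2 * sq_degree + 2 * sign_dist a v"
    "\<bar>\<integral>p. (h (fst p) (snd p)) ^ 3 \<partial>P\<bar> \<le> 4 * sq_degree + 9 * sign_dist a v"
proof -
  have a3: "a ^ 3 > 0" using a by simp
  have Tneg: "trace3 < 0" using T a3 X by linarith
  obtain z where z: "z \<in> space M" "row_norm z > 0" "- row_form z * sq_norm \<ge> - trace3 * row_norm z"
    using good_row(2)[OF Tneg] by blast
  have N: "sq_norm > 0" by (rule good_row(1)[OF Tneg])
  \<comment> \<open>Minus the Rayleigh quotient of the good row. The choice of the row gives
    \<open>m * sq_norm \<ge> - trace3\<close>, and Cauchy-Schwarz gives
    \<open>m\<^sup>2 \<le> sq_norm\<close>; together they yield the inequality between trace and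
    norm without eigenvalues.\<close>
  define m where "m = - row_form z / row_norm z"
  have m: "- trace3 \<le> m * sq_norm"
  proof (rule mult_right_le_imp_le[OF _ z(2)])
    have "m * row_norm z = - row_form z" using z(2) by (simp add: m_def)
    moreover have "m * sq_norm * row_norm z = (m * row_norm z) * sq_norm" by (simp only: mult_ac)
    ultimately have "m * sq_norm * row_norm z = - row_form z * sq_norm" by simp
    then show "- trace3 * row_norm z \<le> m * sq_norm * row_norm z" using z(3) by simp
  qed
  have m2: "m\<^sup>2 \<le> sq_norm"
    using row_form_sq_le[OF z(1)] z(2) by (simp add: m_def power_divide pos_divide_le_eq)
  have "(a ^ 3 + X)\<^sup>2 \<le> (m * sq_norm)\<^sup>2"
    using m T a3 X by (intro power_mono) auto
  also have "\<dots> \<le> sq_norm * sq_norm\<^sup>2" unfolding power_mult_distrib using m2 by (intro mult_right_mono) auto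
  also have "\<dots> = sq_norm ^ 3" by (simp add: power2_eq_square power3_eq_cube)
  finally have stab: "(a ^ 3 + X)\<^sup>2 \<le> sq_norm ^ 3" .
  note aN = sqrt_stability[OF a(1) less_imp_le[OF N] sq_norm_le_1 X stab]
  have defect: "sq_norm - m\<^sup>2 \<le> 3 * (sq_norm - a\<^sup>2)"
    using m T X by (intro rank_one_defect a aN) auto
  \<comment> \<open>The minimizer in \<open>sq_norm_shift\<close>: the kernel
    \<open>- c * (h z x * h z y)\<close> is the orthogonal projection of \<open>h\<close> to the
    line spanned by the rank one kernel of the row. The signs \<open>v\<close> of this row are the
    signs of the optimal kernel.\<close>
  define c where "c = m / row_norm z"
  have c0: "c \<ge> 0"
  proof -
    have "m * sq_norm > 0" using m Tneg by linarith
    then have "m > 0" using N by (simp add: zero_less_mult_iff)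
    then show ?thesis using z by (simp add: c_def)
  qed
  have shift: "(\<integral>p. (h (fst p) (snd p) + c * (h z (fst p) * h z (snd p)))\<^sup>2 \<partial>P) = sq_norm - m\<^sup>2"
  proof -
    have "row_form z = - m * row_norm z" using z(2) by (simp add: m_def)
    then show ?thesis unfolding sq_norm_shift[OF z(1)] using z(2)
      by (simp add: c_def power2_eq_square)
  qed
  define v :: "'a \<Rightarrow> real" where "v x = (if h z x \<ge> 0 then 1 else -1)" for x
  have vm [measurable]: "v \<in> borel_measurable M"
  proof -
    have "bounded_measurable M (\<lambda>x. h z x)" using z(1) by (intro bm_intros) auto
    then have [measurable]: "(\<lambda>x. h z x) \<in> borel_measurable M" by (rule bounded_measurable_measurable)
    show ?thesis unfolding v_def[abs_def] by measurable
  qed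
  have v: "v x = 1 \<or> v x = -1" for x by (simp add: v_def)
  have bv: "bounded_measurable M v" by (rule bm_sign[OF vm v])
  have bvf [bm_intros]: "bounded_measurable N' (\<lambda>p. v (f p))" if "f \<in> N' \<rightarrow>\<^sub>M M" for f :: "'b \<Rightarrow> 'a" and N'
    by (rule bounded_measurable_compose[OF bv that])
  have bvfst: "bounded_measurable P (\<lambda>p. v (fst p))" "bounded_measurable P (\<lambda>p. v (snd p))"
    by (rule bounded_measurable_compose[OF bv]; simp)+
  have bh: "bounded_measurable P (\<lambda>p. h (fst p) (snd p))" by (intro bm_intros; simp)
  have bzf: "bounded_measurable P (\<lambda>p. h z (fst p))" "bounded_measurable P (\<lambda>p. h z (snd p))"
    using z(1) by (intro bm_intros; simp)+
  note bms = bm_intros bvfst bh bzf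
  have vv: "v x * v y = 1 \<or> v x * v y = -1" for x y using v[of x] v[of y] by auto
  define E where "E = sq_norm - a\<^sup>2"
  define W where "W = quartic_defect a"
  define R where "R = sign_dist a v"
  have R: "R \<le> 8 / a ^ 4 * (3 * E + W)"
  proof -
    have i: "integrable P (\<lambda>p. (h (fst p) (snd p) + c * (h z (fst p) * h z (snd p)))\<^sup>2)"
      "integrable P (\<lambda>p. ((h (fst p) (snd p))\<^sup>2 - a\<^sup>2)\<^sup>2)"
      "integrable P (\<lambda>p. (h (fst p) (snd p) + a * (v (fst p) * v (snd p)))\<^sup>2)"
      by (intro ibl_P bms)+
    have "R \<le> (\<integral>p. 8 / a ^ 4 * ((h (fst p) (snd p) + c * (h z (fst p) * h z (snd p)))\<^sup>2
        + ((h (fst p) (snd p))\<^sup>2 - a\<^sup>2)\<^sup>2) \<partial>P)"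
      unfolding R_def sign_dist_def
    proof (rule integral_mono)
      fix p
      have "0 \<le> (c * (h z (fst p) * h z (snd p))) * (v (fst p) * v (snd p))"
        using c0 by (auto simp: v_def zero_le_mult_iff mult_le_0_iff)
      then show "(h (fst p) (snd p) + a * (v (fst p) * v (snd p)))\<^sup>2
        \<le> 8 / a ^ 4 * ((h (fst p) (snd p) + c * (h z (fst p) * h z (snd p)))\<^sup>2
          + ((h (fst p) (snd p))\<^sup>2 - a\<^sup>2)\<^sup>2)"
        by (rule sign_defect[OF a kernel_le_1 vv])
    qed (use i in simp_all)
    also have "\<dots> = 8 / a ^ 4 * ((sq_norm - m\<^sup>2) + W)"
      using i by (simp add: shift W_def quartic_defect_def)
    also have "\<dots> \<le> 8 / a ^ 4 * (3 * E + W)"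
      using defect a by (intro mult_left_mono) (auto simp: E_def)
    finally show ?thesis .
  qed
  have R0: "R \<ge> 0" unfolding R_def sign_dist_def by simp
  define mu where "mu = (\<integral>x. v x \<partial>M)"
  define rho where "rho x y = h x y + a * (v x * v y)" for x y
  have brho: "bounded_measurable P (\<lambda>p. rho (fst p) (snd p))"
    unfolding rho_def by (intro bms)
  have M: "(a * mu)\<^sup>2 \<le> 2 * sq_degree + 2 * R"
  proof -
    \<comment> \<open>Integrating \<open>rho x y\<close> over \<open>y\<close> gives
      \<open>degree_fun x + a * mu * v x\<close>. Since \<open>v\<close> has modulus 1, small
      degrees and a small \<open>rho\<close> force a small mean \<open>mu\<close>.\<close>
    define s where "s x = (\<integral>y. rho x y \<partial>M)" for x
    have bs: "bounded_measurable M s" unfolding s_def[abs_def] by (intro bm_integral brho)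
    have brx: "bounded_measurable M (\<lambda>y. rho x y)" if "x \<in> space M" for x
      unfolding rho_def using that by (intro bm_intros bv) auto
    have sx: "s x = degree_fun x + a * mu * v x" if "x \<in> space M" for x
    proof -
      have "integrable M (\<lambda>y. h x y)" "integrable M v"
        using that by (intro ibl_M bm_intros bv; simp)+
      then show ?thesis
        by (simp add: s_def rho_def degree_fun_def mu_def mult_ac)
    qed
    have ss: "(s x)\<^sup>2 \<le> (\<integral>y. (rho x y)\<^sup>2 \<partial>M)" if "x \<in> space M" for x
      unfolding s_def by (rule integral_square_le[OF brx[OF that]])
    have brx2: "bounded_measurable M (\<lambda>x. \<integral>y. (rho x y)\<^sup>2 \<partial>M)"
      by (intro bm_intros brho)
    have i: "integrable M (\<lambda>x. (s x)\<^sup>2)" "integrable M (\<lambda>x. (degree_fun x)\<^sup>2)"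
       "integrable M (\<lambda>x. \<integral>y. (rho x y)\<^sup>2 \<partial>M)"
      by (intro ibl_M bm_intros bs brx2)+
    have "(a * mu)\<^sup>2 = (\<integral>x. (a * mu)\<^sup>2 \<partial>M)" by (simp add: prob_space)
    also have "\<dots> \<le> (\<integral>x. 2 * (degree_fun x)\<^sup>2 + 2 * (\<integral>y. (rho x y)\<^sup>2 \<partial>M) \<partial>M)"
    proof (rule integral_mono)
      fix x assume x: "x \<in> space M"
      have "(a * mu)\<^sup>2 = (a * mu * v x)\<^sup>2" using v[of x] by auto
      also have "\<dots> = (s x - degree_fun x)\<^sup>2" using sx[OF x] by simp
      also have "\<dots> \<le> 2 * (degree_fun x)\<^sup>2 + 2 * (s x)\<^sup>2"
        using zero_le_power2[of "s x + degree_fun x"] by (simp add: power2_eq_square algebra_simps)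
      also have "\<dots> \<le> 2 * (degree_fun x)\<^sup>2 + 2 * (\<integral>y. (rho x y)\<^sup>2 \<partial>M)"
        using ss[OF x] by simp
      finally show "(a * mu)\<^sup>2 \<le> 2 * (degree_fun x)\<^sup>2 + 2 * (\<integral>y. (rho x y)\<^sup>2 \<partial>M)" .
    qed (use i in simp_all)
    also have "\<dots> = 2 * sq_degree + 2 * (\<integral>x. (\<integral>y. (rho x y)\<^sup>2 \<partial>M) \<partial>M)"
      using i by (simp add: sq_degree_def)
    also have "(\<integral>x. (\<integral>y. (rho x y)\<^sup>2 \<partial>M) \<partial>M) = (\<integral>p. (rho (fst p) (snd p))\<^sup>2 \<partial>P)"
      by (rule integral_P_iterated(1)[symmetric]) (intro bm_intros brho)
    also have "\<dots> = R" by (simp add: R_def sign_dist_def rho_def)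
    finally show ?thesis .
  qed
  have C: "\<bar>\<integral>p. (h (fst p) (snd p)) ^ 3 \<partial>P\<bar> \<le> 4 * sq_degree + 9 * R"
  proof -
    have i: "integrable P (\<lambda>p. (h (fst p) (snd p)) ^ 3)" "integrable P (\<lambda>p. v (fst p) * v (snd p))"
        "integrable P (\<lambda>p. h (fst p) (snd p))"
        "integrable P (\<lambda>p. (rho (fst p) (snd p))\<^sup>2)"
      by (intro ibl_P bms brho)+
    have mu2: "(\<integral>p. v (fst p) * v (snd p) \<partial>P) = mu\<^sup>2"
      unfolding integral_P_product[OF bv bv] by (simp add: mu_def power2_eq_square)
    \<comment> \<open>The tangent of the cube at \<open>- a * (v x * v y)\<close>. As
      \<open>h\<close> has mean zero, its integral is \<open>2 * a ^ 3 * mu\<^sup>2\<close>, at most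
      \<open>4 * sq_degree + 4 * R\<close> by \<open>M\<close>; the quadratic remainder adds
      \<open>5 * R\<close>.\<close>
    let ?L = "\<lambda>p. - (a ^ 3) * (v (fst p) * v (snd p)) + 3 * a\<^sup>2 * (h (fst p) (snd p) + a * (v (fst p) * v (snd p)))"
    have L: "(\<integral>p. ?L p \<partial>P) = 2 * a ^ 3 * mu\<^sup>2"
      using i by (simp add: mu2 mean power2_eq_square power3_eq_cube)
    have iL: "integrable P ?L" using i by simp
    have "\<bar>(\<integral>p. (h (fst p) (snd p)) ^ 3 \<partial>P) - (\<integral>p. ?L p \<partial>P)\<bar> = \<bar>\<integral>p. (h (fst p) (snd p)) ^ 3 - ?L p \<partial>P\<bar>"
      using i(1) iL by (simp only: Bochner_Integration.integral_diff)
    also have "\<dots> \<le> (\<integral>p. \<bar>(h (fst p) (snd p)) ^ 3 - ?L p\<bar> \<partial>P)" by (rule integral_abs_bound)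
    also have "\<dots> \<le> (\<integral>p. 5 * (rho (fst p) (snd p))\<^sup>2 \<partial>P)"
    proof (rule integral_mono)
      show "\<bar>(h (fst p) (snd p)) ^ 3 - ?L p\<bar> \<le> 5 * (rho (fst p) (snd p))\<^sup>2" for p
        unfolding rho_def by (rule cube_defect[OF a kernel_le_1 vv])
    qed (use i iL in simp_all)
    also have "\<dots> = 5 * R" using i by (simp add: R_def sign_dist_def rho_def)
    finally have "\<bar>(\<integral>p. (h (fst p) (snd p)) ^ 3 \<partial>P)\<bar> \<le> 2 * a ^ 3 * mu\<^sup>2 + 5 * R"
    proof -
      assume "\<bar>(\<integral>p. (h (fst p) (snd p)) ^ 3 \<partial>P) - (\<integral>p. ?L p \<partial>P)\<bar> \<le> 5 * R"
      moreover have "0 \<le> 2 * a ^ 3 * mu\<^sup>2" using a by simp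
      ultimately show ?thesis unfolding L by linarith
    qed
    moreover have "a ^ 3 * mu\<^sup>2 \<le> (a * mu)\<^sup>2"
      using a by (simp add: power_mult_distrib mult_right_mono power_decreasing)
    ultimately show ?thesis using M by linarith
  qed
  show thesis
    by (rule that[OF vm allI[OF v] aN R[unfolded R_def E_def W_def] M[unfolded mu_def R_def] C[unfolded R_def]])
qed

end

section \<open>The parameter region and the entropy bound\<close>

definition amp :: "real \<Rightarrow> real \<Rightarrow> real" where
  "amp e t = root 3 (e ^ 3 - t)"

definition opt_entropy :: "real \<Rightarrow> real \<Rightarrow> real" where
  "opt_entropy e t = (H (e - amp e t) + H (e + amp e t)) / 2"

text \<open>A bound for the cubic term per unit of \<open>E + W\<close> in
  \<open>entropy_bound\<close>. The estimates of \<open>near_extremal\<close> give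
  \<open>4 / (e * a)\<close> from the degrees and \<open>9 * 24 / a ^ 4 = 216 / a ^ 4\<close> from
  the distance to the sign kernel; 12 and 228 are larger round values.\<close>

definition odd_loss :: "real \<Rightarrow> real \<Rightarrow> real" where
  "odd_loss e a = \<bar>odd_coeff e a\<bar> * (12 / (e * a) + 228 / a ^ 4)"

text \<open>The last two inequalities compare the odd loss with the two gains:
  \<open>even_coeff\<close> per unit of excess of the square norm, and 1/2 per unit of the quartic
  defect. The first three keep the two values of the bipodal graphon distinct and strictly between 0
  and 1.\<close>

definition region :: "(real \<times> real) set" where
  "region = {(e, t). 0 < amp e t \<and> amp e t < e \<and> amp e t < 1 - e \<and>
     odd_loss e (amp e t) < even_coeff e (amp e t) \<and> odd_loss e (amp e t) < 1/2}"

lemma amp_cubed: "amp e t ^ 3 = e ^ 3 - t"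
  unfolding amp_def by (rule odd_real_root_pow) simp

context kernel
begin

text \<open>Of the eight terms of the product, the linear ones vanish with the mean, each of the
  three quadratic ones integrates to \<open>sq_degree\<close>, and the cubic one is
  \<open>trace3\<close>.\<close>

lemma triangle_expansion:
  assumes mean: "(\<integral>p. h (fst p) (snd p) \<partial>P) = 0"
  shows "(\<integral>p. (e + h (fst p) (snd p)) * (\<integral>z. (e + h (snd p) z) * (e + h z (fst p)) \<partial>M) \<partial>P)
    = e ^ 3 + 3 * e * sq_degree + trace3"
proof -
  define k where "k x y = (\<integral>z. h y z * h z x \<partial>M)" for x y
  have bk: "bounded_measurable P (\<lambda>p. k (fst p) (snd p))"
    unfolding k_def by (intro bm_intros; simp)
  have bd: "bounded_measurable P (\<lambda>p. degree_fun (fst p))" "bounded_measurable P (\<lambda>p. degree_fun (snd p))"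
    by (rule bounded_measurable_compose[OF bm_degree_fun]; simp)+
  have bh: "bounded_measurable P (\<lambda>p. h (fst p) (snd p))" by (intro bm_intros; simp)
  have inner: "(\<integral>z. (e + h (snd p) z) * (e + h z (fst p)) \<partial>M)
      = e\<^sup>2 + e * degree_fun (snd p) + e * degree_fun (fst p) + k (fst p) (snd p)" if "p \<in> space P" for p
  proof -
    have sp: "fst p \<in> space M" "snd p \<in> space M" using that by (auto simp: space_pair_measure)
    have i: "integrable M (\<lambda>z. h (snd p) z)" "integrable M (\<lambda>z. h (fst p) z)"
      "integrable M (\<lambda>z. h (snd p) z * h z (fst p))"
      using sp by (intro ibl_M bm_intros; simp)+
    have "(\<integral>z. (e + h (snd p) z) * (e + h z (fst p)) \<partial>M)
      = (\<integral>z. e\<^sup>2 + e * h (snd p) z + e * h (fst p) z + h (snd p) z * h z (fst p) \<partial>M)"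
      by (intro Bochner_Integration.integral_cong)
        (auto simp: kernel_sym[of _ "fst p"] power2_eq_square algebra_simps)
    also have "\<dots> = e\<^sup>2 + e * degree_fun (snd p) + e * degree_fun (fst p) + k (fst p) (snd p)"
      using i by (simp add: prob_space degree_fun_def k_def)
    finally show ?thesis .
  qed
  have d0: "(\<integral>x. degree_fun x \<partial>M) = 0"
    unfolding degree_fun_def integral_P_iterated(1)[OF bh, symmetric] by (rule mean)
  have one: "bounded_measurable M (\<lambda>_. 1)" by (rule bounded_measurable_const)
  have I1: "(\<integral>p. degree_fun (fst p) \<partial>P) = 0" "(\<integral>p. degree_fun (snd p) \<partial>P) = 0"
    using integral_P_product[OF bm_degree_fun one] integral_P_product[OF one bm_degree_fun]
    by (simp_all add: d0)
  have hd1: "(\<integral>p. h (fst p) (snd p) * degree_fun (fst p) \<partial>P) = sq_degree"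
  proof -
    have "(\<integral>p. h (fst p) (snd p) * degree_fun (fst p) \<partial>P) = (\<integral>x. (\<integral>y. h x y * degree_fun x \<partial>M) \<partial>M)"
      by (rule integral_P_iterated(1)) (intro bm_intros bh bd)
    then show ?thesis by (simp add: sq_degree_def degree_fun_def power2_eq_square)
  qed
  have hd2: "(\<integral>p. h (fst p) (snd p) * degree_fun (snd p) \<partial>P) = sq_degree"
  proof -
    have "(\<integral>p. h (fst p) (snd p) * degree_fun (snd p) \<partial>P) = (\<integral>y. (\<integral>x. h x y * degree_fun y \<partial>M) \<partial>M)"
      by (rule integral_P_iterated(2)) (intro bm_intros bh bd)
    then show ?thesis
      by (simp add: sq_degree_def degree_fun_def power2_eq_square kernel_sym)
  qed
  have k0: "(\<integral>p. k (fst p) (snd p) \<partial>P) = sq_degree"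
  proof -
    have "(\<integral>p. k (fst p) (snd p) \<partial>P) = (\<integral>z. (\<integral>p. h (snd p) z * h z (fst p) \<partial>P) \<partial>M)"
      unfolding k_def by (rule integral_PM_swap) (intro bm_intros; simp)
    also have "\<dots> = (\<integral>z. (degree_fun z)\<^sup>2 \<partial>M)"
    proof (rule Bochner_Integration.integral_cong)
      fix z assume "z \<in> space M"
      then have b: "bounded_measurable M (\<lambda>x. h z x)" by (intro bm_intros) auto
      have "(\<integral>p. h (snd p) z * h z (fst p) \<partial>P) = (\<integral>p. h z (fst p) * h z (snd p) \<partial>P)"
        by (simp add: kernel_sym[of _ z] mult.commute)
      also have "\<dots> = (degree_fun z)\<^sup>2"
        unfolding integral_P_product[OF b b] by (simp add: degree_fun_def power2_eq_square)
      finally show "(\<integral>p. h (snd p) z * h z (fst p) \<partial>P) = (degree_fun z)\<^sup>2" .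
    qed simp
    finally show ?thesis by (simp add: sq_degree_def)
  qed
  have i: "integrable P (\<lambda>p. h (fst p) (snd p))" "integrable P (\<lambda>p. degree_fun (fst p))"
    "integrable P (\<lambda>p. degree_fun (snd p))" "integrable P (\<lambda>p. k (fst p) (snd p))"
    "integrable P (\<lambda>p. h (fst p) (snd p) * degree_fun (fst p))"
    "integrable P (\<lambda>p. h (fst p) (snd p) * degree_fun (snd p))"
    "integrable P (\<lambda>p. h (fst p) (snd p) * k (fst p) (snd p))"
    by (intro ibl_P bm_intros bh bd bk)+
  have "(\<integral>p. (e + h (fst p) (snd p)) * (\<integral>z. (e + h (snd p) z) * (e + h z (fst p)) \<partial>M) \<partial>P)
    = (\<integral>p. e ^ 3 + e\<^sup>2 * degree_fun (snd p) + e\<^sup>2 * degree_fun (fst p) + e * k (fst p) (snd p)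
        + e\<^sup>2 * h (fst p) (snd p) + e * (h (fst p) (snd p) * degree_fun (snd p))
        + e * (h (fst p) (snd p) * degree_fun (fst p)) + h (fst p) (snd p) * k (fst p) (snd p) \<partial>P)"
  proof (rule Bochner_Integration.integral_cong[OF refl])
    fix p assume p: "p \<in> space P"
    show "(e + h (fst p) (snd p)) * (\<integral>z. (e + h (snd p) z) * (e + h z (fst p)) \<partial>M)
      = e ^ 3 + e\<^sup>2 * degree_fun (snd p) + e\<^sup>2 * degree_fun (fst p) + e * k (fst p) (snd p)
        + e\<^sup>2 * h (fst p) (snd p) + e * (h (fst p) (snd p) * degree_fun (snd p))
        + e * (h (fst p) (snd p) * degree_fun (fst p)) + h (fst p) (snd p) * k (fst p) (snd p)"
      unfolding inner[OF p] by (simp add: power2_eq_square power3_eq_cube algebra_simps)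
  qed
  also have "\<dots> = e ^ 3 + 3 * e * sq_degree + trace3"
  proof -
    have tr: "trace3 = (\<integral>p. h (fst p) (snd p) * k (fst p) (snd p) \<partial>P)"
      by (simp add: trace3_def k_def)
    show ?thesis using i by (simp add: MM.prob_space I1 hd1 hd2 k0 mean tr)
  qed
  finally show ?thesis .
qed

text \<open>The integral of the Hermite majorant is
  \<open>opt_entropy e t - C * E + D * I3 - W / 2\<close>, the linear term disappearing with the
  mean. In \<open>region\<close> the gains exceed the loss \<open>D * I3\<close>. Equality therefore
  forces \<open>E = W = 0\<close>, and then the estimates of \<open>near_extremal\<close> make the
  degrees, the mean of \<open>v\<close> and the distance to the sign kernel vanish.\<close>

lemma entropy_bound:
  assumes reg: "(e, t) \<in> region"
    and mean: "(\<integral>p. h (fst p) (snd p) \<partial>P) = 0"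
    and T: "e ^ 3 + 3 * e * sq_degree + trace3 = t"
    and range: "\<And>x y. 0 \<le> e + h x y" "\<And>x y. e + h x y \<le> 1"
  shows "(\<integral>p. H (e + h (fst p) (snd p)) \<partial>P) \<le> opt_entropy e t"
    and "(\<integral>p. H (e + h (fst p) (snd p)) \<partial>P) = opt_entropy e t \<Longrightarrow>
      \<exists>v \<in> borel_measurable M. (\<forall>x. v x = 1 \<or> v x = -1) \<and> (\<integral>x. v x \<partial>M) = 0 \<and>
        (AE p in P. e + h (fst p) (snd p) = e - amp e t * (v (fst p) * v (snd p)))"
proof -
  define a where "a = amp e t"
  define C where "C = even_coeff e a"
  define D where "D = odd_coeff e a"
  define K where "K = 12 / (e * a) + 228 / a ^ 4"
  have reg': "0 < a" "a < e" "a < 1 - e" "\<bar>D\<bar> * K < C" "\<bar>D\<bar> * K < 1/2"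
    using reg by (auto simp: region_def a_def C_def D_def K_def odd_loss_def)
  have a1: "a \<le> 1" and e0: "e > 0" using reg' by auto
  have trace: "trace3 = - (a ^ 3 + 3 * e * sq_degree)"
    using T amp_cubed[of e t] by (simp add: a_def)
  have X0: "0 \<le> 3 * e * sq_degree" using e0 sq_degree_nonneg by simp
  obtain v where v0: "v \<in> borel_measurable M" "\<forall>x. v x = 1 \<or> v x = -1"
    and aN: "a\<^sup>2 \<le> sq_norm" and X: "3 * e * sq_degree \<le> 3 * (sq_norm - a\<^sup>2) / a"
    and R: "sign_dist a v \<le> 8 / a ^ 4 * (3 * (sq_norm - a\<^sup>2) + quartic_defect a)"
    and mu: "(a * (\<integral>x. v x \<partial>M))\<^sup>2 \<le> 2 * sq_degree + 2 * sign_dist a v"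
    and cub: "\<bar>\<integral>p. (h (fst p) (snd p)) ^ 3 \<partial>P\<bar> \<le> 4 * sq_degree + 9 * sign_dist a v"
    by (rule near_extremal[OF reg'(1) a1 X0 mean trace])
  note v = v0(1) v0(2)[rule_format]
  define E where "E = sq_norm - a\<^sup>2"
  define W where "W = quartic_defect a"
  define I3 where "I3 = (\<integral>p. (h (fst p) (snd p)) ^ 3 \<partial>P)"
  have E0: "E \<ge> 0" using aN by (simp add: E_def)
  have W0: "W \<ge> 0" unfolding W_def quartic_defect_def by simp
  have D2: "sq_degree \<le> E / (e * a)"
  proof -
    have "3 * e * sq_degree \<le> 3 * E / a" using X by (simp add: E_def)
    then have "e * sq_degree \<le> E / a" by simp
    then show ?thesis using e0 reg'(1) by (simp add: field_simps)
  qed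
  have R': "sign_dist a v \<le> 24 / a ^ 4 * (E + W)"
  proof -
    have "sign_dist a v \<le> 8 / a ^ 4 * (3 * E + W)" using R by (simp add: E_def W_def)
    also have "\<dots> \<le> 8 / a ^ 4 * (3 * (E + W))" using W0 by (intro mult_left_mono) auto
    finally show ?thesis by simp
  qed
  have I3: "\<bar>I3\<bar> \<le> K * (E + W)"
  proof -
    have "\<bar>I3\<bar> \<le> 4 * (E / (e * a)) + 9 * (24 / a ^ 4 * (E + W))"
      using cub D2 R' unfolding I3_def by linarith
    also have "\<dots> \<le> 12 / (e * a) * (E + W) + 228 / a ^ 4 * (E + W)"
    proof (rule add_mono)
      have "4 * (E / (e * a)) = 4 / (e * a) * E" by simp
      also have "\<dots> \<le> 12 / (e * a) * (E + W)"
        using E0 W0 e0 reg'(1) by (intro mult_mono divide_right_mono) auto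
      finally show "4 * (E / (e * a)) \<le> 12 / (e * a) * (E + W)" .
      have "9 * (24 / a ^ 4 * (E + W)) = 216 / a ^ 4 * (E + W)" by simp
      also have "\<dots> \<le> 228 / a ^ 4 * (E + W)"
        using E0 W0 by (intro mult_right_mono divide_right_mono) auto
      finally show "9 * (24 / a ^ 4 * (E + W)) \<le> 228 / a ^ 4 * (E + W)" .
    qed
    finally show ?thesis by (simp add: K_def distrib_right)
  qed
  define S where "S = (\<integral>p. H (e + h (fst p) (snd p)) \<partial>P)"
  have bh: "bounded_measurable P (\<lambda>p. h (fst p) (snd p))" by (intro bm_intros; simp)
  have bH: "bounded_measurable P (\<lambda>p. H (e + h (fst p) (snd p)))"
  proof (rule bounded_measurableI[of _ _ 1])
    have [measurable]: "(\<lambda>p. h (fst p) (snd p)) \<in> borel_measurable P" by (rule bounded_measurable_measurable[OF bh])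
    show "(\<lambda>p. H (e + h (fst p) (snd p))) \<in> borel_measurable P" by measurable
    show "\<bar>H (e + h (fst p) (snd p))\<bar> \<le> 1" for p
      using H_nonneg[OF range] H_le_1[OF range] by simp
  qed
  define B where "B = (H (e + a) - H (e - a)) / (2 * a) - D * a\<^sup>2"
  have "S \<le> (\<integral>p. opt_entropy e t - C * ((h (fst p) (snd p))\<^sup>2 - a\<^sup>2) + B * h (fst p) (snd p)
      + D * h (fst p) (snd p) ^ 3 - ((h (fst p) (snd p))\<^sup>2 - a\<^sup>2)\<^sup>2 / 2 \<partial>P)"
    unfolding S_def
  proof (rule integral_mono)
    show "H (e + h (fst p) (snd p)) \<le> opt_entropy e t - C * ((h (fst p) (snd p))\<^sup>2 - a\<^sup>2) + B * h (fst p) (snd p)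
      + D * h (fst p) (snd p) ^ 3 - ((h (fst p) (snd p))\<^sup>2 - a\<^sup>2)\<^sup>2 / 2" for p
      using H_le_Hermite[OF reg'(1-3) range]
      by (simp add: C_def D_def B_def opt_entropy_def flip: a_def)
    show "integrable P (\<lambda>p. H (e + h (fst p) (snd p)))" by (rule ibl_P[OF bH])
    show "integrable P (\<lambda>p. opt_entropy e t - C * ((h (fst p) (snd p))\<^sup>2 - a\<^sup>2) + B * h (fst p) (snd p)
      + D * h (fst p) (snd p) ^ 3 - ((h (fst p) (snd p))\<^sup>2 - a\<^sup>2)\<^sup>2 / 2)"
      unfolding divide_inverse by (intro ibl_P bm_intros bh)
  qed
  also have "\<dots> = opt_entropy e t - C * E + D * I3 - W / 2"
  proof -
    have i: "integrable P (\<lambda>p. h (fst p) (snd p))" "integrable P (\<lambda>p. (h (fst p) (snd p))\<^sup>2)"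
      "integrable P (\<lambda>p. (h (fst p) (snd p)) ^ 3)" "integrable P (\<lambda>p. ((h (fst p) (snd p))\<^sup>2 - a\<^sup>2)\<^sup>2)"
      by (intro ibl_P bm_intros bh)+
    show ?thesis
      using i by (simp add: MM.prob_space mean E_def sq_norm_def I3_def W_def quartic_defect_def)
  qed
  finally have S: "S \<le> opt_entropy e t - C * E + D * I3 - W / 2" .
  \<comment> \<open>The smaller of the two gains minus the loss, positive by the last two
    inequalities of \<open>region\<close>.\<close>
  define c where "c = min C (1/2) - \<bar>D\<bar> * K"
  have c: "c > 0" using reg' by (simp add: c_def)
  have gain: "S \<le> opt_entropy e t - c * (E + W)"
  proof -
    have "D * I3 \<le> \<bar>D\<bar> * \<bar>I3\<bar>" by (simp add: abs_mult[symmetric])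
    also have "\<dots> \<le> \<bar>D\<bar> * (K * (E + W))" using I3 by (intro mult_left_mono) auto
    finally have "D * I3 \<le> \<bar>D\<bar> * K * (E + W)" by (simp add: mult.assoc)
    moreover have "min C (1/2) * E \<le> C * E" using E0 by (intro mult_right_mono) auto
    moreover have "min C (1/2) * W \<le> 1/2 * W" using W0 by (intro mult_right_mono) auto
    ultimately show ?thesis using S by (simp add: c_def algebra_simps)
  qed
  have "0 \<le> c * (E + W)" using c E0 W0 by simp
  then show "(\<integral>p. H (e + h (fst p) (snd p)) \<partial>P) \<le> opt_entropy e t"
    using gain by (simp add: S_def)
  assume "(\<integral>p. H (e + h (fst p) (snd p)) \<partial>P) = opt_entropy e t"
  then have "c * (E + W) \<le> 0" using gain by (simp add: S_def)
  then have "E + W \<le> 0" using c by (simp add: mult_le_0_iff)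
  then have EW: "E = 0" "W = 0" using E0 W0 by auto
  have D20: "sq_degree = 0" using D2 sq_degree_nonneg by (simp add: EW)
  have "sign_dist a v \<ge> 0" unfolding sign_dist_def by simp
  then have R0: "sign_dist a v = 0" using R' by (simp add: EW)
  have mu0: "(\<integral>x. v x \<partial>M) = 0" using mu reg'(1) by (simp add: D20 R0)
  have bv: "bounded_measurable M v" by (rule bm_sign[OF v])
  have bvfst: "bounded_measurable P (\<lambda>p. v (fst p))" "bounded_measurable P (\<lambda>p. v (snd p))"
    by (rule bounded_measurable_compose[OF bv]; simp)+
  have "integrable P (\<lambda>p. (h (fst p) (snd p) + a * (v (fst p) * v (snd p)))\<^sup>2)"
    by (intro ibl_P bm_intros bh bvfst)
  from integral_nonneg_eq_0_iff_AE[OF this]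
  have "AE p in P. (h (fst p) (snd p) + a * (v (fst p) * v (snd p)))\<^sup>2 = 0"
    using R0 by (simp add: sign_dist_def)
  then have "AE p in P. e + h (fst p) (snd p) = e - amp e t * (v (fst p) * v (snd p))"
    by (rule AE_mp) (auto simp: a_def)
  then show "\<exists>v \<in> borel_measurable M. (\<forall>x. v x = 1 \<or> v x = -1) \<and> (\<integral>x. v x \<partial>M) = 0 \<and>
        (AE p in P. e + h (fst p) (snd p) = e - amp e t * (v (fst p) * v (snd p)))"
    using v mu0 by blast
qed

end

text \<open>The probability space is arbitrary because the bound is needed twice: on the unit interval
  for graphons, on a finite uniform space for the block densities of graphs.\<close>

theorem kernel_entropy:
  fixes g :: "'a \<Rightarrow> 'a \<Rightarrow> real"
  assumes "prob_space M" and meas: "(\<lambda>p. g (fst p) (snd p)) \<in> borel_measurable (M \<Otimes>\<^sub>M M)"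
    and sym: "\<And>x y. g x y = g y x" and range: "\<And>x y. 0 \<le> g x y" "\<And>x y. g x y \<le> 1"
    and e: "(\<integral>p. g (fst p) (snd p) \<partial>(M \<Otimes>\<^sub>M M)) = e"
    and t: "(\<integral>p. g (fst p) (snd p) * (\<integral>z. g (snd p) z * g z (fst p) \<partial>M) \<partial>(M \<Otimes>\<^sub>M M)) = t"
    and reg: "(e, t) \<in> region"
  shows "(\<integral>p. H (g (fst p) (snd p)) \<partial>(M \<Otimes>\<^sub>M M)) \<le> opt_entropy e t"
    and "(\<integral>p. H (g (fst p) (snd p)) \<partial>(M \<Otimes>\<^sub>M M)) = opt_entropy e t \<Longrightarrow>
      \<exists>v \<in> borel_measurable M. (\<forall>x. v x = 1 \<or> v x = -1) \<and> (\<integral>x. v x \<partial>M) = 0 \<and>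
        (AE p in M \<Otimes>\<^sub>M M. g (fst p) (snd p) = e - amp e t * (v (fst p) * v (snd p)))"
proof -
  define h where "h x y = g x y - e" for x y
  interpret prob_space M by fact
  interpret P: pair_prob_space M M ..
  have e01: "0 \<le> e" "e \<le> 1" using reg by (auto simp: region_def)
  have ig: "integrable (M \<Otimes>\<^sub>M M) (\<lambda>p. g (fst p) (snd p))"
    by (rule P.bounded_measurable_integrable[OF bounded_measurableI[OF meas, of 1]]) (use range in auto)
  interpret kernel M h
  proof
    show "(\<lambda>p. h (fst p) (snd p)) \<in> borel_measurable (M \<Otimes>\<^sub>M M)"
      unfolding h_def using meas by measurable
    show "h x y = h y x" for x y by (simp add: h_def sym)
    show "\<bar>h x y\<bar> \<le> 1" for x y using range[of x y] e01 by (simp add: h_def abs_le_iff)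
  qed
  have mean: "(\<integral>p. h (fst p) (snd p) \<partial>(M \<Otimes>\<^sub>M M)) = 0"
    using ig by (simp add: h_def P.prob_space e)
  have eh: "e + h x y = g x y" for x y by (simp add: h_def)
  have T: "e ^ 3 + 3 * e * sq_degree + trace3 = t"
    using triangle_expansion[OF mean, of e] by (simp add: eh t)
  note * = entropy_bound[OF reg mean T, unfolded eh, OF range]
  show "(\<integral>p. H (g (fst p) (snd p)) \<partial>(M \<Otimes>\<^sub>M M)) \<le> opt_entropy e t" by (rule *(1))
  assume "(\<integral>p. H (g (fst p) (snd p)) \<partial>(M \<Otimes>\<^sub>M M)) = opt_entropy e t"
  then show "\<exists>v \<in> borel_measurable M. (\<forall>x. v x = 1 \<or> v x = -1) \<and> (\<integral>x. v x \<partial>M) = 0 \<and>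
        (AE p in M \<Otimes>\<^sub>M M. g (fst p) (snd p) = e - amp e t * (v (fst p) * v (snd p)))"
    by (rule *(2))
qed

section \<open>Openness of the parameter region\<close>

lemma continuous_on_H_open:
  assumes "continuous_on S f" "\<And>x. x \<in> S \<Longrightarrow> 0 < f x \<and> f x < 1"
  shows "continuous_on S (\<lambda>x. H (f x))" "continuous_on S (\<lambda>x. H' (f x))"
proof -
  show "continuous_on S (\<lambda>x. H (f x))"
    by (rule continuous_on_compose2[OF continuous_on_H assms(1)]) (use assms(2) in \<open>force simp: less_imp_le\<close>)
  show "continuous_on S (\<lambda>x. H' (f x))"
    unfolding H'_def using assms(2)
    by (intro continuous_on_diff continuous_on_ln continuous_on_const assms(1)) force+
qed

text \<open>The part of the conditions of \<open>region\<close> that places the two values of the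
  bipodal graphon inside the open unit interval. Continuity and analyticity are proved on this
  larger set.\<close>

definition amp_domain :: "(real \<times> real) set" where
  "amp_domain = {p. 0 < amp (fst p) (snd p) \<and> amp (fst p) (snd p) < fst p \<and> amp (fst p) (snd p) < 1 - fst p}"

lemma continuous_on_amp: "continuous_on S (\<lambda>p. amp (fst p) (snd p))"
  unfolding amp_def by (intro continuous_intros)

lemma open_amp_domain: "open amp_domain"
proof -
  have "amp_domain = {p. 0 < amp (fst p) (snd p)} \<inter> {p. amp (fst p) (snd p) < fst p}
      \<inter> {p. amp (fst p) (snd p) < 1 - fst p}" by (auto simp: amp_domain_def)
  moreover have "open \<dots>"
    by (intro open_Int open_Collect_less continuous_on_amp continuous_intros)
  ultimately show ?thesis by simp
qed

lemma continuous_on_opt_entropy: "continuous_on amp_domain (\<lambda>p. opt_entropy (fst p) (snd p))"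
  unfolding opt_entropy_def divide_inverse
  by (intro continuous_on_mult continuous_on_add continuous_on_H_open continuous_on_diff continuous_on_const
      continuous_on_amp continuous_on_fst continuous_on_snd continuous_on_id)
    (auto simp: amp_domain_def)

lemma region_subset: "region \<subseteq> amp_domain"
  by (auto simp: region_def amp_domain_def)

lemma open_region: "open region"
proof -
  let ?a = "\<lambda>p. amp (fst p) (snd p)"
  have c1: "continuous_on amp_domain (\<lambda>p. fst p + ?a p)" "continuous_on amp_domain (\<lambda>p. fst p - ?a p)"
    by (intro continuous_intros continuous_on_amp)+
  have r: "\<And>p. p \<in> amp_domain \<Longrightarrow> 0 < fst p + ?a p \<and> fst p + ?a p < 1"
      "\<And>p. p \<in> amp_domain \<Longrightarrow> 0 < fst p - ?a p \<and> fst p - ?a p < 1"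
    by (auto simp: amp_domain_def)
  note cH = continuous_on_H_open[OF c1(1) r(1)] continuous_on_H_open[OF c1(2) r(2)]
  have nz: "?a p \<noteq> 0" "fst p \<noteq> 0" if "p \<in> amp_domain" for p using that by (auto simp: amp_domain_def)
  have C: "continuous_on amp_domain (\<lambda>p. even_coeff (fst p) (?a p))"
    unfolding even_coeff_def
    by (intro continuous_on_divide continuous_on_diff continuous_on_mult cH continuous_on_amp continuous_on_const)
      (use nz in auto)
  have D: "continuous_on amp_domain (\<lambda>p. odd_coeff (fst p) (?a p))"
    unfolding odd_coeff_def
    by (intro continuous_on_divide continuous_on_diff continuous_on_add continuous_on_mult continuous_on_power
        cH continuous_on_amp continuous_on_const) (use nz in auto)
  have L: "continuous_on amp_domain (\<lambda>p. odd_loss (fst p) (?a p))"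
    unfolding odd_loss_def
    by (intro continuous_on_mult continuous_on_add continuous_on_divide continuous_on_power
        continuous_on_rabs D continuous_on_amp continuous_on_const continuous_on_fst continuous_on_id)
      (use nz in auto)
  have 1: "open (amp_domain \<inter> (\<lambda>p. even_coeff (fst p) (?a p) - odd_loss (fst p) (?a p)) -` {0<..})"
    by (rule continuous_open_preimage[OF continuous_on_diff[OF C L] open_amp_domain]) simp
  have 2: "open (amp_domain \<inter> (\<lambda>p. odd_loss (fst p) (?a p)) -` {..<1/2})"
    by (rule continuous_open_preimage[OF L open_amp_domain]) simp
  have "region = (amp_domain \<inter> (\<lambda>p. even_coeff (fst p) (?a p) - odd_loss (fst p) (?a p)) -` {0<..})
      \<inter> (amp_domain \<inter> (\<lambda>p. odd_loss (fst p) (?a p)) -` {..<1/2})"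
    by (auto simp: region_def amp_domain_def)
  then show ?thesis using open_Int[OF 1 2] by simp
qed

text \<open>At \<open>e = 1/2\<close> the symmetry of \<open>H\<close> about 1/2 makes
  \<open>odd_coeff\<close> vanish, so the two comparisons of \<open>region\<close> reduce to
  \<open>even_coeff > 0\<close>, which holds as \<open>H\<close> decreases beyond 1/2. The bound
  \<open>t > 0\<close> gives \<open>a < 1/2\<close>.\<close>

lemma half_line_in_region: "{1/2} \<times> {0<..<1/8} \<subseteq> region"
proof clarify
  fix t :: real assume t: "t \<in> {0<..<1/8}"
  define a where "a = amp (1/2) t"
  have a3: "a ^ 3 = 1/8 - t" unfolding a_def amp_cubed by (simp add: power3_eq_cube)
  have "a > 0" unfolding a_def amp_def using t by (simp add: power3_eq_cube)
  have "a < 1/2"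
  proof (rule ccontr)
    assume "\<not> a < 1/2"
    then have "(1/2) ^ 3 \<le> a ^ 3" by (intro power_mono) auto
    then show False using a3 t by (simp add: power3_eq_cube)
  qed
  have "H (1/2 - a) = H (1/2 + a)" "H' (1/2 - a) = - H' (1/2 + a)"
    using H_one_minus[of "1/2 + a"] H'_one_minus[of "1/2 + a"] by (simp_all add: field_simps)
  then have D: "odd_coeff (1/2) a = 0" by (simp add: odd_coeff_def)
  have "H' (1/2 + a) < 0"
    using \<open>a > 0\<close> \<open>a < 1/2\<close> by (simp add: H'_def)
  then have "even_coeff (1/2) a > 0"
    using \<open>H' (1/2 - a) = _\<close> \<open>a > 0\<close> by (simp add: even_coeff_def divide_neg_pos)
  then show "(1/2, t) \<in> region"
    using D \<open>a > 0\<close> \<open>a < 1/2\<close> by (simp add: region_def odd_loss_def flip: a_def)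
qed

section \<open>Graphons\<close>

text \<open>The functionals are defined with completed measures, and the completed measure of the
  square is not the product of those of its sides. Fubini is used for this Borel version. As a
  density it lives on the whole line, so Borel functions need no restriction.\<close>

abbreviation unit_lborel :: "real measure" where
  "unit_lborel \<equiv> density lborel (indicator {0..1})"

interpretation unit_lborel: prob_space unit_lborel
  by (rule prob_spaceI) (simp add: emeasure_density)

interpretation unit_pair: pair_prob_space unit_lborel unit_lborel ..

interpretation unit_triple: pair_prob_space unit_lborel "unit_lborel \<Otimes>\<^sub>M unit_lborel" ..

lemma unit_square_measure: "unit_lborel \<Otimes>\<^sub>M unit_lborel = density lborel (indicator unit_square)"
proof -
  have "unit_lborel \<Otimes>\<^sub>M unit_lborel
      = density (lborel \<Otimes>\<^sub>M lborel) (\<lambda>(x, y). indicator {0..1::real} x * indicator {0..1::real} y)"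
    by (rule pair_measure_density) (auto intro: unit_lborel.sigma_finite_measure_axioms lborel.sigma_finite_measure_axioms)
  also have "(\<lambda>(x, y). indicator {0..1::real} x * indicator {0..1::real} y) = (indicator unit_square :: _ \<Rightarrow> ennreal)"
    by (auto simp: fun_eq_iff indicator_def)
  finally show ?thesis by (simp add: lborel_prod)
qed

lemma unit_cube_measure:
  "unit_lborel \<Otimes>\<^sub>M (unit_lborel \<Otimes>\<^sub>M unit_lborel) = density lborel (indicator unit_cube)"
proof -
  have "sigma_finite_measure (density lborel (indicator unit_square :: _ \<Rightarrow> ennreal))"
    unfolding unit_square_measure[symmetric] by unfold_locales
  then have "unit_lborel \<Otimes>\<^sub>M (unit_lborel \<Otimes>\<^sub>M unit_lborel)
      = density (lborel \<Otimes>\<^sub>M lborel) (\<lambda>(x, y). indicator {0..1::real} x * indicator unit_square y)"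
    unfolding unit_square_measure
    by (intro pair_measure_density) (auto intro: lborel.sigma_finite_measure_axioms borel_measurable_indicator closed_Times borel_closed)
  also have "(\<lambda>(x, y). indicator {0..1::real} x * indicator unit_square y) = (indicator unit_cube :: _ \<Rightarrow> ennreal)"
    by (auto simp: fun_eq_iff indicator_def)
  finally show ?thesis by (simp add: lborel_prod)
qed

lemma unit_square_borel: "unit_square \<in> sets borel" and unit_cube_borel: "unit_cube \<in> sets borel"
  by (intro borel_closed closed_Times closed_real_atLeastAtMost)+

lemma AE_lebesgue_on:
  assumes "S \<in> sets borel"
  shows "(AE x in lebesgue_on S. Q x) \<longleftrightarrow> (AE x in density lborel (indicator S). Q x)"
  using assms by (simp add: AE_restrict_space_iff AE_completion_iff AE_density indicator_def)

lemma measurable_lebesgue_AE: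
  fixes f f' :: "'a::euclidean_space \<Rightarrow> real"
  assumes f': "f' \<in> borel_measurable borel" and ae: "AE x in lborel. f x = f' x"
  shows "f \<in> borel_measurable lebesgue"
proof (rule measurableI)
  fix A :: "real set" assume A: "A \<in> sets borel"
  have "AE x in lebesgue. x \<in> f' -` A \<longleftrightarrow> x \<in> f -` A"
    using ae by (auto intro: AE_completion elim: AE_mp)
  moreover have "f' -` A \<in> sets lebesgue"
    using measurable_sets[OF f' A] by (simp add: sets_completionI_sets)
  ultimately show "f -` A \<inter> space lebesgue \<in> sets lebesgue"
    using completion.in_sets_AE[of "f' -` A" "f -` A" lborel] by simp
qed simp

text \<open>Transfers an integral from the completed measure to the Borel one. Measurability of
  \<open>f\<close> follows by completeness from its agreement with the Borel function
  \<open>f'\<close> up to a null set.\<close>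

lemma integral_lebesgue_on_eq:
  fixes f f' :: "'a::euclidean_space \<Rightarrow> real"
  assumes S: "S \<in> sets borel" and f': "f' \<in> borel_measurable borel"
    and ae: "AE x in density lborel (indicator S). f x = f' x"
  shows "(LINT x|lebesgue_on S. f x) = (LINT x|density lborel (indicator S). f' x)"
proof -
  have ae': "AE x in lborel. indicator S x *\<^sub>R f x = indicator S x *\<^sub>R f' x"
    using ae S by (auto simp: AE_density indicator_def elim: AE_mp)
  have m': "(\<lambda>x. indicator S x *\<^sub>R f' x) \<in> borel_measurable borel"
    using S f' by measurable
  have "(LINT x|lebesgue_on S. f x) = (LINT x|lebesgue. indicator S x *\<^sub>R f x)"
    using S by (intro integral_restrict_space) (simp add: sets_completionI_sets)
  also have "\<dots> = (LINT x|lebesgue. indicator S x *\<^sub>R f' x)"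
    by (rule integral_cong_AE[OF measurable_lebesgue_AE[OF m' ae'] _ AE_completion[OF ae']])
      (use m' in \<open>auto intro: measurable_completion\<close>)
  also have "\<dots> = (LINT x|lborel. indicator S x *\<^sub>R f' x)"
    by (rule integral_completion) (use m' in simp)
  also have "\<dots> = (LINT x|density lborel (\<lambda>x. ennreal (indicator S x)). f' x)"
    by (rule integral_density[symmetric]) (use S f' in auto)
  finally show ?thesis by (simp add: ennreal_indicator)
qed

text \<open>The edges of a triangle are three projections of the cube to the square, and null sets
  of the square have null preimages. For the two projections that involve the first coordinate this
  is read off from the sections of the null set.\<close>

lemma AE_unit_pair_triple:
  assumes ae: "AE p in unit_lborel \<Otimes>\<^sub>M unit_lborel. Q p"
  shows "AE q in unit_lborel \<Otimes>\<^sub>M (unit_lborel \<Otimes>\<^sub>M unit_lborel).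
    Q (fst q, fst (snd q)) \<and> Q (fst (snd q), snd (snd q)) \<and> Q (snd (snd q), fst q)"
proof -
  let ?U = "unit_lborel" let ?UU = "unit_lborel \<Otimes>\<^sub>M unit_lborel"
  \<comment> \<open>\<open>Q\<close> is an arbitrary predicate, whereas
    \<open>AE_pair_measure\<close> asks for measurable sets; hence the passage to a measurable null
    set.\<close>
  obtain N where N: "{p \<in> space ?UU. \<not> Q p} \<subseteq> N" "emeasure ?UU N = 0" and [measurable]: "N \<in> sets ?UU"
    by (rule AE_E[OF ae]) auto
  have QN: "Q p" if "p \<notin> N" for p
    using N(1) that by (auto simp: space_pair_measure)
  have nN: "AE p in ?UU. p \<notin> N"
    using N(2) \<open>N \<in> sets ?UU\<close> by (intro AE_not_in) auto
  have lift: "AE p in ?UU. (c, fst p) \<notin> N" if "AE y in ?U. (c, y) \<notin> N" for c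
  proof (rule unit_pair.AE_pair_measure)
    show "{p \<in> space ?UU. (c, fst p) \<notin> N} \<in> sets ?UU" by measurable
  qed (use that in simp)
  have lift': "AE p in ?UU. (snd p, c) \<notin> N" if "AE y in ?U. (y, c) \<notin> N" for c
  proof (rule unit_pair.AE_pair_measure)
    show "{p \<in> space ?UU. (snd p, c) \<notin> N} \<in> sets ?UU" by measurable
  qed (use that in simp)
  have N1: "AE x in ?U. AE y in ?U. (x, y) \<notin> N"
    using unit_pair.AE_pair[OF nN] by simp
  have N2: "AE x in ?U. AE y in ?U. (y, x) \<notin> N"
  proof (subst unit_pair.AE_commute)
    show "{x \<in> space ?UU. (\<lambda>x y. (y, x) \<notin> N) (fst x) (snd x)} \<in> sets ?UU" by measurable
  qed (rule N1)
  have "AE q in ?U \<Otimes>\<^sub>M ?UU. (fst q, fst (snd q)) \<notin> N"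
  proof (rule unit_triple.AE_pair_measure)
    show "AE x in ?U. AE p in ?UU. (fst (x, p), fst (snd (x, p))) \<notin> N"
      using N1 by eventually_elim (simp add: lift)
    show "{q \<in> space (?U \<Otimes>\<^sub>M ?UU). (fst q, fst (snd q)) \<notin> N} \<in> sets (?U \<Otimes>\<^sub>M ?UU)" by measurable
  qed
  moreover have "AE q in ?U \<Otimes>\<^sub>M ?UU. (snd (snd q), fst q) \<notin> N"
  proof (rule unit_triple.AE_pair_measure)
    show "AE x in ?U. AE p in ?UU. (snd (snd (x, p)), fst (x, p)) \<notin> N"
      using N2 by eventually_elim (simp add: lift')
    show "{q \<in> space (?U \<Otimes>\<^sub>M ?UU). (snd (snd q), fst q) \<notin> N} \<in> sets (?U \<Otimes>\<^sub>M ?UU)" by measurable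
  qed
  moreover have "AE q in ?U \<Otimes>\<^sub>M ?UU. snd q \<notin> N"
  proof (rule unit_triple.AE_pair_measure)
    show "{q \<in> space (?U \<Otimes>\<^sub>M ?UU). snd q \<notin> N} \<in> sets (?U \<Otimes>\<^sub>M ?UU)" by measurable
  qed (use nN in simp)
  ultimately show ?thesis by eventually_elim (auto intro: QN)
qed

context kernel
begin

lemma integral_triangle:
  "(\<integral>q. h (fst q) (fst (snd q)) * h (fst (snd q)) (snd (snd q)) * h (snd (snd q)) (fst q) \<partial>(M \<Otimes>\<^sub>M P)) = trace3"
proof -
  interpret MP: pair_prob_space M "M \<Otimes>\<^sub>M M" ..
  let ?f = "\<lambda>x p. h x (fst p) * h (fst p) (snd p) * h (snd p) x"
  have "bounded_measurable (M \<Otimes>\<^sub>M P) (\<lambda>q. ?f (fst q) (snd q))" by (intro bm_intros; simp)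
  from MP.bounded_measurable_integrable[OF this]
  have "integrable (M \<Otimes>\<^sub>M P) (case_prod ?f)" by (simp add: split_def)
  from MP.integral_fst[OF this]
  have "(\<integral>q. ?f (fst q) (snd q) \<partial>(M \<Otimes>\<^sub>M P)) = (\<integral>x. (\<integral>p. ?f x p \<partial>P) \<partial>M)"
    by (simp add: split_def)
  also have "\<dots> = (\<integral>x. (\<integral>y. h x y * (\<integral>z. h y z * h z x \<partial>M) \<partial>M) \<partial>M)"
  proof (rule Bochner_Integration.integral_cong[OF refl])
    fix x assume x: "x \<in> space M"
    have "(\<integral>p. ?f x p \<partial>P) = (\<integral>y. (\<integral>z. h x y * h y z * h z x \<partial>M) \<partial>M)"
      using integral_P_iterated(1)[of "\<lambda>y z. h x y * h y z * h z x"] x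
      by (simp add: bm_intros)
    then show "(\<integral>p. ?f x p \<partial>P) = (\<integral>y. h x y * (\<integral>z. h y z * h z x \<partial>M) \<partial>M)"
      by (simp add: mult.assoc)
  qed
  also have "\<dots> = trace3"
    unfolding trace3_def
    by (rule integral_P_iterated(1)[symmetric]) (intro bm_intros; simp)
  finally show ?thesis .
qed

end

lemma kernel_unitI:
  assumes "(\<lambda>p. g (fst p) (snd p)) \<in> borel_measurable borel"
    and "\<And>x y. g x y = g y x" "\<And>x y. 0 \<le> g x y" "\<And>x y. g x y \<le> 1"
  shows "kernel unit_lborel g"
proof
  show "(\<lambda>p. g (fst p) (snd p)) \<in> borel_measurable (unit_lborel \<Otimes>\<^sub>M unit_lborel)"
    using assms(1) by (simp add: unit_square_measure)
  show "\<bar>g x y\<bar> \<le> 1" for x y using assms(3,4) by simp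
qed (rule assms(2))

definition sq_ae_eq :: "(real \<Rightarrow> real \<Rightarrow> real) \<Rightarrow> (real \<Rightarrow> real \<Rightarrow> real) \<Rightarrow> bool" where
  "sq_ae_eq g g' \<longleftrightarrow> (AE p in unit_lborel \<Otimes>\<^sub>M unit_lborel. g (fst p) (snd p) = g' (fst p) (snd p))"

text \<open>Replaces the three Lebesgue integrals by integrals over the Borel product measure, the
  triangle density in the iterated form of \<open>kernel_entropy\<close>.\<close>

lemma graphon_functionals_eq:
  assumes m: "(\<lambda>p. g' (fst p) (snd p)) \<in> borel_measurable borel"
    and sym: "\<And>x y. g' x y = g' y x" and r: "\<And>x y. 0 \<le> g' x y" "\<And>x y. g' x y \<le> 1"
    and ae: "sq_ae_eq g g'"
  shows "edge_density g = (\<integral>p. g' (fst p) (snd p) \<partial>(unit_lborel \<Otimes>\<^sub>M unit_lborel))"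
    and "triangle_density g = (\<integral>p. g' (fst p) (snd p) *
        (\<integral>z. g' (snd p) z * g' z (fst p) \<partial>unit_lborel) \<partial>(unit_lborel \<Otimes>\<^sub>M unit_lborel))"
    and "graphon_entropy g = (\<integral>p. H (g' (fst p) (snd p)) \<partial>(unit_lborel \<Otimes>\<^sub>M unit_lborel))"
proof -
  interpret kernel unit_lborel g' by (rule kernel_unitI[OF m sym r])
  have ae': "AE p in density lborel (indicator unit_square). g (fst p) (snd p) = g' (fst p) (snd p)"
    using ae unfolding sq_ae_eq_def unit_square_measure .
  show "edge_density g = (\<integral>p. g' (fst p) (snd p) \<partial>(unit_lborel \<Otimes>\<^sub>M unit_lborel))"
    unfolding edge_density_def split_def unit_square_measure
    by (rule integral_lebesgue_on_eq[OF unit_square_borel m ae'])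
  show "graphon_entropy g = (\<integral>p. H (g' (fst p) (snd p)) \<partial>(unit_lborel \<Otimes>\<^sub>M unit_lborel))"
    unfolding graphon_entropy_def split_def unit_square_measure
  proof (rule integral_lebesgue_on_eq[OF unit_square_borel])
    show "(\<lambda>p. H (g' (fst p) (snd p))) \<in> borel_measurable borel"
      by (rule measurable_compose[OF m borel_measurable_H])
    show "AE p in density lborel (indicator unit_square). H (g (fst p) (snd p)) = H (g' (fst p) (snd p))"
      using ae' by eventually_elim simp
  qed
  let ?f = "\<lambda>g :: real \<Rightarrow> real \<Rightarrow> real. \<lambda>q. g (fst q) (fst (snd q)) * g (fst (snd q)) (snd (snd q)) * g (snd (snd q)) (fst q)"
  have "(LINT q|lebesgue_on unit_cube. ?f g q) = (LINT q|density lborel (indicator unit_cube). ?f g' q)"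
  proof (rule integral_lebesgue_on_eq[OF unit_cube_borel])
    have "(\<lambda>q::real\<times>real\<times>real. g' (fst q) (fst (snd q))) \<in> borel_measurable borel"
      "(\<lambda>q::real\<times>real\<times>real. g' (fst (snd q)) (snd (snd q))) \<in> borel_measurable borel"
      "(\<lambda>q::real\<times>real\<times>real. g' (snd (snd q)) (fst q)) \<in> borel_measurable borel"
      using measurable_compose[OF _ m, of "\<lambda>q. (fst q, fst (snd q))" borel]
        measurable_compose[OF _ m, of "\<lambda>q. (fst (snd q), snd (snd q))" borel]
        measurable_compose[OF _ m, of "\<lambda>q. (snd (snd q), fst q)" borel]
      by (simp_all add: borel_measurable_continuous_onI continuous_intros)
    then show "?f g' \<in> borel_measurable borel" by (intro borel_measurable_times)
    show "AE q in density lborel (indicator unit_cube). ?f g q = ?f g' q"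
      using AE_unit_pair_triple[OF ae[unfolded sq_ae_eq_def]] unfolding unit_cube_measure
      by eventually_elim simp
  qed
  then show "triangle_density g = (\<integral>p. g' (fst p) (snd p) *
        (\<integral>z. g' (snd p) z * g' z (fst p) \<partial>unit_lborel) \<partial>(unit_lborel \<Otimes>\<^sub>M unit_lborel))"
    unfolding triangle_density_def split_def
    using integral_triangle unfolding unit_cube_measure trace3_def by simp
qed

text \<open>Provides the everywhere symmetric and bounded Borel kernel that the locale
  \<open>kernel\<close> asks for.\<close>

lemma graphon_borel_version:
  assumes "graphon g"
  obtains g' where "(\<lambda>p. g' (fst p) (snd p)) \<in> borel_measurable borel"
    "\<And>x y. g' x y = g' y x" "\<And>x y. 0 \<le> g' x y" "\<And>x y. g' x y \<le> 1" "sq_ae_eq g g'"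
proof -
  let ?U = "unit_lborel" let ?UU = "unit_lborel \<Otimes>\<^sub>M unit_lborel"
  have gm: "(\<lambda>p. g (fst p) (snd p)) \<in> borel_measurable (lebesgue_on unit_square)"
    and gs: "\<And>x y. x \<in> unit_interval \<Longrightarrow> y \<in> unit_interval \<Longrightarrow> g x y = g y x \<and> 0 \<le> g x y \<and> g x y \<le> 1"
    using assms unfolding graphon_def split_def by blast+
  define f where "f p = (if p \<in> unit_square then g (fst p) (snd p) else 0)" for p
  have "f \<in> borel_measurable lebesgue"
    unfolding f_def[abs_def]
    using gm unit_square_borel by (subst borel_measurable_if) (auto simp: sets_completionI_sets)
  then obtain f' where f': "f' \<in> borel_measurable lborel" "AE p in lborel. f p = f' p"
    using completion_ex_borel_measurable_real by blast
  \<comment> \<open>A Borel version of a symmetric function need not be symmetric or bounded.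
    Averaging with the transpose and clipping repair this, and change nothing outside the
    exceptional set and its reflection, both null.\<close>
  define g' where "g' x y = max 0 (min 1 ((f' (x, y) + f' (y, x)) / 2))" for x y
  have fm [measurable]: "f' \<in> borel_measurable borel" using f'(1) by simp
  have sw: "(\<lambda>p::real\<times>real. (snd p, fst p)) \<in> borel_measurable borel"
    by (intro borel_measurable_continuous_onI continuous_intros)
  have "(\<lambda>p. f' (snd p, fst p)) \<in> borel_measurable borel"
    using measurable_compose[OF sw fm] by simp
  moreover have "(\<lambda>p. f' (fst p, snd p)) \<in> borel_measurable borel" using fm by simp
  ultimately have m: "(\<lambda>p. g' (fst p) (snd p)) \<in> borel_measurable borel"
    unfolding g'_def by measurable
  have ae: "AE p in ?UU. p \<in> unit_square \<and> f p = f' p"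
    unfolding unit_square_measure using f'(2) unit_square_borel
    by (auto simp: AE_density indicator_def elim: AE_mp)
  obtain N where N: "{p \<in> space ?UU. \<not> (p \<in> unit_square \<and> f p = f' p)} \<subseteq> N" "emeasure ?UU N = 0"
    and [measurable]: "N \<in> sets ?UU"
    by (rule AE_E[OF ae]) auto
  have nN: "AE p in ?UU. p \<notin> N"
    using N(2) \<open>N \<in> sets ?UU\<close> by (intro AE_not_in) auto
  have N1: "AE x in ?U. AE y in ?U. (x, y) \<notin> N"
    using unit_pair.AE_pair[OF nN] by simp
  have N2: "AE x in ?U. AE y in ?U. (y, x) \<notin> N"
  proof (subst unit_pair.AE_commute)
    show "{x \<in> space ?UU. (\<lambda>x y. (y, x) \<notin> N) (fst x) (snd x)} \<in> sets ?UU" by measurable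
  qed (rule N1)
  have "AE p in ?UU. (snd p, fst p) \<notin> N"
  proof (rule unit_pair.AE_pair_measure)
    show "{p \<in> space ?UU. (snd p, fst p) \<notin> N} \<in> sets ?UU" by measurable
  qed (use N2 in simp)
  with nN have "AE p in ?UU. g (fst p) (snd p) = g' (fst p) (snd p)"
  proof eventually_elim
    case (elim p)
    have "q \<in> unit_square \<and> f q = f' q" if "q \<notin> N" for q
      using N(1) that by (auto simp: space_pair_measure)
    from this[OF elim(1)] this[OF elim(2)] show ?case
      using gs[of "fst p" "snd p"] by (auto simp: f_def g'_def mem_Times_iff)
  qed
  then show thesis
    by (intro that[OF m]) (auto simp: g'_def add.commute sq_ae_eq_def)
qed

theorem graphon_entropy_le:
  assumes "graphon g" and e: "edge_density g = e" and t: "triangle_density g = t"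
    and reg: "(e, t) \<in> region"
  shows "graphon_entropy g \<le> opt_entropy e t"
    and "graphon_entropy g = opt_entropy e t \<Longrightarrow>
      \<exists>v \<in> borel_measurable borel. (\<forall>x. v x = 1 \<or> v x = -1) \<and> (\<integral>x. v x \<partial>unit_lborel) = 0 \<and>
        sq_ae_eq g (\<lambda>x y. e - amp e t * (v x * v y))"
proof -
  obtain g' where g': "(\<lambda>p. g' (fst p) (snd p)) \<in> borel_measurable borel"
    "\<And>x y. g' x y = g' y x" "\<And>x y. 0 \<le> g' x y" "\<And>x y. g' x y \<le> 1" "sq_ae_eq g g'"
    by (rule graphon_borel_version[OF assms(1)]) blast
  have m: "(\<lambda>p. g' (fst p) (snd p)) \<in> borel_measurable (unit_lborel \<Otimes>\<^sub>M unit_lborel)"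
    using g'(1) by (simp add: unit_square_measure)
  note fe = graphon_functionals_eq[OF g']
  note ke = kernel_entropy[OF unit_lborel.prob_space_axioms m g'(2-4) fe(1)[symmetric] fe(2)[symmetric],
      unfolded e t fe(3)[symmetric], OF reg]
  show "graphon_entropy g \<le> opt_entropy e t" by (rule ke(1))
  assume "graphon_entropy g = opt_entropy e t"
  from ke(2)[OF this] obtain v where v: "v \<in> borel_measurable borel" "\<forall>x. v x = 1 \<or> v x = -1"
    "(\<integral>x. v x \<partial>unit_lborel) = 0"
    "AE p in unit_lborel \<Otimes>\<^sub>M unit_lborel. g' (fst p) (snd p) = e - amp e t * (v (fst p) * v (snd p))"
    by auto
  have "sq_ae_eq g (\<lambda>x y. e - amp e t * (v x * v y))"
    using v(4) g'(5) unfolding sq_ae_eq_def by eventually_elim simp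
  with v show "\<exists>v \<in> borel_measurable borel. (\<forall>x. v x = 1 \<or> v x = -1) \<and> (\<integral>x. v x \<partial>unit_lborel) = 0 \<and>
        sq_ae_eq g (\<lambda>x y. e - amp e t * (v x * v y))" by blast
qed

definition half_sign :: "real \<Rightarrow> real" where
  "half_sign x = (if x < 1/2 then 1 else -1)"

lemma half_sign_measurable [measurable]: "half_sign \<in> borel_measurable borel"
  unfolding half_sign_def[abs_def] by measurable

lemma integral_half_sign: "(\<integral>x. half_sign x \<partial>unit_lborel) = 0"
proof -
  have U: "unit_lborel = density lborel (\<lambda>x. ennreal (indicator {0..1} x))"
    by (simp add: ennreal_indicator)
  have "(\<integral>x. half_sign x \<partial>unit_lborel) = (\<integral>x. indicator {0..1} x *\<^sub>R half_sign x \<partial>lborel)"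
    unfolding U by (rule integral_density) auto
  also have "\<dots> = (\<integral>x. 2 * indicator {0..<1/2::real} x - indicator {0..1} x \<partial>lborel)"
    by (rule Bochner_Integration.integral_cong) (auto simp: half_sign_def indicator_def)
  also have "\<dots> = 0"
  proof -
    have "integrable lborel (indicator {0..<1/2::real} :: real \<Rightarrow> real)"
      by (rule integrable_real_indicator, simp, subst emeasure_lborel_Ico, simp, simp only: infinity_ennreal_def ennreal_less_top)
    moreover have "integrable lborel (indicator {0..1::real} :: real \<Rightarrow> real)"
      by (rule integrable_real_indicator) simp_all
    ultimately have "(\<integral>x. 2 * indicat_real {0..<1/2::real} x - indicat_real {0..1::real} x \<partial>lborel)
        = 2 * (\<integral>x. indicat_real {0..<1/2::real} x \<partial>lborel) - (\<integral>x. indicat_real {0..1::real} x \<partial>lborel)"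
      by (subst Bochner_Integration.integral_diff) simp_all
    then show ?thesis by simp
  qed
  finally show ?thesis .
qed

lemma bipodal_ae: "sq_ae_eq (bipodal_graphon e t) (\<lambda>x y. e - amp e t * (half_sign x * half_sign y))"
proof -
  have ne: "AE x in unit_lborel. x \<noteq> 1/2"
    using AE_lborel_singleton[of "1/2::real"] by (auto simp: AE_density elim: AE_mp)
  have "AE p in unit_lborel \<Otimes>\<^sub>M unit_lborel. fst p \<noteq> 1/2"
  proof (rule unit_pair.AE_pair_measure)
    show "{p \<in> space (unit_lborel \<Otimes>\<^sub>M unit_lborel). fst p \<noteq> 1/2} \<in> sets (unit_lborel \<Otimes>\<^sub>M unit_lborel)"
      by measurable
  qed (use ne in simp)
  moreover have "AE p in unit_lborel \<Otimes>\<^sub>M unit_lborel. snd p \<noteq> 1/2"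
  proof (rule unit_pair.AE_pair_measure)
    show "{p \<in> space (unit_lborel \<Otimes>\<^sub>M unit_lborel). snd p \<noteq> 1/2} \<in> sets (unit_lborel \<Otimes>\<^sub>M unit_lborel)"
      by measurable
  qed (use ne in simp)
  ultimately show ?thesis
    unfolding sq_ae_eq_def
    by eventually_elim (auto simp: bipodal_graphon_def half_sign_def amp_def)
qed

lemma bipodal_graphon_facts:
  assumes "(e, t) \<in> amp_domain"
  shows "graphon (bipodal_graphon e t)" "edge_density (bipodal_graphon e t) = e"
    "triangle_density (bipodal_graphon e t) = t" "graphon_entropy (bipodal_graphon e t) = opt_entropy e t"
proof -
  define a where "a = amp e t"
  have a: "0 < a" "a < e" "a < 1 - e" using assms by (auto simp: amp_domain_def a_def)
  show "graphon (bipodal_graphon e t)"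
    unfolding graphon_def
  proof (intro conjI ballI)
    have "(\<lambda>(x, y). bipodal_graphon e t x y) \<in> borel_measurable borel"
    proof -
      have "Measurable.pred borel (\<lambda>p::real\<times>real. fst p < 1/2 \<and> snd p < 1/2 \<or> 1/2 < fst p \<and> 1/2 < snd p)"
        unfolding borel_prod[symmetric] by measurable
      then show ?thesis unfolding bipodal_graphon_def split_def by measurable
    qed
    then show "(\<lambda>(x, y). bipodal_graphon e t x y) \<in> borel_measurable (lebesgue_on unit_square)"
      by (intro measurable_restrict_space1 measurable_completion) simp
  qed (use a in \<open>auto simp: bipodal_graphon_def simp flip: amp_def a_def\<close>)
  let ?s = half_sign
  define g' where "g' x y = e - a * (?s x * ?s y)" for x y
  have s: "?s x = 1 \<or> ?s x = -1" for x by (auto simp: half_sign_def)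
  have sf: "(\<lambda>p::real\<times>real. ?s (fst p)) \<in> borel_measurable borel" "(\<lambda>p::real\<times>real. ?s (snd p)) \<in> borel_measurable borel"
    by (intro measurable_compose[OF _ half_sign_measurable] borel_measurable_continuous_onI continuous_intros)+
  have m: "(\<lambda>p. g' (fst p) (snd p)) \<in> borel_measurable borel"
    unfolding g'_def using sf by measurable
  have sym: "g' x y = g' y x" for x y by (simp add: g'_def mult.commute)
  have r: "0 \<le> g' x y" "g' x y \<le> 1" for x y
    using s[of x] s[of y] a by (auto simp: g'_def)
  have ae: "sq_ae_eq (bipodal_graphon e t) g'"
    using bipodal_ae by (simp add: g'_def[abs_def] a_def)
  interpret kernel unit_lborel g' by (rule kernel_unitI[OF m sym r])
  note fe = graphon_functionals_eq[OF m sym r ae]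
  have bs: "bounded_measurable unit_lborel ?s"
    by (rule bounded_measurableI[of _ _ 1]) (auto simp: half_sign_def)
  have ss0: "(\<integral>p. ?s (fst p) * ?s (snd p) \<partial>P) = 0"
    unfolding integral_P_product[OF bs bs] by (simp add: integral_half_sign)
  have bss: "bounded_measurable P (\<lambda>p. ?s (fst p) * ?s (snd p))"
    by (intro bm_intros bounded_measurable_compose[OF bs]; simp)
  \<comment> \<open>Any function of the two values of \<open>g'\<close> is affine in the product of
    the signs, which has integral 0; only the constant term survives.\<close>
  have aff: "(\<integral>p. c + d * (?s (fst p) * ?s (snd p)) \<partial>P) = c" for c d
    using ibl_P[OF bss] by (simp add: unit_pair.prob_space ss0)
  show "edge_density (bipodal_graphon e t) = e"
    using aff[of e "-a"] by (simp add: fe(1) g'_def)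
  have "H (g' x y) = opt_entropy e t + (H (e - a) - H (e + a)) / 2 * (?s x * ?s y)" for x y
    using s[of x] s[of y] by (auto simp: g'_def opt_entropy_def field_simps simp flip: a_def)
  then show "graphon_entropy (bipodal_graphon e t) = opt_entropy e t"
    by (simp only: fe(3) aff)
  have inner: "(\<integral>z. g' y z * g' z x \<partial>unit_lborel) = e\<^sup>2 + a\<^sup>2 * (?s x * ?s y)" for x y
  proof -
    have "g' y z * g' z x = e\<^sup>2 + a\<^sup>2 * (?s x * ?s y) - e * a * (?s x + ?s y) * ?s z" for z
      using s[of z] by (auto simp: g'_def power2_eq_square algebra_simps)
    then show ?thesis
      using ibl_M[OF bs] by (simp add: unit_lborel.prob_space[simplified] integral_half_sign)
  qed
  have "g' x y * (e\<^sup>2 + a\<^sup>2 * (?s x * ?s y)) = (e ^ 3 - a ^ 3) + (e * a\<^sup>2 - a * e\<^sup>2) * (?s x * ?s y)" for x y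
    using s[of x] s[of y] by (auto simp: g'_def power2_eq_square power3_eq_cube algebra_simps)
  then show "triangle_density (bipodal_graphon e t) = t"
    by (simp add: fe(2) inner aff) (simp add: a_def amp_cubed)
qed

lemma bipodal_entropy_maximizer:
  assumes "(e, t) \<in> region"
  shows "entropy_maximizer e t (bipodal_graphon e t)"
    and "entropy_maximizer e t g \<Longrightarrow> graphon g \<and> graphon_entropy g = opt_entropy e t"
proof -
  note bp = bipodal_graphon_facts[OF subsetD[OF region_subset assms]]
  show "entropy_maximizer e t (bipodal_graphon e t)"
    unfolding entropy_maximizer_def using bp graphon_entropy_le(1)[OF _ _ _ assms] by auto
  assume g: "entropy_maximizer e t g"
  then show "graphon g \<and> graphon_entropy g = opt_entropy e t"
    unfolding entropy_maximizer_def using bp graphon_entropy_le(1)[of g, OF _ _ _ assms]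
    by (metis order_antisym)
qed

section \<open>Uniqueness up to rearrangement\<close>

text \<open>Here the space is the interval itself, as maps of the interval to itself require; almost
  everywhere means the same as for \<open>unit_lborel\<close>.\<close>

abbreviation unit_restr :: "real measure" where
  "unit_restr \<equiv> restrict_space lborel {0..1}"

lemma lebesgue_on_completion:
  assumes S: "S \<in> sets lborel"
  shows "lebesgue_on S = completion (restrict_space lborel S)"
proof (rule measure_eqI)
  have n: "null_sets (restrict_space lborel S) = {N \<in> null_sets lborel. N \<subseteq> S}"
    using null_sets_restrict_space[OF S] by auto
  show eq: "sets (lebesgue_on S) = sets (completion (restrict_space lborel S))"
  proof (intro equalityI subsetI)
    fix A assume "A \<in> sets (lebesgue_on S)"
    then obtain B where "B \<in> sets lebesgue" and AB: "A = S \<inter> B"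
      by (auto simp: sets_restrict_space)
    then obtain C N N' where C: "B = C \<union> N" "C \<in> sets lborel" "N' \<in> null_sets lborel" "N \<subseteq> N'"
      by (auto simp: sets_completion)
    have "A = (S \<inter> C) \<union> (S \<inter> N)" "S \<inter> C \<in> sets (restrict_space lborel S)"
      using AB C by (auto simp: sets_restrict_space)
    moreover have "S \<inter> N' \<in> null_sets (restrict_space lborel S)" "S \<inter> N \<subseteq> S \<inter> N'"
      using C S unfolding n by (auto intro: null_set_Int1)
    ultimately show "A \<in> sets (completion (restrict_space lborel S))"
      unfolding sets_completion by blast
  next
    fix A assume "A \<in> sets (completion (restrict_space lborel S))"
    then obtain C N N' where C: "A = C \<union> N" "C \<in> sets (restrict_space lborel S)"
      "N' \<in> null_sets (restrict_space lborel S)" "N \<subseteq> N'"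
      unfolding sets_completion by blast
    have "N' \<in> null_sets lborel" "N' \<subseteq> S" using C(3) unfolding n by auto
    moreover have "C \<in> sets lborel" "C \<subseteq> S" using C(2) S by (auto simp: sets_restrict_space)
    ultimately have "A \<in> sets lebesgue" "A \<subseteq> S"
      using C(1,4) by (auto simp: sets_completion)
    then show "A \<in> sets (lebesgue_on S)" by (auto simp: sets_restrict_space)
  qed
  fix A assume A: "A \<in> sets (lebesgue_on S)"
  have SL: "S \<in> sets lebesgue" using S by (simp add: sets_completionI_sets)
  have "A \<in> sets (completion (restrict_space lborel S))" using A eq by simp
  then obtain C N N' where C: "A = C \<union> N" "C \<in> sets (restrict_space lborel S)"
      "N' \<in> null_sets (restrict_space lborel S)" "N \<subseteq> N'"
    unfolding sets_completion by blast
  have N': "N' \<in> null_sets lborel" "N' \<subseteq> S" using C(3) unfolding n by auto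
  have CS: "C \<in> sets lborel" "C \<subseteq> S" using C(2) S by (auto simp: sets_restrict_space)
  have nN: "N \<in> null_sets lebesgue" using null_sets_completion_subset[OF C(4)] N'(1) by (auto intro: null_sets_completionI)
  have nN2: "N \<in> null_sets (completion (restrict_space lborel S))"
    using null_sets_completion_subset[OF C(4)] C(3) by (auto intro: null_sets_completionI)
  have "emeasure (lebesgue_on S) A = emeasure lebesgue A"
    using A SL by (intro emeasure_restrict_space) (auto simp: sets_restrict_space)
  also have "\<dots> = emeasure lborel C"
    unfolding C(1) using CS nN by (simp add: emeasure_Un_null_set sets_completionI_sets)
  also have "\<dots> = emeasure (restrict_space lborel S) C"
    using CS S by (intro emeasure_restrict_space[symmetric]) auto
  also have "\<dots> = emeasure (completion (restrict_space lborel S)) A"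
    unfolding C(1) using C(2) nN2 by (simp add: emeasure_Un_null_set sets_completionI_sets)
  finally show "emeasure (lebesgue_on S) A = emeasure (completion (restrict_space lborel S)) A" .
qed

text \<open>A measure-preserving Borel map pulls null sets back to null sets, so it stays measurable
  and measure-preserving after completion.\<close>

lemma measure_preserving_unitI:
  assumes m: "\<phi> \<in> unit_restr \<rightarrow>\<^sub>M unit_restr" and d: "distr unit_restr unit_restr \<phi> = unit_restr"
  shows "measure_preserving_unit \<phi>"
proof -
  have mc: "\<phi> \<in> completion unit_restr \<rightarrow>\<^sub>M unit_restr" using m by (rule measurable_completion)
  have dc: "distr (completion unit_restr) unit_restr \<phi> = unit_restr"
    by (simp add: distr_completion[OF m] d)
  have "\<phi> \<in> completion unit_restr \<rightarrow>\<^sub>M completion unit_restr"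
    by (rule completion.measurable_completion2[OF mc]) (simp add: dc)
  moreover have "distr (completion unit_restr) (completion unit_restr) \<phi> = completion unit_restr"
    using completion.completion_distr_eq[OF mc] by (simp add: dc)
  moreover have "lebesgue_on unit_interval = completion unit_restr"
    by (rule lebesgue_on_completion) simp
  ultimately show ?thesis unfolding measure_preserving_unit_def by simp
qed

lemma AE_unit_restr: "(AE x in unit_restr. Q x) \<longleftrightarrow> (AE x in unit_lborel. Q x)"
  by (simp add: AE_restrict_space_iff AE_density indicator_def)

text \<open>Moving the part of \<open>[0,1]\<close> where \<open>v = -1\<close> to the right of the rest by the shift by 2, the
  quantile function of the resulting law enumerates \<open>v = 1\<close> on \<open>(0, 1/2)\<close> and
  \<open>v = -1\<close> on \<open>(1/2, 1)\<close>.\<close>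

lemma rearrange_sign:
  fixes v :: "real \<Rightarrow> real"
  assumes vm [measurable]: "v \<in> borel_measurable borel" and v: "\<And>x. v x = 1 \<or> v x = -1"
    and int: "(\<integral>x. v x \<partial>unit_lborel) = 0"
  obtains \<phi> where "\<phi> \<in> borel_measurable borel" "\<phi> \<in> unit_restr \<rightarrow>\<^sub>M unit_restr" "distr unit_restr unit_restr \<phi> = unit_restr"
    "AE x in unit_lborel. v (\<phi> x) = half_sign x"
proof -
  interpret R: prob_space unit_restr
    by (rule prob_spaceI) (simp add: emeasure_restrict_space space_restrict_space)
  \<comment> \<open>\<open>Y\<close> takes values in \<open>[0,1]\<close> or in \<open>[2,3]\<close>
    according to the sign, and \<open>3/2\<close> is a threshold in the gap. \<open>f\<close> undoes
    the shift; the clipping makes it map into \<open>[0,1]\<close> also at values that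
    \<open>Y\<close> never takes.\<close>
  define Y where "Y x = (if v x = 1 then x else x + 2)" for x
  define f where "f y = max 0 (min 1 (if y \<le> 3/2 then y else y - 2))" for y :: real
  have Ym: "Y \<in> borel_measurable unit_restr"
    unfolding Y_def[abs_def] by (intro measurable_restrict_space1) measurable
  have fm [measurable]: "f \<in> borel_measurable borel" unfolding f_def[abs_def] by measurable
  have fY: "f (Y x) = x" if "x \<in> {0..1}" for x using that by (auto simp: f_def Y_def)
  define nu where "nu = distr unit_restr borel Y"
  interpret nu: cdf_distribution nu
    unfolding nu_def cdf_distribution_def by (rule R.real_distribution_distr[OF Ym])
  \<comment> \<open>Mean zero says that \<open>v = 1\<close> on a set of measure 1/2. By the
    pseudoinverse property of the quantile function this places the jump of the rearranged sign at
    1/2.\<close>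
  have half: "nu.C (3/2) = 1/2"
  proof -
    have U: "unit_lborel = density lborel (\<lambda>x. ennreal (indicator {0..1} x))"
      by (simp add: ennreal_indicator)
    have "(\<integral>x. v x \<partial>unit_lborel) = (\<integral>x. v x \<partial>unit_restr)"
      unfolding U by (subst integral_density) (auto simp: integral_restrict_space)
    also have "\<dots> = (\<integral>x. 2 * indicator {x. v x = 1} x - 1 \<partial>unit_restr)"
      using v by (intro Bochner_Integration.integral_cong) (auto simp: indicator_def)
    also have "\<dots> = 2 * measure unit_restr ({x. v x = 1} \<inter> {0..1}) - 1"
    proof -
      have "{x. v x = 1} \<inter> {0..1} \<in> sets unit_restr"
        by (auto simp: sets_restrict_space)
      then have "integrable unit_restr (indicator ({x. v x = 1} \<inter> {0..1}) :: _ \<Rightarrow> real)"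
        by (intro integrable_real_indicator) (auto simp: R.emeasure_finite less_top[symmetric])
      then have "(\<integral>x. 2 * indicator ({x. v x = 1} \<inter> {0..1}) x - 1 \<partial>unit_restr)
          = 2 * measure unit_restr ({x. v x = 1} \<inter> {0..1}) - 1"
        by (simp add: measure_restrict_space)
      moreover have "(\<integral>x. 2 * indicator {x. v x = 1} x - 1 \<partial>unit_restr)
          = (\<integral>x. 2 * indicator ({x. v x = 1} \<inter> {0..1}) x - (1::real) \<partial>unit_restr)"
        by (intro Bochner_Integration.integral_cong) (auto simp: indicator_def space_restrict_space)
      ultimately show ?thesis by simp
    qed
    finally have "measure unit_restr ({x. v x = 1} \<inter> {0..1}) = 1/2" using int by simp
    moreover have "Y -` {..3/2} \<inter> space unit_restr = {x. v x = 1} \<inter> {0..1}"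
      by (auto simp: Y_def space_restrict_space split: if_splits)
    ultimately show ?thesis
      by (simp add: cdf_def nu_def measure_distr[OF Ym])
  qed
  \<comment> \<open>The quantile function is used on the open interval only; within
    \<open>[0,1]\<close> the default value 0 concerns just the two end points.\<close>
  define \<phi> where "\<phi> x = (if x \<in> {0<..<1} then f (nu.I x) else 0)" for x
  have \<phi>m: "\<phi> \<in> borel_measurable borel"
    unfolding \<phi>_def[abs_def]
  proof (subst measurable_If_restrict_space_iff)
    show "(\<lambda>x. f (nu.I x)) \<in> borel_measurable (restrict_space borel {x. x \<in> {0<..<1}})
      \<and> (\<lambda>x. 0) \<in> borel_measurable (restrict_space borel {x. x \<notin> {0<..<1}})"
      using measurable_compose[OF nu.measurable_CI fm] by (simp del: greaterThanLessThan_iff)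
  qed simp
  have \<phi>01: "\<phi> x \<in> {0..1}" for x by (auto simp: \<phi>_def f_def)
  have \<phi>R: "\<phi> \<in> unit_restr \<rightarrow>\<^sub>M unit_restr"
    using \<phi>m \<phi>01 by (intro measurable_restrict_space3) auto
  let ?O = "restrict_space lborel {0<..<1::real}"
  have Im: "nu.I \<in> borel_measurable ?O"
    using nu.measurable_CI by (simp cong: measurable_cong_sets sets_restrict_space_cong)
  have "distr unit_restr unit_restr \<phi> = unit_restr"
  proof (rule measure_eqI)
    fix E assume "E \<in> sets (distr unit_restr unit_restr \<phi>)"
    then have E: "E \<in> sets borel" "E \<subseteq> {0..1}" by (auto simp: sets_restrict_space)
    have "emeasure (distr unit_restr unit_restr \<phi>) E = emeasure unit_restr (\<phi> -` E \<inter> {0..1})"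
      using E \<phi>R by (subst emeasure_distr) (auto simp: sets_restrict_space space_restrict_space)
    also have "\<dots> = emeasure lborel (\<phi> -` E \<inter> {0..1})"
      using E measurable_sets[OF \<phi>m E(1)] by (intro emeasure_restrict_space) auto
    also have "\<dots> = emeasure lborel (\<phi> -` E \<inter> {0<..<1})"
    proof (rule emeasure_eq_AE)
      show "AE x in lborel. x \<in> \<phi> -` E \<inter> {0..1} \<longleftrightarrow> x \<in> \<phi> -` E \<inter> {0<..<1}"
        using AE_lborel_singleton[of 0] AE_lborel_singleton[of "1::real"]
        by eventually_elim auto
    qed (use measurable_sets[OF \<phi>m E(1)] in auto)
    also have "\<dots> = emeasure ?O ((f \<circ> nu.I) -` E \<inter> {0<..<1})"
    proof -
      have "\<phi> -` E \<inter> {0<..<1} = (f \<circ> nu.I) -` E \<inter> {0<..<1}" by (auto simp: \<phi>_def)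
      then show ?thesis by (simp only:) (intro emeasure_restrict_space[symmetric], auto)
    qed
    also have "\<dots> = emeasure (distr ?O borel nu.I) (f -` E)"
      using measurable_sets[OF fm E(1)] by (subst emeasure_distr[OF Im]) (auto simp: space_restrict_space vimage_comp)
    also have "\<dots> = emeasure nu (f -` E)" by (simp only: nu.distr_I_eq_M)
    also have "\<dots> = emeasure unit_restr (Y -` (f -` E) \<inter> space unit_restr)"
      using measurable_sets[OF fm E(1)] unfolding nu_def by (subst emeasure_distr[OF Ym]) auto
    also have "Y -` (f -` E) \<inter> space unit_restr = E"
      using E(2) fY by (auto simp: space_restrict_space)
    finally show "emeasure (distr unit_restr unit_restr \<phi>) E = emeasure unit_restr E" .
  qed simp
  moreover have "AE x in unit_lborel. v (\<phi> x) = half_sign x"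
  proof -
    let ?Q = "\<lambda>y. v (f y) = (if y \<le> 3/2 then 1 else -1)"
    have "AE x in unit_restr. ?Q (Y x)"
    proof (rule AE_I2)
      fix x assume "x \<in> space unit_restr"
      then have x: "x \<in> {0..1}" by (simp add: space_restrict_space)
      show "?Q (Y x)"
        unfolding fY[OF x] using x v[of x] by (auto simp: Y_def)
    qed
    then have "AE y in nu. ?Q y"
      unfolding nu_def by (subst AE_distr_iff[OF Ym]) auto
    then have "AE y in distr ?O borel nu.I. ?Q y" by (simp only: nu.distr_I_eq_M)
    then have "AE u in ?O. ?Q (nu.I u)" by (rule AE_distrD[OF Im])
    then have "AE u in lborel. u \<in> {0<..<1} \<longrightarrow> ?Q (nu.I u)"
      by (simp add: AE_restrict_space_iff)
    then have "AE u in lborel. u \<in> {0..1} \<longrightarrow> v (\<phi> u) = half_sign u"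
      using AE_lborel_singleton[of 0] AE_lborel_singleton[of "1::real"] AE_lborel_singleton[of "1/2::real"]
    proof eventually_elim
      case (elim u)
      show ?case
      proof
        assume "u \<in> {0..1}"
        then have u: "0 < u" "u < 1" using elim by auto
        have "nu.I u \<le> 3/2 \<longleftrightarrow> u \<le> 1/2"
          using nu.pseudoinverse[OF u, of "3/2"] half by simp
        then show "v (\<phi> u) = half_sign u"
          using elim u by (auto simp: \<phi>_def half_sign_def)
      qed
    qed
    then show ?thesis by (simp add: AE_density indicator_def)
  qed
  ultimately show thesis using that[OF \<phi>m \<phi>R] by blast
qed

text \<open>\<open>\<phi>\<close> is applied to one coordinate at a time: measure preservation on
  the interval pulls back the null sections, and Fubini reassembles them to a null set of the
  square.\<close>

lemma sq_ae_eq_compose: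
  assumes ae: "sq_ae_eq g g'" and [measurable]: "\<phi> \<in> borel_measurable borel"
    and m: "\<phi> \<in> unit_restr \<rightarrow>\<^sub>M unit_restr" and d: "distr unit_restr unit_restr \<phi> = unit_restr"
  shows "sq_ae_eq (\<lambda>x y. g (\<phi> x) (\<phi> y)) (\<lambda>x y. g' (\<phi> x) (\<phi> y))"
proof -
  let ?U = "unit_lborel" let ?UU = "unit_lborel \<Otimes>\<^sub>M unit_lborel"
  have push: "AE x in ?U. Q (\<phi> x)" if "AE x in ?U. Q x" for Q
    using AE_distrD[OF m, of Q] that unfolding d AE_unit_restr .
  obtain N where N: "{p \<in> space ?UU. g (fst p) (snd p) \<noteq> g' (fst p) (snd p)} \<subseteq> N" "emeasure ?UU N = 0"
    and NS [measurable]: "N \<in> sets ?UU"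
    by (rule AE_E[OF ae[unfolded sq_ae_eq_def]]) auto
  have nN: "AE p in ?UU. p \<notin> N" using N(2) NS by (intro AE_not_in) auto
  have "AE x in ?U. AE y in ?U. (x, y) \<notin> N" using unit_pair.AE_pair[OF nN] by simp
  then have "AE x in ?U. AE y in ?U. (\<phi> x, y) \<notin> N" by (rule push)
  then have xy: "AE x in ?U. AE y in ?U. (\<phi> x, \<phi> y) \<notin> N"
    by eventually_elim (rule push)
  have "AE p in ?UU. (\<phi> (fst p), \<phi> (snd p)) \<notin> N"
  proof (rule unit_pair.AE_pair_measure)
    show "{p \<in> space ?UU. (\<phi> (fst p), \<phi> (snd p)) \<notin> N} \<in> sets ?UU" by measurable
  qed (use xy in simp)
  then show ?thesis
    unfolding sq_ae_eq_def
  proof eventually_elim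
    case (elim p)
    show ?case
    proof (rule ccontr)
      assume "g (\<phi> (fst p)) (\<phi> (snd p)) \<noteq> g' (\<phi> (fst p)) (\<phi> (snd p))"
      then have "(\<phi> (fst p), \<phi> (snd p)) \<in> {p \<in> space ?UU. g (fst p) (snd p) \<noteq> g' (fst p) (snd p)}"
        by (simp add: space_pair_measure)
      with N(1) elim show False by blast
    qed
  qed
qed

text \<open>The rearrangement need not be invertible. Two maximizers are therefore compared by
  pulling both back to the same normal form, which matches the two maps in
  \<open>graphon_equiv\<close>.\<close>

lemma sign_kernel_normal_form:
  assumes "sq_ae_eq g (\<lambda>x y. e - a * (v x * v y))"
    and v: "v \<in> borel_measurable borel" "\<forall>x. v x = 1 \<or> v x = -1" "(\<integral>x. v x \<partial>unit_lborel) = 0"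
  obtains \<phi> where "measure_preserving_unit \<phi>"
    "sq_ae_eq (\<lambda>x y. g (\<phi> x) (\<phi> y)) (\<lambda>x y. e - a * (half_sign x * half_sign y))"
proof -
  obtain \<phi> where \<phi>: "\<phi> \<in> borel_measurable borel" "\<phi> \<in> unit_restr \<rightarrow>\<^sub>M unit_restr"
    "distr unit_restr unit_restr \<phi> = unit_restr" and s: "AE x in unit_lborel. v (\<phi> x) = half_sign x"
    by (rule rearrange_sign[OF v(1) _ v(3)]) (use v(2) in auto)
  note [measurable] = \<phi>(1) v(1)
  have "AE p in unit_lborel \<Otimes>\<^sub>M unit_lborel. v (\<phi> (fst p)) = half_sign (fst p)"
  proof (rule unit_pair.AE_pair_measure)
    show "{p \<in> space (unit_lborel \<Otimes>\<^sub>M unit_lborel). v (\<phi> (fst p)) = half_sign (fst p)}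
      \<in> sets (unit_lborel \<Otimes>\<^sub>M unit_lborel)" by measurable
  qed (use s in simp)
  moreover have "AE p in unit_lborel \<Otimes>\<^sub>M unit_lborel. v (\<phi> (snd p)) = half_sign (snd p)"
  proof (rule unit_pair.AE_pair_measure)
    show "{p \<in> space (unit_lborel \<Otimes>\<^sub>M unit_lborel). v (\<phi> (snd p)) = half_sign (snd p)}
      \<in> sets (unit_lborel \<Otimes>\<^sub>M unit_lborel)" by measurable
  qed (use s in simp)
  moreover note sq_ae_eq_compose[OF assms(1) \<phi>, unfolded sq_ae_eq_def]
  ultimately have "sq_ae_eq (\<lambda>x y. g (\<phi> x) (\<phi> y)) (\<lambda>x y. e - a * (half_sign x * half_sign y))"
    unfolding sq_ae_eq_def by eventually_elim simp
  with measure_preserving_unitI[OF \<phi>(2,3)] show thesis by (rule that)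
qed

lemma entropy_maximizer_unique:
  assumes reg: "(e, t) \<in> region" and g: "entropy_maximizer e t g" and h: "entropy_maximizer e t h"
  shows "graphon_equiv g h"
proof -
  have nf: "\<exists>\<phi>. measure_preserving_unit \<phi> \<and>
    sq_ae_eq (\<lambda>x y. g (\<phi> x) (\<phi> y)) (\<lambda>x y. e - amp e t * (half_sign x * half_sign y))"
    if g: "entropy_maximizer e t g" for g
  proof -
    have "graphon g" "edge_density g = e" "triangle_density g = t" "graphon_entropy g = opt_entropy e t"
      using g bipodal_entropy_maximizer(2)[OF reg g] by (auto simp: entropy_maximizer_def)
    from graphon_entropy_le(2)[OF this(1-3) reg this(4)] obtain v where v:
      "v \<in> borel_measurable borel" "\<forall>x. v x = 1 \<or> v x = -1" "(\<integral>x. v x \<partial>unit_lborel) = 0"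
      "sq_ae_eq g (\<lambda>x y. e - amp e t * (v x * v y))" by blast
    show ?thesis by (rule sign_kernel_normal_form[OF v(4) v(1-3)]) blast
  qed
  obtain \<phi> \<psi> where *: "measure_preserving_unit \<phi>" "measure_preserving_unit \<psi>"
    "sq_ae_eq (\<lambda>x y. g (\<phi> x) (\<phi> y)) (\<lambda>x y. e - amp e t * (half_sign x * half_sign y))"
    "sq_ae_eq (\<lambda>x y. h (\<psi> x) (\<psi> y)) (\<lambda>x y. e - amp e t * (half_sign x * half_sign y))"
    using nf[OF g] nf[OF h] by blast
  have "AE p in unit_lborel \<Otimes>\<^sub>M unit_lborel. g (\<phi> (fst p)) (\<phi> (snd p)) = h (\<psi> (fst p)) (\<psi> (snd p))"
    using *(3,4) unfolding sq_ae_eq_def by eventually_elim simp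
  then have "AE (x, y) in lebesgue_on unit_square. g (\<phi> x) (\<phi> y) = h (\<psi> x) (\<psi> y)"
    unfolding AE_lebesgue_on[OF unit_square_borel] unit_square_measure split_def .
  with *(1,2) show ?thesis unfolding graphon_equiv_def by blast
qed

section \<open>Real analyticity\<close>

text \<open>Analyticity is handled by absolutely convergent sums of monomials over an arbitrary index
  type: products are then indexed by pairs and substitutions into power series by lists.\<close>

definition mono_sum :: "real \<Rightarrow> ('k \<Rightarrow> real) \<Rightarrow> ('k \<Rightarrow> nat) \<Rightarrow> ('k \<Rightarrow> nat) \<Rightarrow> bool" where
  "mono_sum r c m n \<longleftrightarrow> (\<lambda>k. \<bar>c k\<bar> * r ^ (m k + n k)) summable_on UNIV"

text \<open>Absolute summability up to the corner \<open>(r, r)\<close> is built in, since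
  rearrangements of products and substitutions rest on it.\<close>

definition analytic_at2 :: "(real \<Rightarrow> real \<Rightarrow> real) \<Rightarrow> real \<Rightarrow> real \<Rightarrow> bool" where
  "analytic_at2 f a b \<longleftrightarrow> (\<exists>r>0. \<exists>c :: nat \<times> nat \<Rightarrow> real. mono_sum r c fst snd \<and>
     (\<forall>x y. \<bar>x - a\<bar> \<le> r \<and> \<bar>y - b\<bar> \<le> r \<longrightarrow>
       ((\<lambda>k. c k * (x - a) ^ fst k * (y - b) ^ snd k) has_sum f x y) UNIV))"

lemma mono_sum_abs_summable:
  assumes c: "mono_sum r c m n" and x: "\<bar>x\<bar> \<le> r" "\<bar>y\<bar> \<le> r"
  shows "(\<lambda>k. norm (c k * x ^ m k * y ^ n k)) summable_on UNIV"
proof (rule summable_on_comparison_test)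
  show "(\<lambda>k. \<bar>c k\<bar> * r ^ (m k + n k)) summable_on UNIV" using c by (simp add: mono_sum_def)
  show "norm (c k * x ^ m k * y ^ n k) \<le> \<bar>c k\<bar> * r ^ (m k + n k)" for k
  proof -
    have "\<bar>x\<bar> ^ m k * \<bar>y\<bar> ^ n k \<le> r ^ m k * r ^ n k"
      using x by (intro mult_mono power_mono) auto
    then have "\<bar>c k\<bar> * (\<bar>x\<bar> ^ m k * \<bar>y\<bar> ^ n k) \<le> \<bar>c k\<bar> * (r ^ m k * r ^ n k)"
      by (rule mult_left_mono) simp
    then show ?thesis by (simp add: abs_mult power_abs power_add mult.assoc)
  qed
qed simp

lemma mono_sum_mono:
  assumes "mono_sum r c m n" "0 \<le> s" "s \<le> r"
  shows "mono_sum s c m n"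
  unfolding mono_sum_def
proof (rule summable_on_comparison_test)
  show "(\<lambda>k. \<bar>c k\<bar> * r ^ (m k + n k)) summable_on UNIV" using assms(1) by (simp add: mono_sum_def)
  show "\<bar>c k\<bar> * s ^ (m k + n k) \<le> \<bar>c k\<bar> * r ^ (m k + n k)" for k
    using assms by (intro mult_left_mono power_mono) auto
qed (use assms in auto)

text \<open>Terms of the same bidegree are collected. Infinitely many indices may share a bidegree;
  absolute summability justifies both the fibre sums and the regrouping. All closure properties
  below only have to produce some family of monomials.\<close>

lemma analytic_at2_regroup:
  fixes c :: "'k \<Rightarrow> real"
  assumes r: "r > 0" and c: "mono_sum r c m n"
    and f: "\<And>x y. \<bar>x - a\<bar> \<le> r \<Longrightarrow> \<bar>y - b\<bar> \<le> r \<Longrightarrow>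
      ((\<lambda>k. c k * (x - a) ^ m k * (y - b) ^ n k) has_sum f x y) UNIV"
  shows "analytic_at2 f a b"
proof -
  define deg where "deg k = (m k, n k)" for k
  define d where "d p = (\<Sum>\<^sub>\<infinity>k\<in>deg -` {p}. c k)" for p
  define S where "S = (SIGMA p:UNIV. deg -` {p})"
  have bij: "bij_betw snd S UNIV"
    by (rule bij_betwI[of _ _ _ "\<lambda>k. (deg k, k)"]) (auto simp: S_def)
  \<comment> \<open>On a fibre of \<open>deg\<close> the factor \<open>r ^ (m k + n k)\<close> is a
    positive constant and can be divided out.\<close>
  have fib: "c summable_on deg -` {p}" "(\<lambda>k. \<bar>c k\<bar>) summable_on deg -` {p}" for p
  proof -
    have "(\<lambda>k. \<bar>c k\<bar> * r ^ (m k + n k)) summable_on deg -` {p}"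
      using c unfolding mono_sum_def by (rule summable_on_subset_banach) simp
    then have "(\<lambda>k. (1 / r ^ (fst p + snd p)) * (\<bar>c k\<bar> * r ^ (m k + n k))) summable_on deg -` {p}"
      by (rule summable_on_cmult_right)
    also have "?this \<longleftrightarrow> (\<lambda>k. \<bar>c k\<bar>) summable_on deg -` {p}"
      using r by (intro summable_on_cong) (auto simp: deg_def)
    finally show "(\<lambda>k. \<bar>c k\<bar>) summable_on deg -` {p}" .
    then show "c summable_on deg -` {p}"
      using abs_summable_summable[of c "deg -` {p}"] by simp
  qed
  have D: "mono_sum r d fst snd"
    unfolding mono_sum_def
  proof (rule summable_on_comparison_test)
    have "(\<lambda>k. \<bar>c k\<bar> * r ^ (m k + n k)) summable_on UNIV" using c by (simp add: mono_sum_def)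
    then have "(\<lambda>q. \<bar>c (snd q)\<bar> * r ^ (m (snd q) + n (snd q))) summable_on S"
      using summable_on_reindex_bij_betw[OF bij, of "\<lambda>k. \<bar>c k\<bar> * r ^ (m k + n k)"] by simp
    then have "(\<lambda>(p, k). \<bar>c k\<bar> * r ^ (m k + n k)) summable_on (SIGMA p:UNIV. deg -` {p})"
      by (simp add: S_def split_def)
    then show "(\<lambda>p. \<Sum>\<^sub>\<infinity>k\<in>deg -` {p}. \<bar>c k\<bar> * r ^ (m k + n k)) summable_on UNIV"
      by (rule summable_on_Sigma_banach)
    fix p :: "nat \<times> nat"
    have "\<bar>d p\<bar> \<le> (\<Sum>\<^sub>\<infinity>k\<in>deg -` {p}. \<bar>c k\<bar>)"
      using norm_infsum_bound[of c "deg -` {p}"] fib(2)[of p] by (simp add: d_def)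
    then have "\<bar>d p\<bar> * r ^ (fst p + snd p) \<le> (\<Sum>\<^sub>\<infinity>k\<in>deg -` {p}. \<bar>c k\<bar>) * r ^ (fst p + snd p)"
      using r by (intro mult_right_mono) auto
    also have "\<dots> = (\<Sum>\<^sub>\<infinity>k\<in>deg -` {p}. \<bar>c k\<bar> * r ^ (fst p + snd p))"
      using fib(2)[of p] by (subst infsum_cmult_left) auto
    also have "\<dots> = (\<Sum>\<^sub>\<infinity>k\<in>deg -` {p}. \<bar>c k\<bar> * r ^ (m k + n k))"
      by (intro infsum_cong) (auto simp: deg_def)
    finally show "\<bar>d p\<bar> * r ^ (fst p + snd p) \<le> (\<Sum>\<^sub>\<infinity>k\<in>deg -` {p}. \<bar>c k\<bar> * r ^ (m k + n k))" .
  qed (use r in auto)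
  have "((\<lambda>k. d k * (x - a) ^ fst k * (y - b) ^ snd k) has_sum f x y) UNIV"
    if xy: "\<bar>x - a\<bar> \<le> r" "\<bar>y - b\<bar> \<le> r" for x y
  proof -
    have "((\<lambda>k. c k * (x - a) ^ m k * (y - b) ^ n k) has_sum f x y) UNIV" by (rule f[OF xy])
    then have "((\<lambda>q. c (snd q) * (x - a) ^ m (snd q) * (y - b) ^ n (snd q)) has_sum f x y) S"
      using has_sum_reindex_bij_betw[OF bij, of "\<lambda>k. c k * (x - a) ^ m k * (y - b) ^ n k"] by simp
    then have sig: "((\<lambda>(p, k). c k * (x - a) ^ m k * (y - b) ^ n k) has_sum f x y) (SIGMA p:UNIV. deg -` {p})"
      by (simp add: S_def split_def)
    have fibsum: "((\<lambda>k. c k * (x - a) ^ m k * (y - b) ^ n k) has_sum d p * (x - a) ^ fst p * (y - b) ^ snd p) (deg -` {p})" for p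
    proof -
      have "(c has_sum d p) (deg -` {p})" unfolding d_def by (rule has_sum_infsum[OF fib(1)])
      then have "((\<lambda>k. c k * ((x - a) ^ fst p * (y - b) ^ snd p)) has_sum d p * ((x - a) ^ fst p * (y - b) ^ snd p)) (deg -` {p})"
        by (rule has_sum_cmult_left)
      also have "?this \<longleftrightarrow> ?thesis"
        by (simp only: mult.assoc) (intro has_sum_cong, auto simp: deg_def)
      finally show ?thesis .
    qed
    show ?thesis
      using has_sum_SigmaD[OF sig, of "\<lambda>p. d p * (x - a) ^ fst p * (y - b) ^ snd p"] fibsum by simp
  qed
  then show ?thesis unfolding analytic_at2_def using r D by blast
qed

lemma analytic_at2_cong:
  assumes f: "analytic_at2 f a b" and s: "s > 0"
    and eq: "\<And>x y. \<bar>x - a\<bar> < s \<Longrightarrow> \<bar>y - b\<bar> < s \<Longrightarrow> g x y = f x y"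
  shows "analytic_at2 g a b"
proof -
  obtain r c where r: "r > 0" "mono_sum r c fst snd"
    "\<And>x y. \<bar>x - a\<bar> \<le> r \<Longrightarrow> \<bar>y - b\<bar> \<le> r \<Longrightarrow> ((\<lambda>k. c k * (x - a) ^ fst k * (y - b) ^ snd k) has_sum f x y) UNIV"
    using f unfolding analytic_at2_def by blast
  define q where "q = min r (s / 2)"
  have q: "q > 0" "q \<le> r" "q < s" using r(1) s by (auto simp: q_def)
  show ?thesis
  proof (rule analytic_at2_regroup[OF q(1) mono_sum_mono[OF r(2)]])
    fix x y assume xy: "\<bar>x - a\<bar> \<le> q" "\<bar>y - b\<bar> \<le> q"
    have "g x y = f x y" using xy q by (intro eq) auto
    then show "((\<lambda>k. c k * (x - a) ^ fst k * (y - b) ^ snd k) has_sum g x y) UNIV"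
      using r(3)[of x y] xy q by simp
  qed (use q in auto)
qed

lemma real_analytic_onI:
  assumes "\<And>a b. (a, b) \<in> U \<Longrightarrow> analytic_at2 f a b"
  shows "real_analytic_on f U"
  unfolding real_analytic_on_def
proof clarify
  fix a b assume "(a, b) \<in> U"
  from assms[OF this] obtain r c where r: "r > 0"
    "\<And>x y. \<bar>x - a\<bar> \<le> r \<Longrightarrow> \<bar>y - b\<bar> \<le> r \<Longrightarrow> ((\<lambda>k. c k * (x - a) ^ fst k * (y - b) ^ snd k) has_sum f x y) UNIV"
    unfolding analytic_at2_def by blast
  show "\<exists>r>0. \<exists>c :: nat \<Rightarrow> nat \<Rightarrow> real. \<forall>x y. \<bar>x - a\<bar> < r \<and> \<bar>y - b\<bar> < r \<longrightarrow>
      ((\<lambda>(i, j). c i j * (x - a) ^ i * (y - b) ^ j) has_sum f x y) UNIV"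
    by (intro exI[of _ r] conjI r(1) exI[of _ "\<lambda>i j. c (i, j)"] allI impI)
      (use r(2) in \<open>auto simp: split_def less_imp_le\<close>)
qed

lemma analytic_at2_finite:
  fixes c :: "'k::finite \<Rightarrow> real"
  assumes "\<And>x y. f x y = (\<Sum>k\<in>UNIV. c k * (x - a) ^ m k * (y - b) ^ n k)"
  shows "analytic_at2 f a b"
  by (rule analytic_at2_regroup[of 1 c m n]) (simp_all add: mono_sum_def assms summable_on_finite has_sum_finite)

lemma analytic_at2_const: "analytic_at2 (\<lambda>x y. c) a b"
  by (rule analytic_at2_finite[of _ "\<lambda>_::unit. c" _ "\<lambda>_. 0" _ "\<lambda>_. 0"]) simp

lemma analytic_at2_fst: "analytic_at2 (\<lambda>x y. x) a b"
  by (rule analytic_at2_finite[of _ "\<lambda>k::bool. if k then 1 else a" _ "\<lambda>k. if k then 1 else 0" _ "\<lambda>_. 0"])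
    (simp add: UNIV_bool)

lemma analytic_at2_snd: "analytic_at2 (\<lambda>x y. y) a b"
  by (rule analytic_at2_finite[of _ "\<lambda>k::bool. if k then 1 else b" _ "\<lambda>_. 0" _ "\<lambda>k. if k then 1 else 0"])
    (simp add: UNIV_bool)

lemma analytic_at2_obtain:
  assumes "analytic_at2 f a b" "analytic_at2 g a b"
  obtains r c d where "r > 0" "mono_sum r c fst snd" "mono_sum r d fst snd"
    "\<And>x y. \<bar>x - a\<bar> \<le> r \<Longrightarrow> \<bar>y - b\<bar> \<le> r \<Longrightarrow> ((\<lambda>k. c k * (x - a) ^ fst k * (y - b) ^ snd k) has_sum f x y) UNIV"
    "\<And>x y. \<bar>x - a\<bar> \<le> r \<Longrightarrow> \<bar>y - b\<bar> \<le> r \<Longrightarrow> ((\<lambda>k. d k * (x - a) ^ fst k * (y - b) ^ snd k) has_sum g x y) UNIV"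
proof -
  obtain r1 c where 1: "r1 > 0" "mono_sum r1 c fst snd"
    "\<And>x y. \<bar>x - a\<bar> \<le> r1 \<Longrightarrow> \<bar>y - b\<bar> \<le> r1 \<Longrightarrow> ((\<lambda>k. c k * (x - a) ^ fst k * (y - b) ^ snd k) has_sum f x y) UNIV"
    using assms(1) unfolding analytic_at2_def by blast
  obtain r2 d where 2: "r2 > 0" "mono_sum r2 d fst snd"
    "\<And>x y. \<bar>x - a\<bar> \<le> r2 \<Longrightarrow> \<bar>y - b\<bar> \<le> r2 \<Longrightarrow> ((\<lambda>k. d k * (x - a) ^ fst k * (y - b) ^ snd k) has_sum g x y) UNIV"
    using assms(2) unfolding analytic_at2_def by blast
  show thesis
    by (rule that[of "min r1 r2" c d]) (use 1 2 in \<open>auto intro: mono_sum_mono\<close>)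
qed

text \<open>The sum of absolute values is carried along because it justifies the sum over pairs, and
  because it is the second hypothesis needed to iterate the lemma in
  \<open>has_sum_lists\<close>.\<close>

lemma has_sum_times_abs:
  fixes f :: "'k \<Rightarrow> real" and g :: "'l \<Rightarrow> real"
  assumes f: "(f has_sum A) S" and g: "(g has_sum B) T"
    and F: "((\<lambda>k. \<bar>f k\<bar>) has_sum F) S" and G: "((\<lambda>l. \<bar>g l\<bar>) has_sum G) T"
  shows "((\<lambda>(k, l). f k * g l) has_sum A * B) (S \<times> T)"
    and "((\<lambda>(k, l). \<bar>f k * g l\<bar>) has_sum F * G) (S \<times> T)"
proof -
  have rows: "((\<lambda>l. \<bar>f k * g l\<bar>) has_sum \<bar>f k\<bar> * G) T" for k
    unfolding abs_mult by (rule has_sum_cmult_right[OF G])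
  have cols: "((\<lambda>k. \<bar>f k\<bar> * G) has_sum F * G) S" by (rule has_sum_cmult_left[OF F])
  have s: "(\<lambda>(k, l). \<bar>f k * g l\<bar>) summable_on (S \<times> T)"
    by (rule summable_on_SigmaI[where g = "\<lambda>k. \<bar>f k\<bar> * G"])
      (use rows cols in \<open>auto simp: summable_on_def\<close>)
  show "((\<lambda>(k, l). \<bar>f k * g l\<bar>) has_sum F * G) (S \<times> T)"
    by (rule has_sum_SigmaI[OF _ cols s]) (use rows in simp)
  have s': "(\<lambda>(k, l). f k * g l) summable_on (S \<times> T)"
    by (rule Infinite_Sum.abs_summable_summable) (use s in \<open>simp add: split_def\<close>)
  have "((\<lambda>k. f k * B) has_sum A * B) S" by (rule has_sum_cmult_left[OF f])
  then show "((\<lambda>(k, l). f k * g l) has_sum A * B) (S \<times> T)"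
    by (rule has_sum_SigmaI[OF _ _ s', rotated]) (use has_sum_cmult_right[OF g] in simp)
qed

lemma analytic_at2_mult:
  assumes "analytic_at2 f a b" "analytic_at2 g a b"
  shows "analytic_at2 (\<lambda>x y. f x y * g x y) a b"
proof -
  obtain r c d where r: "r > 0" "mono_sum r c fst snd" "mono_sum r d fst snd"
    and f: "\<And>x y. \<bar>x - a\<bar> \<le> r \<Longrightarrow> \<bar>y - b\<bar> \<le> r \<Longrightarrow> ((\<lambda>k. c k * (x - a) ^ fst k * (y - b) ^ snd k) has_sum f x y) UNIV"
    and g: "\<And>x y. \<bar>x - a\<bar> \<le> r \<Longrightarrow> \<bar>y - b\<bar> \<le> r \<Longrightarrow> ((\<lambda>k. d k * (x - a) ^ fst k * (y - b) ^ snd k) has_sum g x y) UNIV"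
    by (rule analytic_at2_obtain[OF assms]) blast
  define m where "m q = fst (fst q) + fst (snd q)" for q :: "(nat \<times> nat) \<times> (nat \<times> nat)"
  define n where "n q = snd (fst q) + snd (snd q)" for q :: "(nat \<times> nat) \<times> (nat \<times> nat)"
  have S: "((\<lambda>q. (c (fst q) * X ^ fst (fst q) * Y ^ snd (fst q)) * (d (snd q) * X ^ fst (snd q) * Y ^ snd (snd q))) has_sum A * B) UNIV"
      "(\<lambda>q. \<bar>(c (fst q) * X ^ fst (fst q) * Y ^ snd (fst q)) * (d (snd q) * X ^ fst (snd q) * Y ^ snd (snd q))\<bar>) summable_on UNIV"
    if "\<bar>X\<bar> \<le> r" "\<bar>Y\<bar> \<le> r" "((\<lambda>k. c k * X ^ fst k * Y ^ snd k) has_sum A) UNIV"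
      "((\<lambda>k. d k * X ^ fst k * Y ^ snd k) has_sum B) UNIV" for X Y A B
  proof -
    have "(\<lambda>k. \<bar>c k * X ^ fst k * Y ^ snd k\<bar>) summable_on UNIV" "(\<lambda>k. \<bar>d k * X ^ fst k * Y ^ snd k\<bar>) summable_on UNIV"
      using mono_sum_abs_summable[OF r(2) that(1,2)] mono_sum_abs_summable[OF r(3) that(1,2)] by simp_all
    from has_sum_times_abs[OF that(3,4) has_sum_infsum[OF this(1)] has_sum_infsum[OF this(2)]]
    show "((\<lambda>q. (c (fst q) * X ^ fst (fst q) * Y ^ snd (fst q)) * (d (snd q) * X ^ fst (snd q) * Y ^ snd (snd q))) has_sum A * B) UNIV"
      "(\<lambda>q. \<bar>(c (fst q) * X ^ fst (fst q) * Y ^ snd (fst q)) * (d (snd q) * X ^ fst (snd q) * Y ^ snd (snd q))\<bar>) summable_on UNIV"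
      by (simp_all add: split_def summable_on_def) blast
  qed
  have eq: "(c (fst q) * X ^ fst (fst q) * Y ^ snd (fst q)) * (d (snd q) * X ^ fst (snd q) * Y ^ snd (snd q))
      = c (fst q) * d (snd q) * X ^ m q * Y ^ n q" for q X Y
    by (simp add: m_def n_def power_add mult_ac)
  show ?thesis
  proof (rule analytic_at2_regroup[OF r(1), of "\<lambda>q. c (fst q) * d (snd q)" m n])
    show "((\<lambda>q. c (fst q) * d (snd q) * (x - a) ^ m q * (y - b) ^ n q) has_sum f x y * g x y) UNIV"
      if "\<bar>x - a\<bar> \<le> r" "\<bar>y - b\<bar> \<le> r" for x y
      using S(1)[OF that f[OF that] g[OF that]] unfolding eq .
    have "\<bar>(a + r) - a\<bar> \<le> r" "\<bar>(b + r) - b\<bar> \<le> r" using r(1) by auto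
    from f[OF this] g[OF this] have "(\<lambda>q. \<bar>c (fst q) * d (snd q) * r ^ m q * r ^ n q\<bar>) summable_on UNIV"
      using S(2)[of r r] r(1) unfolding eq by simp
    then show "mono_sum r (\<lambda>q. c (fst q) * d (snd q)) m n"
      using r(1) by (simp add: mono_sum_def abs_mult power_add mult.assoc)
  qed
qed

lemma analytic_at2_add:
  assumes "analytic_at2 f a b" "analytic_at2 g a b"
  shows "analytic_at2 (\<lambda>x y. f x y + g x y) a b"
proof -
  obtain r c d where r: "r > 0" "mono_sum r c fst snd" "mono_sum r d fst snd"
    and f: "\<And>x y. \<bar>x - a\<bar> \<le> r \<Longrightarrow> \<bar>y - b\<bar> \<le> r \<Longrightarrow> ((\<lambda>k. c k * (x - a) ^ fst k * (y - b) ^ snd k) has_sum f x y) UNIV"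
    and g: "\<And>x y. \<bar>x - a\<bar> \<le> r \<Longrightarrow> \<bar>y - b\<bar> \<le> r \<Longrightarrow> ((\<lambda>k. d k * (x - a) ^ fst k * (y - b) ^ snd k) has_sum g x y) UNIV"
    by (rule analytic_at2_obtain[OF assms]) blast
  show ?thesis
  proof (rule analytic_at2_regroup[OF r(1), of "\<lambda>k. c k + d k" fst snd])
    show "((\<lambda>k. (c k + d k) * (x - a) ^ fst k * (y - b) ^ snd k) has_sum f x y + g x y) UNIV"
      if "\<bar>x - a\<bar> \<le> r" "\<bar>y - b\<bar> \<le> r" for x y
      using has_sum_add[OF f[OF that] g[OF that]] by (simp add: algebra_simps)
    have "(\<lambda>k. \<bar>c k\<bar> * r ^ (fst k + snd k) + \<bar>d k\<bar> * r ^ (fst k + snd k)) summable_on UNIV"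
      using r(2,3) unfolding mono_sum_def by (rule summable_on_add)
    then show "mono_sum r (\<lambda>k. c k + d k) fst snd"
      unfolding mono_sum_def
    proof (rule summable_on_comparison_test)
      show "\<bar>c k + d k\<bar> * r ^ (fst k + snd k) \<le> \<bar>c k\<bar> * r ^ (fst k + snd k) + \<bar>d k\<bar> * r ^ (fst k + snd k)" for k
        using r(1) by (simp add: abs_triangle_ineq mult_right_mono flip: distrib_right)
    qed (use r(1) in simp)
  qed
qed

lemma analytic_at2_cmult: "analytic_at2 f a b \<Longrightarrow> analytic_at2 (\<lambda>x y. c * f x y) a b"
  by (rule analytic_at2_mult[OF analytic_at2_const])

lemma analytic_at2_diff:
  assumes "analytic_at2 f a b" "analytic_at2 g a b"
  shows "analytic_at2 (\<lambda>x y. f x y - g x y) a b"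
  using analytic_at2_add[OF assms(1) analytic_at2_cmult[OF assms(2), of "-1"]] by simp

lemma analytic_at2_power:
  assumes "analytic_at2 f a b"
  shows "analytic_at2 (\<lambda>x y. f x y ^ n) a b"
proof (induction n)
  case (Suc n)
  from analytic_at2_mult[OF assms Suc] show ?case by simp
qed (simp add: analytic_at2_const)

lemma analytic_at2_sum:
  assumes "finite I" "\<And>i. i \<in> I \<Longrightarrow> analytic_at2 (f i) a b"
  shows "analytic_at2 (\<lambda>x y. \<Sum>i\<in>I. f i x y) a b"
  using assms
proof (induction I)
  case (insert i I)
  then have "analytic_at2 (\<lambda>x y. f i x y + (\<Sum>i\<in>I. f i x y)) a b" by (intro analytic_at2_add) auto
  then show ?case using insert.hyps by simp
qed (simp add: analytic_at2_const)

text \<open>A power of a sum expanded over words of length \<open>n\<close>. This is what turns the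
  substitution into a power series into one sum over all lists.\<close>

lemma has_sum_lists:
  fixes f :: "'k \<Rightarrow> real"
  assumes "(f has_sum A) UNIV" "((\<lambda>k. \<bar>f k\<bar>) has_sum F) UNIV"
  shows "((\<lambda>l. prod_list (map f l)) has_sum A ^ n) {l. length l = n} \<and>
    ((\<lambda>l. \<bar>prod_list (map f l)\<bar>) has_sum F ^ n) {l. length l = n}"
proof (induction n)
  case 0
  have "{l :: 'k list. length l = 0} = {[]}" by auto
  then show ?case by (simp add: has_sum_finiteI)
next
  case (Suc n)
  have bij: "bij_betw (\<lambda>(k, l). k # l) (UNIV \<times> {l. length l = n}) {l :: 'k list. length l = Suc n}"
    by (rule bij_betwI[of _ _ _ "\<lambda>l. (hd l, tl l)"]) (auto simp: length_Suc_conv)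
  from has_sum_times_abs[OF assms(1) conjunct1[OF Suc] assms(2) conjunct2[OF Suc]]
  show ?case
    unfolding has_sum_reindex_bij_betw[OF bij, symmetric] by (simp add: split_def)
qed

lemma prod_list_monomials:
  "prod_list (map (\<lambda>k. c k * X ^ m k * Y ^ n k) l)
    = prod_list (map c l) * X ^ sum_list (map m l) * (Y :: real) ^ sum_list (map n l)"
  by (induction l) (simp_all add: power_add mult_ac)

lemma prod_list_abs: "\<bar>prod_list (map f l)\<bar> = prod_list (map (\<lambda>k. \<bar>f k :: real\<bar>) l)"
  by (induction l) (simp_all add: abs_mult)

text \<open>Expanding each power of \<open>f x y - f a b\<close> over words gives a single family of
  monomials indexed by lists of bidegrees. The normalization \<open>\<bar>F n\<bar> \<le> 1\<close>
  with radius 1/2 covers the exponential and the logarithm and makes a geometric series the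
  majorant.\<close>

lemma analytic_at2_compose:
  fixes F :: "nat \<Rightarrow> real"
  assumes f: "analytic_at2 f a b" and F: "\<And>n. \<bar>F n\<bar> \<le> 1"
    and G: "\<And>z. \<bar>z\<bar> \<le> 1/2 \<Longrightarrow> (\<lambda>n. F n * z ^ n) sums G (f a b + z)"
  shows "analytic_at2 (\<lambda>x y. G (f x y)) a b"
proof -
  obtain r c0 where r: "r > 0" "mono_sum r c0 fst snd"
    and f0: "\<And>x y. \<bar>x - a\<bar> \<le> r \<Longrightarrow> \<bar>y - b\<bar> \<le> r \<Longrightarrow> ((\<lambda>k. c0 k * (x - a) ^ fst k * (y - b) ^ snd k) has_sum f x y) UNIV"
    using f unfolding analytic_at2_def by blast
  \<comment> \<open>Without the constant term every monomial has positive degree, so the majorant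
    shrinks at least in proportion to the radius.\<close>
  define c where "c = c0((0, 0) := 0)"
  have f1: "((\<lambda>k. c k * (x - a) ^ fst k * (y - b) ^ snd k) has_sum f x y - c0 (0, 0)) UNIV"
    if "\<bar>x - a\<bar> \<le> r" "\<bar>y - b\<bar> \<le> r" for x y
  proof -
    have "((\<lambda>k. if k = (0, 0) then c0 (0, 0) else 0) has_sum c0 (0, 0)) UNIV"
      by (rule has_sum_cong_neutral[THEN iffD1, OF _ _ _ has_sum_finite[of "{(0, 0)}" "\<lambda>_. c0 (0, 0)", simplified]]) auto
    from has_sum_add[OF f0[OF that] has_sum_cmult_right[OF this, of "-1"]]
    have "((\<lambda>k. c0 k * (x - a) ^ fst k * (y - b) ^ snd k + - 1 * (if k = (0, 0) then c0 (0, 0) else 0))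
        has_sum f x y - c0 (0, 0)) UNIV" by simp
    then show ?thesis
      by (rule has_sum_cong[THEN iffD1, rotated]) (auto simp: c_def)
  qed
  have z0: "f a b = c0 (0, 0)"
  proof -
    have "((\<lambda>k. c k * (a - a) ^ fst k * (b - b) ^ snd k) has_sum f a b - c0 (0, 0)) UNIV"
      using r(1) by (intro f1) auto
    moreover have "c k * (a - a) ^ fst k * (b - b) ^ snd k = 0" for k
      by (cases k) (auto simp: c_def power_0_left)
    then have "((\<lambda>k. c k * (a - a) ^ fst k * (b - b) ^ snd k) has_sum 0) UNIV" by (intro has_sum_0)
    ultimately have "f a b - c0 (0, 0) = 0" by (rule has_sum_unique)
    then show ?thesis by simp
  qed
  have cr: "mono_sum r c fst snd"
    unfolding mono_sum_def
  proof (rule summable_on_comparison_test)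
    show "(\<lambda>k. \<bar>c0 k\<bar> * r ^ (fst k + snd k)) summable_on UNIV" using r(2) by (simp add: mono_sum_def)
  qed (use r(1) in \<open>auto simp: c_def\<close>)
  define B where "B = (\<Sum>\<^sub>\<infinity>k. \<bar>c k\<bar> * r ^ (fst k + snd k))"
  have B: "((\<lambda>k. \<bar>c k\<bar> * r ^ (fst k + snd k)) has_sum B) UNIV"
    unfolding B_def using cr by (intro has_sum_infsum) (simp add: mono_sum_def)
  have B0: "B \<ge> 0" by (rule has_sum_nonneg[OF B]) (use r(1) in auto)
  \<comment> \<open>Since \<open>Q \<le> s / r * B\<close>, this radius makes the majorant
    \<open>Q\<close> of \<open>f x y - f a b\<close> at most 1/2. The added 1 prevents a division by
    zero.\<close>
  define s where "s = min r (r / (2 * (B + 1)))"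
  have s: "s > 0" "s \<le> r" using r(1) B0 by (auto simp: s_def)
  have cs: "mono_sum s c fst snd" by (rule mono_sum_mono[OF cr]) (use s in auto)
  define Q where "Q = (\<Sum>\<^sub>\<infinity>k. \<bar>c k\<bar> * s ^ (fst k + snd k))"
  have Q: "((\<lambda>k. \<bar>c k\<bar> * s ^ (fst k + snd k)) has_sum Q) UNIV"
    unfolding Q_def using cs by (intro has_sum_infsum) (simp add: mono_sum_def)
  have "Q \<le> s / r * B"
  proof (rule has_sum_mono[OF Q has_sum_cmult_right[OF B]])
    fix k :: "nat \<times> nat"
    show "\<bar>c k\<bar> * s ^ (fst k + snd k) \<le> s / r * (\<bar>c k\<bar> * r ^ (fst k + snd k))"
    proof (cases "k = (0, 0)")
      case False
      then obtain d where d: "fst k + snd k = Suc d" 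
      proof -
        have "fst k + snd k \<noteq> 0" using False by (cases k) auto
        then show thesis using that not0_implies_Suc by blast
      qed
      have "s ^ Suc d \<le> s * r ^ d" using s by (auto intro: mult_left_mono power_mono)
      also have "\<dots> = s / r * r ^ Suc d" using r(1) by simp
      finally have "\<bar>c k\<bar> * s ^ Suc d \<le> \<bar>c k\<bar> * (s / r * r ^ Suc d)" by (rule mult_left_mono) simp
      then show ?thesis by (simp only: d mult.left_commute)
    qed (simp add: c_def)
  qed
  also have "\<dots> \<le> 1/2"
  proof -
    have "s / r \<le> (r / (2 * (B + 1))) / r" using r(1) by (intro divide_right_mono) (auto simp: s_def)
    also have "\<dots> = 1 / (2 * (B + 1))" using r(1) by simp
    finally have "s / r \<le> 1 / (2 * (B + 1))" .
    then have "s / r * B \<le> 1 / (2 * (B + 1)) * B" using B0 by (rule mult_right_mono)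
    also have "\<dots> \<le> 1/2" using B0 by (simp add: field_simps)
    finally show ?thesis .
  qed
  finally have Q12: "Q \<le> 1/2" .
  have Q0: "Q \<ge> 0" by (rule has_sum_nonneg[OF Q]) (use s in auto)
  let ?S = "SIGMA n:UNIV. {l :: (nat \<times> nat) list. length l = n}"
  have bij: "bij_betw snd ?S UNIV"
    by (rule bij_betwI[of _ _ _ "\<lambda>l. (length l, l)"]) auto
  have geom: "(\<lambda>n. \<bar>F n\<bar> * Q ^ n) summable_on UNIV"
  proof (rule summable_on_comparison_test)
    have "summable (\<lambda>n. norm (Q ^ n))" using Q0 Q12 by (simp add: norm_power summable_geometric)
    then show "(\<lambda>n. Q ^ n) summable_on UNIV" by (rule norm_summable_imp_summable_on)
    show "\<bar>F n\<bar> * Q ^ n \<le> Q ^ n" for n using F[of n] Q0 by (simp add: mult_left_le_one_le)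
  qed (use Q0 in simp)
  show ?thesis
  proof (rule analytic_at2_regroup[OF s(1), of "\<lambda>l. F (length l) * prod_list (map c l)"
        "\<lambda>l. sum_list (map fst l)" "\<lambda>l. sum_list (map snd l)"])
    let ?W = "\<lambda>l. \<bar>F (length l) * prod_list (map c l)\<bar> * s ^ (sum_list (map fst l) + sum_list (map snd l))"
    have W: "?W l = \<bar>F (length l)\<bar> * \<bar>prod_list (map (\<lambda>k. \<bar>c k\<bar> * s ^ (fst k + snd k)) l)\<bar>" for l
    proof -
      have "prod_list (map (\<lambda>k. \<bar>c k\<bar> * s ^ (fst k + snd k)) l) = prod_list (map (\<lambda>k. \<bar>c k\<bar> * s ^ fst k * s ^ snd k) l)"
        by (simp add: power_add mult.assoc)
      also have "\<dots> = \<bar>prod_list (map c l)\<bar> * s ^ (sum_list (map fst l) + sum_list (map snd l))"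
        unfolding prod_list_monomials prod_list_abs by (simp add: power_add mult.assoc)
      finally show ?thesis using s(1) by (simp add: abs_mult mult.assoc)
    qed
    have Qabs: "((\<lambda>k. \<bar>\<bar>c k\<bar> * s ^ (fst k + snd k)\<bar>) has_sum Q) UNIV" using Q s(1) by (simp add: abs_mult)
    have Wn: "?W l = \<bar>F n\<bar> * \<bar>prod_list (map (\<lambda>k. \<bar>c k\<bar> * s ^ (fst k + snd k)) l)\<bar>" if "length l = n" for l n
      using W[of l] unfolding that .
    have rows: "((\<lambda>l. ?W l) has_sum \<bar>F n\<bar> * Q ^ n) {l. length l = n}" for n
      using has_sum_cmult_right[OF conjunct2[OF has_sum_lists[OF Q Qabs, of n]], of "\<bar>F n\<bar>"]
      by (rule has_sum_cong[THEN iffD1, rotated]) (rule Wn[symmetric], simp)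
    have "(\<lambda>q. ?W (snd q)) summable_on ?S"
    proof (rule summable_on_SigmaI[OF _ geom])
      show "((\<lambda>l. ?W (snd (n, l))) has_sum \<bar>F n\<bar> * Q ^ n) {l. length l = n}" for n
        unfolding snd_conv by (rule rows)
      show "0 \<le> ?W (snd (n, l))" for n l using s(1) by (intro mult_nonneg_nonneg abs_ge_zero zero_le_power) simp
    qed
    then show "mono_sum s (\<lambda>l. F (length l) * prod_list (map c l)) (\<lambda>l. sum_list (map fst l)) (\<lambda>l. sum_list (map snd l))"
      unfolding mono_sum_def using summable_on_reindex_bij_betw[OF bij, of ?W] by simp
    then have ms: "mono_sum s (\<lambda>l. F (length l) * prod_list (map c l)) (\<lambda>l. sum_list (map fst l)) (\<lambda>l. sum_list (map snd l))" .
    fix x y assume xy: "\<bar>x - a\<bar> \<le> s" "\<bar>y - b\<bar> \<le> s"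
    define z where "z = f x y - f a b"
    let ?t = "\<lambda>k. c k * (x - a) ^ fst k * (y - b) ^ snd k"
    have t: "(?t has_sum z) UNIV" using f1[of x y] xy s(2) by (simp add: z_def z0)
    have tabs: "(\<lambda>k. \<bar>?t k\<bar>) summable_on UNIV"
      using mono_sum_abs_summable[OF cs xy] by simp
    have zQ: "\<bar>z\<bar> \<le> Q"
    proof -
      have "norm z \<le> (\<Sum>\<^sub>\<infinity>k. norm (?t k))"
        using norm_infsum_bound[of ?t UNIV] tabs infsumI[OF t] by simp
      also have "\<dots> \<le> Q"
      proof (rule has_sum_mono[OF has_sum_infsum Q])
        show "norm (?t k) \<le> \<bar>c k\<bar> * s ^ (fst k + snd k)" for k
        proof -
          have "\<bar>x - a\<bar> ^ fst k * \<bar>y - b\<bar> ^ snd k \<le> s ^ fst k * s ^ snd k"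
            using xy s by (intro mult_mono power_mono) auto
          then have "\<bar>c k\<bar> * (\<bar>x - a\<bar> ^ fst k * \<bar>y - b\<bar> ^ snd k) \<le> \<bar>c k\<bar> * (s ^ fst k * s ^ snd k)"
            by (rule mult_left_mono) simp
          then show ?thesis by (simp add: abs_mult power_abs power_add mult.assoc)
        qed
      qed (use tabs in simp)
      finally show ?thesis by simp
    qed
    then have z12: "\<bar>z\<bar> \<le> 1/2" using Q12 by linarith
    have "summable (\<lambda>n. norm (F n * z ^ n))"
    proof (rule summable_comparison_test[OF _ summable_geometric[of "1/2 :: real"]], intro exI allI impI)
      fix n
      have "\<bar>F n\<bar> * \<bar>z\<bar> ^ n \<le> 1 * (1/2) ^ n" using F[of n] z12 by (intro mult_mono power_mono) auto
      then show "norm (norm (F n * z ^ n)) \<le> (1/2) ^ n" by (simp add: abs_mult power_abs)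
    qed simp
    from norm_summable_imp_has_sum[OF this G[OF z12]]
    have outer: "((\<lambda>n. F n * z ^ n) has_sum G (f x y)) UNIV" by (simp add: z_def)
    have rows': "((\<lambda>l. F n * prod_list (map ?t l)) has_sum F n * z ^ n) {l. length l = n}" for n
      by (rule has_sum_cmult_right[OF conjunct1[OF has_sum_lists[OF t has_sum_infsum[OF tabs]]]])
    let ?V = "\<lambda>l. F (length l) * prod_list (map c l) * (x - a) ^ sum_list (map fst l) * (y - b) ^ sum_list (map snd l)"
    have Vn: "?V l = F n * prod_list (map ?t l)" if "length l = n" for l n
      unfolding prod_list_monomials[of c "x - a" fst "y - b" snd l] that by simp
    have rows: "(?V has_sum F n * z ^ n) {l. length l = n}" for n
      using rows'[of n] by (rule has_sum_cong[THEN iffD1, rotated]) (rule Vn[symmetric], simp)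
    have "?V summable_on UNIV"
      by (rule Infinite_Sum.abs_summable_summable[OF mono_sum_abs_summable[OF ms xy]])
    then have "(\<lambda>q. ?V (snd q)) summable_on ?S"
      using summable_on_reindex_bij_betw[OF bij, of ?V] by simp
    then have "((\<lambda>q. ?V (snd q)) has_sum G (f x y)) ?S"
      by (rule has_sum_SigmaI[OF _ outer, rotated]) (unfold snd_conv, rule rows)
    then show "(?V has_sum G (f x y)) UNIV"
      using has_sum_reindex_bij_betw[OF bij, of ?V] by simp
  qed
qed

lemma analytic_at2_exp:
  assumes "analytic_at2 f a b"
  shows "analytic_at2 (\<lambda>x y. exp (f x y)) a b"
proof -
  have "analytic_at2 (\<lambda>x y. exp (f x y - f a b)) a b"
  proof (rule analytic_at2_compose[OF assms, where F = "\<lambda>n. 1 / fact n" and G = "\<lambda>w. exp (w - f a b)"])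
    show "\<bar>1 / fact n :: real\<bar> \<le> 1" for n by simp
    show "(\<lambda>n. 1 / fact n * z ^ n) sums exp (f a b + z - f a b)" for z
      using exp_converges[of z] by (simp add: divide_inverse mult.commute)
  qed
  from analytic_at2_cmult[OF this, of "exp (f a b)"] show ?thesis by (simp add: exp_diff)
qed

lemma ln_series_sums:
  assumes "\<bar>z\<bar> \<le> (1/2 :: real)"
  shows "(\<lambda>n. (case n of 0 \<Rightarrow> 0 | Suc m \<Rightarrow> (-1) ^ m / real (Suc m)) * z ^ n) sums ln (1 + z)"
proof -
  have "norm ((-1) ^ n * (1 / real (n + 1)) * z ^ Suc n) \<le> (1/2) ^ n" for n
  proof -
    have "norm ((-1) ^ n * (1 / real (n + 1)) * z ^ Suc n) = 1 / real (n + 1) * \<bar>z\<bar> ^ Suc n"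
      by (simp add: abs_mult power_abs)
    also have "\<dots> \<le> 1 * (1/2) ^ Suc n"
      using assms by (intro mult_mono power_mono) (simp_all del: power_Suc)
    also have "\<dots> \<le> (1/2 :: real) ^ n" by (simp add: power_decreasing)
    finally show ?thesis .
  qed
  then have "summable (\<lambda>n. (-1) ^ n * (1 / real (n + 1)) * z ^ Suc n)"
    by (intro summable_comparison_test[OF _ summable_geometric[of "1/2 :: real"]]) auto
  then have "(\<lambda>n. (-1) ^ n * (1 / real (n + 1)) * z ^ Suc n) sums (\<Sum>n. (-1) ^ n * (1 / real (n + 1)) * z ^ Suc n)"
    by (rule summable_sums)
  also have "(\<Sum>n. (-1) ^ n * (1 / real (n + 1)) * z ^ Suc n) = ln (1 + z)"
    using ln_series[of "1 + z"] assms by (simp only: abs_le_iff add_diff_cancel_left') linarith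
  finally have L: "(\<lambda>n. (-1) ^ n * (1 / real (n + 1)) * z ^ Suc n) sums ln (1 + z)" .
  define f where "f n = (case n of 0 \<Rightarrow> 0 | Suc m \<Rightarrow> (-1) ^ m / real (Suc m)) * z ^ n" for n
  have "f (Suc n) = (-1) ^ n * (1 / real (n + 1)) * z ^ Suc n" for n by (simp add: f_def)
  with L have "(\<lambda>n. f (Suc n)) sums ln (1 + z)" by simp
  then have "f sums (ln (1 + z) + f 0)" by (simp only: sums_Suc_iff)
  then show ?thesis by (simp add: f_def[abs_def])
qed

lemma analytic_at2_ln:
  assumes f: "analytic_at2 f a b" and pos: "f a b > 0"
  shows "analytic_at2 (\<lambda>x y. ln (f x y)) a b"
proof -
  define g where "g x y = 1 / f a b * f x y" for x y
  have g: "analytic_at2 g a b" unfolding g_def[abs_def] by (rule analytic_at2_cmult[OF f])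
  have g1: "g a b = 1" using pos by (simp add: g_def)
  \<comment> \<open>With \<open>G\<close> in this form the product \<open>g x y * f a b\<close> is
    \<open>f x y\<close> itself, so the result is \<open>ln (f x y)\<close> without any sign
    condition away from \<open>(a, b)\<close>.\<close>
  have "analytic_at2 (\<lambda>x y. ln (g x y * f a b) - ln (f a b)) a b"
  proof (rule analytic_at2_compose[OF g, where F = "\<lambda>n. case n of 0 \<Rightarrow> 0 | Suc m \<Rightarrow> (-1) ^ m / real (Suc m)"
        and G = "\<lambda>w. ln (w * f a b) - ln (f a b)"])
    fix z :: real assume z: "\<bar>z\<bar> \<le> 1/2"
    then have "ln ((g a b + z) * f a b) - ln (f a b) = ln (1 + z)"
      using pos by (simp add: g1 ln_mult)
    then show "(\<lambda>n. (case n of 0 \<Rightarrow> 0 | Suc m \<Rightarrow> (-1) ^ m / real (Suc m)) * z ^ n)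
      sums (ln ((g a b + z) * f a b) - ln (f a b))"
      using ln_series_sums[OF z] by simp
  qed (auto simp: abs_divide power_abs split: nat.split)
  from analytic_at2_add[OF analytic_at2_const[of "ln (f a b)"] this]
  show ?thesis using pos by (simp add: g_def)
qed

text \<open>Where \<open>e ^ 3 - t > 0\<close> the real cube root is an exponential of a logarithm.
  This condition is open, so the two functions agree on a box.\<close>

lemma analytic_at2_amp:
  assumes "(e, t) \<in> amp_domain"
  shows "analytic_at2 amp e t"
proof -
  have c: "analytic_at2 (\<lambda>x y. x ^ 3 - y) e t"
    by (intro analytic_at2_diff analytic_at2_power analytic_at2_fst analytic_at2_snd)
  have pos: "e ^ 3 - t > 0" using assms by (simp add: amp_domain_def amp_def)
  have A: "analytic_at2 (\<lambda>x y. exp (1/3 * ln (x ^ 3 - y))) e t"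
    by (intro analytic_at2_exp analytic_at2_cmult analytic_at2_ln[OF c] pos)
  have "open {p :: real \<times> real. 0 < fst p ^ 3 - snd p}"
    by (intro open_Collect_less continuous_intros)
  then obtain d where d: "d > 0" "\<And>p. dist p (e, t) < d \<Longrightarrow> fst p ^ 3 - snd p > 0"
    unfolding open_dist using pos by force
  show ?thesis
  proof (rule analytic_at2_cong[OF A, of "d / 2"])
    fix x y assume "\<bar>x - e\<bar> < d / 2" "\<bar>y - t\<bar> < d / 2"
    moreover have "dist (x, y) (e, t) \<le> \<bar>x - e\<bar> + \<bar>y - t\<bar>"
      unfolding dist_prod_def dist_real_def fst_conv snd_conv by (rule sqrt_sum_squares_le_sum) auto
    ultimately have "x ^ 3 - y > 0" using d(2)[of "(x, y)"] by simp
    then show "amp x y = exp (1/3 * ln (x ^ 3 - y))"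
      by (simp add: amp_def root_powr_inverse powr_def)
  qed (use d in simp)
qed

lemma analytic_at2_H:
  assumes f: "analytic_at2 f a b" and "0 < f a b" "f a b < 1"
  shows "analytic_at2 (\<lambda>x y. H (f x y)) a b"
proof -
  have g: "analytic_at2 (\<lambda>x y. 1 - f x y) a b" by (intro analytic_at2_diff analytic_at2_const f)
  have "analytic_at2 (\<lambda>x y. -1 * (f x y * ln (f x y) + (1 - f x y) * ln (1 - f x y))) a b"
    by (intro analytic_at2_cmult analytic_at2_add analytic_at2_mult f g analytic_at2_ln[OF f] analytic_at2_ln[OF g])
      (use assms in auto)
  then show ?thesis by (simp add: H_def)
qed

lemma analytic_at2_opt_entropy:
  assumes "(e, t) \<in> amp_domain"
  shows "analytic_at2 opt_entropy e t"
proof -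
  have "analytic_at2 (\<lambda>x y. 1/2 * (H (x - amp x y) + H (x + amp x y))) e t"
    by (intro analytic_at2_cmult analytic_at2_add analytic_at2_H analytic_at2_diff analytic_at2_fst analytic_at2_amp assms)
      (use assms in \<open>auto simp: amp_domain_def\<close>)
  then show ?thesis by (simp add: opt_entropy_def[abs_def])
qed

text \<open>Expanding the product over the edges, only the signs depend on the vertices.\<close>

lemma analytic_subgraph_density:
  assumes "simple_graph k E" "(e, t) \<in> amp_domain"
  shows "analytic_at2 (\<lambda>e t. subgraph_density k E (bipodal_graphon e t)) e t"
proof -
  define I where "I = {(i, j). i < j \<and> {i, j} \<in> E}"
  define M where "M = completion (\<Pi>\<^sub>M i\<in>{1..k}. lebesgue_on unit_interval)"
  have "I \<subseteq> {1..k} \<times> {1..k}"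
    using assms(1) by (auto simp: I_def simple_graph_def)
  then have finI: "finite I" and Ik: "\<And>i j. (i, j) \<in> I \<Longrightarrow> i \<in> {1..k} \<and> j \<in> {1..k}"
    using finite_subset by auto
  define s where "s x y = (if x < 1/2 \<and> y < 1/2 \<or> 1/2 < x \<and> 1/2 < y then -1 else 1 :: real)" for x y :: real
  have bs: "bipodal_graphon e t x y = e + amp e t * s x y" for e t x y
    by (simp add: bipodal_graphon_def s_def amp_def)
  interpret L: prob_space "lebesgue_on unit_interval"
    by (rule prob_spaceI) (simp add: emeasure_restrict_space)
  interpret PL: product_prob_space "\<lambda>_::nat. lebesgue_on unit_interval" "{1..k}" ..
  interpret M: finite_measure M
  proof
    show "emeasure M (space M) \<noteq> \<infinity>"
      unfolding M_def using PL.emeasure_space_1 by (simp add: emeasure_completion)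
  qed
  have sm: "(\<lambda>x. s (x i) (x j)) \<in> borel_measurable M" if "(i, j) \<in> I" for i j
  proof -
    have ij: "i \<in> {1..k}" "j \<in> {1..k}" using Ik[OF that] by auto
    have id: "(\<lambda>x. x) \<in> borel_measurable (lebesgue_on unit_interval)"
      by (intro measurable_restrict_space1 measurable_completion) simp
    have [measurable]: "(\<lambda>x. x i) \<in> borel_measurable (\<Pi>\<^sub>M i\<in>{1..k}. lebesgue_on unit_interval)"
      "(\<lambda>x. x j) \<in> borel_measurable (\<Pi>\<^sub>M i\<in>{1..k}. lebesgue_on unit_interval)"
      using measurable_compose[OF measurable_component_singleton[OF ij(1)] id]
        measurable_compose[OF measurable_component_singleton[OF ij(2)] id] by simp_all
    have "(\<lambda>x. s (x i) (x j)) \<in> borel_measurable (\<Pi>\<^sub>M i\<in>{1..k}. lebesgue_on unit_interval)"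
      unfolding s_def by measurable
    then show ?thesis unfolding M_def by (rule measurable_completion)
  qed
  \<comment> \<open>These integrals of products of signs do not depend on \<open>(e, t)\<close>, so
    the expansion below is a polynomial in \<open>e\<close> and \<open>amp e t\<close>.\<close>
  define J where "J A = (\<integral>x. (\<Prod>(i, j)\<in>A. s (x i) (x j)) \<partial>M)" for A
  have int: "integrable M (\<lambda>x. \<Prod>(i, j)\<in>A. s (x i) (x j))" if "A \<subseteq> I" for A
  proof (rule M.bounded_measurable_integrable[OF bounded_measurableI[of _ _ 1]])
    show "(\<lambda>x. \<Prod>(i, j)\<in>A. s (x i) (x j)) \<in> borel_measurable M"
      using that sm by (intro borel_measurable_prod) auto
    show "\<bar>\<Prod>(i, j)\<in>A. s (x i) (x j)\<bar> \<le> 1" for x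
      unfolding abs_prod by (intro prod_le_1) (auto simp: s_def)
  qed
  have expand: "subgraph_density k E (bipodal_graphon e t)
      = (\<Sum>A\<in>Pow I. amp e t ^ card A * e ^ card (I - A) * J A)" for e t
  proof -
    have "(\<Prod>(i, j)\<in>I. bipodal_graphon e t (x i) (x j))
        = (\<Sum>A\<in>Pow I. amp e t ^ card A * e ^ card (I - A) * (\<Prod>(i, j)\<in>A. s (x i) (x j)))" for x
    proof -
      have "(\<Prod>(i, j)\<in>I. bipodal_graphon e t (x i) (x j)) = (\<Prod>q\<in>I. amp e t * s (x (fst q)) (x (snd q)) + e)"
        by (intro prod.cong) (auto simp: bs)
      also have "\<dots> = (\<Sum>A\<in>Pow I. (\<Prod>q\<in>A. amp e t * s (x (fst q)) (x (snd q))) * (\<Prod>q\<in>I - A. e))"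
        by (rule prod_add[OF finI])
      finally show ?thesis
        by (simp add: prod.distrib split_def mult_ac)
    qed
    then have "subgraph_density k E (bipodal_graphon e t)
      = (\<integral>x. (\<Sum>A\<in>Pow I. amp e t ^ card A * e ^ card (I - A) * (\<Prod>(i, j)\<in>A. s (x i) (x j))) \<partial>M)"
      by (simp add: subgraph_density_def M_def I_def)
    also have "\<dots> = (\<Sum>A\<in>Pow I. amp e t ^ card A * e ^ card (I - A) * J A)"
      using int by (subst Bochner_Integration.integral_sum) (auto simp: J_def)
    finally show ?thesis .
  qed
  show ?thesis
    unfolding expand
    by (intro analytic_at2_sum analytic_at2_mult analytic_at2_power analytic_at2_amp analytic_at2_fst
        analytic_at2_const assms(2)) (use finI in simp)
qed

section \<open>Edges and triangles of finite graphs\<close>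

definition pairs :: "'a set \<Rightarrow> 'a set set" where
  "pairs V = {d. d \<subseteq> V \<and> card d = 2}"

definition triples :: "'a set \<Rightarrow> 'a set set" where
  "triples V = {T. T \<subseteq> V \<and> card T = 3}"

lemma finite_pairs: "finite V \<Longrightarrow> finite (pairs V)"
  unfolding pairs_def by (rule finite_subset[of _ "Pow V"]) auto

lemma finite_triples: "finite V \<Longrightarrow> finite (triples V)"
  unfolding triples_def by (rule finite_subset[of _ "Pow V"]) auto

text \<open>Each pair comes from two ordered pairs. This links sums over edges to matrix sums;
  \<open>sum_triples\<close> does the same with the six orderings of a triple.\<close>

lemma sum_pairs:
  fixes F :: "'a set \<Rightarrow> real"
  assumes V: "finite V"
  shows "(\<Sum>i\<in>V. \<Sum>j\<in>V. if i = j then 0 else F {i, j}) = 2 * (\<Sum>d\<in>pairs V. F d)"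
proof -
  let ?Q = "{q \<in> V \<times> V. fst q \<noteq> snd q}" let ?p = "\<lambda>q. {fst q, snd q}"
  have fin: "finite (V \<times> V)" using V by simp
  have "(\<Sum>i\<in>V. \<Sum>j\<in>V. if i = j then 0 else F {i, j}) = (\<Sum>q\<in>V \<times> V. if fst q \<noteq> snd q then F (?p q) else 0)"
    unfolding sum.cartesian_product by (rule sum.cong) auto
  also have "\<dots> = (\<Sum>q\<in>?Q. F (?p q))" by (rule sum.inter_filter[symmetric, OF fin])
  also have "\<dots> = (\<Sum>d\<in>pairs V. \<Sum>q\<in>{q \<in> ?Q. ?p q = d}. F (?p q))"
  proof (rule sum.group[symmetric])
    show "finite ?Q" using fin by simp
    show "finite (pairs V)" by (rule finite_pairs[OF V])
    show "?p ` ?Q \<subseteq> pairs V" by (auto simp: pairs_def)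
  qed
  also have "\<dots> = (\<Sum>d\<in>pairs V. 2 * F d)"
  proof (rule sum.cong[OF refl])
    fix d assume "d \<in> pairs V"
    then obtain a b where ab: "d = {a, b}" "a \<noteq> b" "a \<in> V" "b \<in> V"
      by (auto simp: pairs_def card_2_iff)
    have Q: "{q \<in> ?Q. ?p q = d} = {(a, b), (b, a)}"
      using ab by (auto simp: doubleton_eq_iff)
    have "(\<Sum>q\<in>{q \<in> ?Q. ?p q = d}. F (?p q)) = (\<Sum>q\<in>{q \<in> ?Q. ?p q = d}. F d)"
      by (rule sum.cong) auto
    also have "\<dots> = 2 * F d"
      unfolding Q using ab(2) by simp
    finally show "(\<Sum>q\<in>{q \<in> ?Q. ?p q = d}. F (?p q)) = 2 * F d" .
  qed
  finally show ?thesis by (simp add: sum_distrib_left)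
qed

lemma sum_triples:
  fixes F :: "'a set \<Rightarrow> real"
  assumes V: "finite V"
  shows "(\<Sum>i\<in>V. \<Sum>j\<in>V. \<Sum>k\<in>V. if i = j \<or> j = k \<or> k = i then 0 else F {i, j, k}) = 6 * (\<Sum>T\<in>triples V. F T)"
proof -
  let ?D = "\<lambda>q. fst q \<noteq> fst (snd q) \<and> fst (snd q) \<noteq> snd (snd q) \<and> snd (snd q) \<noteq> fst q"
  let ?Q = "{q \<in> V \<times> V \<times> V. ?D q}" let ?p = "\<lambda>q. {fst q, fst (snd q), snd (snd q)}"
  have fin: "finite (V \<times> V \<times> V)" using V by simp
  have "(\<Sum>i\<in>V. \<Sum>j\<in>V. \<Sum>k\<in>V. if i = j \<or> j = k \<or> k = i then 0 else F {i, j, k})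
      = (\<Sum>q\<in>V \<times> V \<times> V. if ?D q then F (?p q) else 0)"
    unfolding sum.cartesian_product by (rule sum.cong) auto
  also have "\<dots> = (\<Sum>q\<in>?Q. F (?p q))" by (rule sum.inter_filter[symmetric, OF fin])
  also have "\<dots> = (\<Sum>T\<in>triples V. \<Sum>q\<in>{q \<in> ?Q. ?p q = T}. F (?p q))"
  proof (rule sum.group[symmetric])
    show "finite ?Q" using fin by simp
    show "finite (triples V)" by (rule finite_triples[OF V])
    show "?p ` ?Q \<subseteq> triples V" by (auto simp: triples_def)
  qed
  also have "\<dots> = (\<Sum>T\<in>triples V. 6 * F T)"
  proof (rule sum.cong[OF refl])
    fix T assume "T \<in> triples V"
    then obtain a b c where abc: "T = {a, b, c}" "a \<noteq> b" "b \<noteq> c" "a \<noteq> c" "a \<in> V" "b \<in> V" "c \<in> V"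
      by (auto simp: triples_def card_3_iff)
    have Q: "{q \<in> ?Q. ?p q = T} = {(a, b, c), (a, c, b), (b, a, c), (b, c, a), (c, a, b), (c, b, a)}"
    proof (intro equalityI subsetI)
      fix q assume "q \<in> {q \<in> ?Q. ?p q = T}"
      then obtain x y z where q: "q = (x, y, z)" "x \<noteq> y" "y \<noteq> z" "z \<noteq> x" "{x, y, z} = T"
        by (cases q) auto
      then have "x \<in> {a, b, c}" "y \<in> {a, b, c}" "z \<in> {a, b, c}" using abc(1) by auto
      then show "q \<in> {(a, b, c), (a, c, b), (b, a, c), (b, c, a), (c, a, b), (c, b, a)}"
        using q(1-4) by auto
    next
      fix q assume "q \<in> {(a, b, c), (a, c, b), (b, a, c), (b, c, a), (c, a, b), (c, b, a)}"
      then show "q \<in> {q \<in> ?Q. ?p q = T}" using abc by auto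
    qed
    have "(\<Sum>q\<in>{q \<in> ?Q. ?p q = T}. F (?p q)) = (\<Sum>q\<in>{q \<in> ?Q. ?p q = T}. F T)"
      by (rule sum.cong) auto
    also have "\<dots> = 6 * F T"
      unfolding Q using abc(2-4) by simp
    finally show "(\<Sum>q\<in>{q \<in> ?Q. ?p q = T}. F (?p q)) = 6 * F T" .
  qed
  finally show ?thesis by (simp add: sum_distrib_left)
qed

definition adj :: "'a set set \<Rightarrow> 'a \<Rightarrow> 'a \<Rightarrow> real" where
  "adj E i j = (if {i, j} \<in> E then 1 else 0)"

lemma adj_sym: "adj E i j = adj E j i"
  by (simp add: adj_def insert_commute)

lemma adj_range: "0 \<le> adj E i j" "adj E i j \<le> 1"
  by (simp_all add: adj_def)

lemma adj_diag: "E \<subseteq> pairs V \<Longrightarrow> adj E i i = 0"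
  by (auto simp: adj_def pairs_def)

lemma simple_graph_iff: "simple_graph n E \<longleftrightarrow> E \<subseteq> pairs {1..n}"
  by (auto simp: simple_graph_def pairs_def)

lemma sum_adj:
  assumes V: "finite V" and E: "E \<subseteq> pairs V"
  shows "(\<Sum>i\<in>V. \<Sum>j\<in>V. adj E i j) = 2 * real (card E)"
proof -
  have "(\<Sum>i\<in>V. \<Sum>j\<in>V. adj E i j) = (\<Sum>i\<in>V. \<Sum>j\<in>V. if i = j then 0 else (\<lambda>d. if d \<in> E then 1 else 0) {i, j})"
    using adj_diag[OF E] by (intro sum.cong refl) (auto simp: adj_def)
  also have "\<dots> = 2 * (\<Sum>d\<in>pairs V. if d \<in> E then 1 else 0)" by (rule sum_pairs[OF V])
  also have "(\<Sum>d\<in>pairs V. if d \<in> E then 1 else 0) = real (card E)"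
    using E finite_pairs[OF V] by (simp add: sum.If_cases Int_absorb1 flip: sum.inter_filter)
  finally show ?thesis .
qed

definition edges_of :: "'a set \<Rightarrow> 'a set set" where
  "edges_of T = pairs T"

lemma edges_of_triple:
  assumes "i \<noteq> j" "j \<noteq> k" "k \<noteq> i"
  shows "edges_of {i, j, k} = {{i, j}, {j, k}, {k, i}}"
proof (intro equalityI subsetI)
  fix d assume "d \<in> edges_of {i, j, k}"
  then obtain a b where ab: "d = {a, b}" "a \<noteq> b" "a \<in> {i, j, k}" "b \<in> {i, j, k}"
    unfolding edges_of_def pairs_def card_2_iff by blast
  then show "d \<in> {{i, j}, {j, k}, {k, i}}" by blast
next
  fix d assume "d \<in> {{i, j}, {j, k}, {k, i}}"
  then show "d \<in> edges_of {i, j, k}"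
    using assms unfolding edges_of_def pairs_def by (elim insertE emptyE) simp_all
qed

lemma graph_triangles_eq: "graph_triangles n E = {T \<in> triples {1..n}. edges_of T \<subseteq> E}"
proof -
  have "(\<forall>i\<in>T. \<forall>j\<in>T. i \<noteq> j \<longrightarrow> {i, j} \<in> E) \<longleftrightarrow> edges_of T \<subseteq> E" for T :: "nat set"
  proof
    assume "\<forall>i\<in>T. \<forall>j\<in>T. i \<noteq> j \<longrightarrow> {i, j} \<in> E"
    then show "edges_of T \<subseteq> E" by (auto simp: edges_of_def pairs_def card_2_iff)
  next
    assume E: "edges_of T \<subseteq> E"
    have "{i, j} \<in> edges_of T" if "i \<in> T" "j \<in> T" "i \<noteq> j" for i j
      using that by (simp add: edges_of_def pairs_def)
    with E show "\<forall>i\<in>T. \<forall>j\<in>T. i \<noteq> j \<longrightarrow> {i, j} \<in> E" by blast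
  qed
  then show ?thesis by (auto simp: graph_triangles_def triples_def)
qed

text \<open>Degenerate triples contribute 0 because the adjacency matrix has zero diagonal.\<close>

lemma sum_adj_triangles:
  assumes E: "E \<subseteq> pairs {1..n}"
  shows "(\<Sum>i\<in>{1..n}. \<Sum>j\<in>{1..n}. \<Sum>k\<in>{1..n}. adj E i j * adj E j k * adj E k i)
    = 6 * real (card (graph_triangles n E))"
proof -
  have "adj E i j * adj E j k * adj E k i = (if i = j \<or> j = k \<or> k = i then 0 else
      (\<lambda>T. if edges_of T \<subseteq> E then 1 else 0) {i, j, k})" for i j k
  proof (cases "i = j \<or> j = k \<or> k = i")
    case True
    then show ?thesis using adj_diag[OF E] by auto
  next
    case False
    then show ?thesis using edges_of_triple[of i j k] by (simp add: adj_def)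
  qed
  then have "(\<Sum>i\<in>{1..n}. \<Sum>j\<in>{1..n}. \<Sum>k\<in>{1..n}. adj E i j * adj E j k * adj E k i)
    = 6 * (\<Sum>T\<in>triples {1..n}. if edges_of T \<subseteq> E then 1 else 0)"
    using sum_triples[of "{1..n}" "\<lambda>T. if edges_of T \<subseteq> E then 1 else 0"] by simp
  also have "(\<Sum>T\<in>triples {1..n}. if edges_of T \<subseteq> E then 1 else 0) = real (card (graph_triangles n E))"
    unfolding graph_triangles_eq by (simp add: finite_triples flip: sum.inter_filter)
  finally show ?thesis .
qed

section \<open>Averaging over a colouring\<close>

definition cell :: "'a set \<Rightarrow> ('a \<Rightarrow> nat) \<Rightarrow> nat \<Rightarrow> 'a set" where
  "cell V c p = {k \<in> V. c k = p}"

text \<open>The block density, written as a mean of means so that each of the two averagings is an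
  instance of \<open>sum_cell_mean\<close> and \<open>mean_range\<close>. For an empty cell the
  value is 0.\<close>

definition dens :: "'a set \<Rightarrow> ('a \<Rightarrow> nat) \<Rightarrow> ('a \<Rightarrow> 'a \<Rightarrow> real) \<Rightarrow> nat \<Rightarrow> nat \<Rightarrow> real" where
  "dens V c A p q = (\<Sum>k\<in>cell V c p. (\<Sum>l\<in>cell V c q. A k l) / card (cell V c q)) / card (cell V c p)"

lemma sum_cell: "finite V \<Longrightarrow> sum f (cell V c p) = (\<Sum>k\<in>V. if c k = p then f k else 0)"
  unfolding cell_def by (rule sum.inter_filter)

text \<open>Averaging over cells is a conditional expectation: it does not change the sum against a
  function of the colour.\<close>

lemma sum_cell_mean:
  fixes f :: "'a \<Rightarrow> real"
  assumes V: "finite V"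
  shows "(\<Sum>i\<in>V. (\<Sum>k\<in>cell V c (c i). f k) / card (cell V c (c i)) * G (c i)) = (\<Sum>k\<in>V. f k * G (c k))"
proof -
  have "(\<Sum>i\<in>V. (\<Sum>k\<in>cell V c (c i). f k) / card (cell V c (c i)) * G (c i))
      = (\<Sum>i\<in>V. \<Sum>k\<in>V. if c k = c i then f k / card (cell V c (c k)) * G (c k) else 0)"
    unfolding sum_cell[OF V, of f] sum_divide_distrib sum_distrib_right
    by (intro sum.cong refl) auto
  also have "\<dots> = (\<Sum>k\<in>V. \<Sum>i\<in>V. if c i = c k then f k / card (cell V c (c k)) * G (c k) else 0)"
    by (subst sum.swap) (auto intro!: sum.cong)
  also have "\<dots> = (\<Sum>k\<in>V. f k * G (c k))"
  proof (rule sum.cong[OF refl])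
    fix k assume k: "k \<in> V"
    have "(\<Sum>i\<in>V. if c i = c k then f k / card (cell V c (c k)) * G (c k) else 0)
        = (\<Sum>i\<in>cell V c (c k). f k / card (cell V c (c k)) * G (c k))"
      by (rule sum_cell[OF V, symmetric])
    also have "\<dots> = f k * G (c k)"
    proof -
      have "card (cell V c (c k)) > 0" using k V by (auto simp: cell_def card_gt_0_iff)
      then show ?thesis by simp
    qed
    finally show "(\<Sum>i\<in>V. if c i = c k then f k / card (cell V c (c k)) * G (c k) else 0) = f k * G (c k)" .
  qed
  finally show ?thesis .
qed

lemma sum_dens:
  assumes V: "finite V"
  shows "(\<Sum>i\<in>V. \<Sum>j\<in>V. dens V c A (c i) (c j) * F (c i) (c j)) = (\<Sum>i\<in>V. \<Sum>j\<in>V. A i j * F (c i) (c j))"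
proof -
  have "(\<Sum>i\<in>V. \<Sum>j\<in>V. dens V c A (c i) (c j) * F (c i) (c j))
    = (\<Sum>j\<in>V. \<Sum>i\<in>V. dens V c A (c i) (c j) * F (c i) (c j))" by (rule sum.swap)
  also have "\<dots> = (\<Sum>j\<in>V. \<Sum>k\<in>V. (\<Sum>l\<in>cell V c (c j). A k l) / card (cell V c (c j)) * F (c k) (c j))"
    unfolding dens_def by (intro sum.cong refl sum_cell_mean[OF V])
  also have "\<dots> = (\<Sum>k\<in>V. \<Sum>j\<in>V. (\<Sum>l\<in>cell V c (c j). A k l) / card (cell V c (c j)) * F (c k) (c j))"
    by (rule sum.swap)
  also have "\<dots> = (\<Sum>i\<in>V. \<Sum>j\<in>V. A i j * F (c i) (c j))"
    by (intro sum.cong refl sum_cell_mean[OF V])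
  finally show ?thesis .
qed

lemma mean_range:
  fixes f :: "'a \<Rightarrow> real"
  assumes "\<And>k. k \<in> S \<Longrightarrow> 0 \<le> f k \<and> f k \<le> 1"
  shows "0 \<le> sum f S / card S" "sum f S / card S \<le> 1"
proof -
  show "0 \<le> sum f S / card S" using assms by (simp add: sum_nonneg)
  have "sum f S \<le> (\<Sum>k\<in>S. 1)" using assms by (intro sum_mono) auto
  then show "sum f S / card S \<le> 1" by (cases "card S = 0") (auto simp: divide_le_eq)
qed

lemma dens_range:
  assumes A: "\<And>i j. 0 \<le> A i j \<and> A i j \<le> (1 :: real)"
  shows "0 \<le> dens V c A p q" "dens V c A p q \<le> 1"
proof -
  have r: "0 \<le> sum (A k) (cell V c q) / card (cell V c q) \<and> sum (A k) (cell V c q) / card (cell V c q) \<le> 1" for k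
    by (intro conjI mean_range[of _ "A k"] A)
  show "0 \<le> dens V c A p q" "dens V c A p q \<le> 1"
    unfolding dens_def by (rule mean_range, rule r)+
qed

lemma dens_sym:
  assumes "\<And>i j. A i j = A j i"
  shows "dens V c A p q = dens V c A q p"
proof -
  have "dens V c A p q = (\<Sum>k\<in>cell V c p. \<Sum>l\<in>cell V c q. A k l) / card (cell V c q) / card (cell V c p)" for p q
    by (simp add: dens_def sum_divide_distrib)
  moreover have "(\<Sum>k\<in>cell V c p. \<Sum>l\<in>cell V c q. A k l) = (\<Sum>l\<in>cell V c q. \<Sum>k\<in>cell V c p. A l k)"
    by (subst sum.swap) (simp add: assms)
  ultimately show ?thesis by simp
qed

text \<open>One edge between two cells makes their block density positive. Applied to edges and,
  with \<open>dens_one_minus\<close>, to non-edges, it keeps the arguments of the logarithms in the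
  likelihood positive.\<close>

lemma dens_pos:
  assumes V: "finite V" and A: "\<And>i j. 0 \<le> A i j" and ij: "i \<in> V" "j \<in> V" "0 < A i j"
  shows "0 < dens V c A (c i) (c j)"
proof -
  have fin: "finite (cell V c p)" for p using V by (simp add: cell_def)
  have c: "i \<in> cell V c (c i)" "j \<in> cell V c (c j)" using ij by (auto simp: cell_def)
  have card: "card (cell V c (c i)) > 0" "card (cell V c (c j)) > 0" using c fin by (auto simp: card_gt_0_iff)
  have "0 < (\<Sum>l\<in>cell V c (c j). A i l)"
    using ij(3) c(2) A fin by (intro sum_pos2[of _ j]) auto
  then have "0 < (\<Sum>k\<in>cell V c (c i). (\<Sum>l\<in>cell V c (c j). A k l) / card (cell V c (c j)))"
    using c(1) A fin card by (intro sum_pos2[of _ i]) (auto intro!: divide_nonneg_nonneg sum_nonneg)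
  then show ?thesis using card by (simp add: dens_def)
qed

lemma dens_one_minus:
  assumes V: "finite V" and ij: "i \<in> V" "j \<in> V"
  shows "dens V c (\<lambda>i j. 1 - A i j) (c i) (c j) = 1 - dens V c A (c i) (c j)"
proof -
  have fin: "finite (cell V c p)" for p using V by (simp add: cell_def)
  have c: "i \<in> cell V c (c i)" "j \<in> cell V c (c j)" using ij by (auto simp: cell_def)
  have card: "card (cell V c (c i)) > 0" "card (cell V c (c j)) > 0" using c fin by (auto simp: card_gt_0_iff)
  show ?thesis
    using card by (simp add: dens_def sum_subtractf diff_divide_distrib)
qed

section \<open>Weak regularity\<close>

text \<open>Weak regularity of Frieze and Kannan: the unnormalized cut norm of the matrix minus its
  block averages is at most \<epsilon> times the squared number of vertices.\<close>

definition cut_regular :: "'a set \<Rightarrow> ('a \<Rightarrow> nat) \<Rightarrow> ('a \<Rightarrow> 'a \<Rightarrow> real) \<Rightarrow> real \<Rightarrow> bool" where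
  "cut_regular V c A \<epsilon> \<longleftrightarrow>
     (\<forall>S T. S \<subseteq> V \<longrightarrow> T \<subseteq> V \<longrightarrow> \<bar>\<Sum>i\<in>S. \<Sum>j\<in>T. A i j - dens V c A (c i) (c j)\<bar> \<le> \<epsilon> * (real (card V))\<^sup>2)"

definition energy :: "'a set \<Rightarrow> ('a \<Rightarrow> nat) \<Rightarrow> ('a \<Rightarrow> 'a \<Rightarrow> real) \<Rightarrow> real" where
  "energy V c A = (\<Sum>i\<in>V. \<Sum>j\<in>V. (dens V c A (c i) (c j))\<^sup>2)"

text \<open>Pythagoras for nested conditional expectations: by \<open>sum_dens\<close>, twice, the
  mixed product of the fine and the coarse averages is the coarse energy.\<close>

lemma energy_refine:
  assumes V: "finite V" and ref: "\<And>i. c i = h (c' i)"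
  shows "(\<Sum>i\<in>V. \<Sum>j\<in>V. (dens V c' A (c' i) (c' j) - dens V c A (c i) (c j))\<^sup>2) = energy V c' A - energy V c A"
proof -
  let ?f = "\<lambda>i j. dens V c A (c i) (c j)" let ?g = "\<lambda>i j. dens V c' A (c' i) (c' j)"
  have "(\<Sum>i\<in>V. \<Sum>j\<in>V. ?g i j * ?f i j) = (\<Sum>i\<in>V. \<Sum>j\<in>V. A i j * ?f i j)"
    unfolding ref by (rule sum_dens[OF V, of c' A "\<lambda>p q. dens V (\<lambda>i. h (c' i)) A (h p) (h q)"])
  also have "\<dots> = (\<Sum>i\<in>V. \<Sum>j\<in>V. ?f i j * ?f i j)"
    by (rule sum_dens[OF V, symmetric])
  finally have gf: "(\<Sum>i\<in>V. \<Sum>j\<in>V. ?g i j * ?f i j) = energy V c A"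
    by (simp add: energy_def power2_eq_square)
  have "(?g i j - ?f i j)\<^sup>2 = (?g i j)\<^sup>2 - 2 * (?g i j * ?f i j) + (?f i j)\<^sup>2" for i j
    by (simp add: power2_eq_square algebra_simps)
  then have "(\<Sum>i\<in>V. \<Sum>j\<in>V. (?g i j - ?f i j)\<^sup>2)
      = energy V c' A - 2 * (\<Sum>i\<in>V. \<Sum>j\<in>V. ?g i j * ?f i j) + energy V c A"
    by (simp add: energy_def sum.distrib sum_subtractf sum_distrib_left)
  then show ?thesis using gf by simp
qed

text \<open>The cells are split by a pair \<open>S\<close>, \<open>T\<close> that violates
  regularity. The indicator of \<open>S \<times> T\<close> is then a function of the new colours, so
  the violation equals the sum over \<open>S \<times> T\<close> of the difference of the two
  averages, and Cauchy-Schwarz bounds its square by the gain of energy.\<close>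

lemma energy_increment:
  assumes V: "finite V" "V \<noteq> {}" and nreg: "\<not> cut_regular V c A \<epsilon>" and \<epsilon>: "\<epsilon> > 0" and K: "\<And>i. c i < K"
  obtains c' where "\<And>i. c' i < 4 * K" "energy V c' A \<ge> energy V c A + \<epsilon>\<^sup>2 * (real (card V))\<^sup>2"
proof -
  have "\<exists>S T. S \<subseteq> V \<and> T \<subseteq> V \<and> \<not> \<bar>\<Sum>i\<in>S. \<Sum>j\<in>T. A i j - dens V c A (c i) (c j)\<bar> \<le> \<epsilon> * (real (card V))\<^sup>2"
    using nreg unfolding cut_regular_def by blast
  then obtain S T where ST: "S \<subseteq> V" "T \<subseteq> V"
    "\<not> \<bar>\<Sum>i\<in>S. \<Sum>j\<in>T. A i j - dens V c A (c i) (c j)\<bar> \<le> \<epsilon> * (real (card V))\<^sup>2"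
    by blast
  \<comment> \<open>The two lowest binary digits record membership in \<open>S\<close> and
    \<open>T\<close>; division by 4 recovers the old colour.\<close>
  define c' where "c' i = 4 * c i + (if i \<in> S then 2 else 0) + (if i \<in> T then 1 else 0)" for i
  have "c' i < 4 * K" for i using K[of i] by (auto simp: c'_def)
  have ref: "c i = c' i div 4" for i by (auto simp: c'_def)
  have bits: "(4 * x + 2 + 1) div 2 mod 2 = 1" "(4 * x + 2) div 2 mod 2 = 1" "(4 * x + 1) div 2 mod 2 = 0"
    "(4 * x) div 2 mod 2 = 0" "(4 * x + 2 + 1) mod 2 = 1" "(4 * x + 2) mod 2 = 0" "(4 * x + 1) mod 2 = 1"
    "(4 * x) mod 2 = 0" for x :: nat
    by presburger+
  have c'4: "c' i = (if i \<in> S then if i \<in> T then 4 * c i + 2 + 1 else 4 * c i + 2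
      else if i \<in> T then 4 * c i + 1 else 4 * c i)" for i
    by (simp add: c'_def)
  have inS: "i \<in> S \<longleftrightarrow> c' i div 2 mod 2 = 1" and inT: "i \<in> T \<longleftrightarrow> c' i mod 2 = 1" for i
    by (cases "i \<in> S"; cases "i \<in> T"; simp only: c'4 if_True if_False bits simp_thms zero_neq_one)+
  let ?f = "\<lambda>i j. dens V c A (c i) (c j)" let ?g = "\<lambda>i j. dens V c' A (c' i) (c' j)"
  let ?u = "\<lambda>p q. if p div 2 mod 2 = 1 \<and> q mod 2 = 1 then 1 else (0::real)"
  let ?n = "real (card V)"
  have fin: "finite S" "finite T" using ST V finite_subset by auto
  have ind: "(\<Sum>i\<in>S. \<Sum>j\<in>T. X i j) = (\<Sum>i\<in>V. \<Sum>j\<in>V. X i j * ?u (c' i) (c' j))" for X :: "'a \<Rightarrow> 'a \<Rightarrow> real"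
  proof -
    have "(\<Sum>i\<in>V. \<Sum>j\<in>V. X i j * ?u (c' i) (c' j)) = (\<Sum>i\<in>V. if i \<in> S then (\<Sum>j\<in>V. if j \<in> T then X i j else 0) else 0)"
      unfolding inS[symmetric] inT[symmetric] by (intro sum.cong refl) (auto intro: sum.cong)
    also have "\<dots> = (\<Sum>i\<in>S. \<Sum>j\<in>T. X i j)"
      using V ST by (simp add: sum.If_cases Int_absorb1)
    finally show ?thesis ..
  qed
  have "(\<Sum>i\<in>S. \<Sum>j\<in>T. A i j - ?f i j) = (\<Sum>i\<in>V. \<Sum>j\<in>V. (?g i j - ?f i j) * ?u (c' i) (c' j))"
    unfolding ind left_diff_distrib sum_subtractf sum_dens[OF V(1), of c' A ?u] by simp
  also have "\<dots> = (\<Sum>q\<in>V \<times> V. (?g (fst q) (snd q) - ?f (fst q) (snd q)) * ?u (c' (fst q)) (c' (snd q)))"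
    by (simp add: sum.cartesian_product split_def)
  finally have eq: "(\<Sum>i\<in>S. \<Sum>j\<in>T. A i j - ?f i j)
      = (\<Sum>q\<in>V \<times> V. (?g (fst q) (snd q) - ?f (fst q) (snd q)) * ?u (c' (fst q)) (c' (snd q)))" .
  have "(\<Sum>i\<in>S. \<Sum>j\<in>T. A i j - ?f i j)\<^sup>2
      \<le> (\<Sum>q\<in>V \<times> V. (?g (fst q) (snd q) - ?f (fst q) (snd q))\<^sup>2) * (\<Sum>q\<in>V \<times> V. (?u (c' (fst q)) (c' (snd q)))\<^sup>2)"
    unfolding eq by (rule Cauchy_Schwarz_ineq_sum)
  also have "(\<Sum>q\<in>V \<times> V. (?g (fst q) (snd q) - ?f (fst q) (snd q))\<^sup>2) = energy V c' A - energy V c A"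
    using energy_refine[OF V(1), of c "\<lambda>p. p div 4" c' A] ref by (simp add: sum.cartesian_product split_def)
  also have "(energy V c' A - energy V c A) * (\<Sum>q\<in>V \<times> V. (?u (c' (fst q)) (c' (snd q)))\<^sup>2)
      \<le> (energy V c' A - energy V c A) * ?n\<^sup>2"
  proof (rule mult_left_mono)
    have "(\<Sum>q\<in>V \<times> V. (?u (c' (fst q)) (c' (snd q)))\<^sup>2) \<le> (\<Sum>q\<in>V \<times> V. 1)"
      by (intro sum_mono) auto
    then show "(\<Sum>q\<in>V \<times> V. (?u (c' (fst q)) (c' (snd q)))\<^sup>2) \<le> ?n\<^sup>2"
      by (simp add: card_cartesian_product power2_eq_square)
    have "0 \<le> (\<Sum>i\<in>V. \<Sum>j\<in>V. (?g i j - ?f i j)\<^sup>2)" by (intro sum_nonneg) auto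
    then show "0 \<le> energy V c' A - energy V c A"
      using energy_refine[OF V(1), of c "\<lambda>p. p div 4" c' A] ref by simp
  qed
  finally have up: "(\<Sum>i\<in>S. \<Sum>j\<in>T. A i j - ?f i j)\<^sup>2 \<le> (energy V c' A - energy V c A) * ?n\<^sup>2" .
  have n: "?n > 0" using V by (simp add: card_gt_0_iff)
  have "(\<epsilon> * ?n\<^sup>2)\<^sup>2 \<le> \<bar>\<Sum>i\<in>S. \<Sum>j\<in>T. A i j - ?f i j\<bar>\<^sup>2"
    using ST(3) \<epsilon> by (intro power_mono) auto
  also have "\<dots> \<le> (energy V c' A - energy V c A) * ?n\<^sup>2" using up by (simp only: power2_abs)
  also have "(\<epsilon> * ?n\<^sup>2)\<^sup>2 = (\<epsilon>\<^sup>2 * ?n\<^sup>2) * ?n\<^sup>2" by (simp add: power2_eq_square)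
  finally have "\<epsilon>\<^sup>2 * ?n\<^sup>2 \<le> energy V c' A - energy V c A"
    by (rule mult_right_le_imp_le) (use n in simp)
  then show thesis using that[of c'] \<open>\<And>i. c' i < 4 * K\<close> by simp
qed

text \<open>The energy never exceeds the squared number of vertices, while each irregular step adds
  the fraction \<open>\<epsilon>\<^sup>2\<close> of it; so \<open>m\<close> irregular steps are
  impossible. Each step multiplies the number of colours by 4, and the bound does not involve
  \<open>V\<close>.\<close>

lemma weak_regularity:
  assumes V: "finite V" "V \<noteq> {}" and A: "\<And>i j. 0 \<le> A i j \<and> A i j \<le> (1 :: real)" and \<epsilon>: "\<epsilon> > 0"
    and m: "real m * \<epsilon>\<^sup>2 > 1"
  shows "\<exists>c. (\<forall>i. c i < 4 ^ m) \<and> cut_regular V c A \<epsilon>"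
proof -
  let ?n = "real (card V)"
  have n: "?n > 0" using V by (simp add: card_gt_0_iff)
  have "\<exists>c. (\<forall>i. c i < 4 ^ m) \<and> (cut_regular V c A \<epsilon> \<or> energy V c A \<ge> real m * \<epsilon>\<^sup>2 * ?n\<^sup>2)" for m :: nat
  proof (induction m)
    case 0
    have "energy V (\<lambda>_. 0) A \<ge> 0" unfolding energy_def by (intro sum_nonneg) auto
    then show ?case by (intro exI[of _ "\<lambda>_. 0"]) simp
  next
    case (Suc m)
    then obtain c where c: "\<And>i. c i < 4 ^ m" "cut_regular V c A \<epsilon> \<or> energy V c A \<ge> real m * \<epsilon>\<^sup>2 * ?n\<^sup>2" by blast
    show ?case
    proof (cases "cut_regular V c A \<epsilon>")
      case True
      have "c i < 4 ^ Suc m" for i using c(1)[of i] by simp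
      then show ?thesis using True by blast
    next
      case False
      obtain c' where c': "\<And>i. c' i < 4 * 4 ^ m" "energy V c' A \<ge> energy V c A + \<epsilon>\<^sup>2 * ?n\<^sup>2"
        by (rule energy_increment[OF V False \<epsilon> c(1)]) blast
      have "energy V c' A \<ge> real (Suc m) * \<epsilon>\<^sup>2 * ?n\<^sup>2"
        using c'(2) c(2) False by (simp add: algebra_simps)
      then show ?thesis using c'(1) by auto
    qed
  qed
  then obtain c where c: "\<And>i. c i < 4 ^ m" "cut_regular V c A \<epsilon> \<or> energy V c A \<ge> real m * \<epsilon>\<^sup>2 * ?n\<^sup>2" by blast
  have "energy V c A \<le> (\<Sum>i\<in>V. \<Sum>j\<in>V. 1)"
    unfolding energy_def
  proof (intro sum_mono)
    fix i j
    show "(dens V c A (c i) (c j))\<^sup>2 \<le> 1"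
      using dens_range[of A V c "c i" "c j", OF A] by (simp add: abs_square_le_1)
  qed
  also have "\<dots> = ?n\<^sup>2" by (simp add: power2_eq_square)
  also have "\<dots> < real m * \<epsilon>\<^sup>2 * ?n\<^sup>2" using m n by simp
  finally have "\<not> energy V c A \<ge> real m * \<epsilon>\<^sup>2 * ?n\<^sup>2" by simp
  then show ?thesis using c by (intro exI[of _ c]) simp
qed

text \<open>A bilinear form on weights in \<open>[0,1]\<close> is largest at weights 0 and 1:
  \<open>f\<close> is replaced by the indicator of the rows with positive weighted sum, and then
  \<open>g\<close> by that of the positive columns. The lower bound follows for
  \<open>- D\<close>.\<close>

lemma cut_bound_weights:
  fixes D :: "'a \<Rightarrow> 'a \<Rightarrow> real"
  assumes V: "finite V" and D: "\<And>S T. S \<subseteq> V \<Longrightarrow> T \<subseteq> V \<Longrightarrow> \<bar>\<Sum>i\<in>S. \<Sum>j\<in>T. D i j\<bar> \<le> B"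
    and f: "\<And>i. 0 \<le> f i \<and> f i \<le> (1 :: real)" and g: "\<And>i. 0 \<le> g i \<and> g i \<le> (1 :: real)"
  shows "\<bar>\<Sum>i\<in>V. \<Sum>j\<in>V. D i j * f i * g j\<bar> \<le> B"
proof -
  have pick: "(\<Sum>i\<in>V. x i * w i) \<le> (\<Sum>i\<in>{i \<in> V. x i > 0}. x i)" if w: "\<And>i. 0 \<le> w i \<and> w i \<le> 1" for x w :: "'a \<Rightarrow> real"
  proof -
    have "(\<Sum>i\<in>V. x i * w i) \<le> (\<Sum>i\<in>V. if x i > 0 then x i else 0)"
    proof (rule sum_mono)
      fix i
      show "x i * w i \<le> (if x i > 0 then x i else 0)"
        using w[of i] by (auto simp: mult_left_le mult_nonpos_nonneg)
    qed
    then show ?thesis using V by (simp add: sum.inter_filter)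
  qed
  have half: "(\<Sum>i\<in>V. \<Sum>j\<in>V. D i j * f i * g j) \<le> B"
    if D: "\<And>S T. S \<subseteq> V \<Longrightarrow> T \<subseteq> V \<Longrightarrow> (\<Sum>i\<in>S. \<Sum>j\<in>T. D i j) \<le> B" for D :: "'a \<Rightarrow> 'a \<Rightarrow> real"
  proof -
    define S where "S = {i \<in> V. (\<Sum>j\<in>V. D i j * g j) > 0}"
    have "(\<Sum>i\<in>V. \<Sum>j\<in>V. D i j * f i * g j) = (\<Sum>i\<in>V. (\<Sum>j\<in>V. D i j * g j) * f i)"
      unfolding sum_distrib_right by (simp only: mult_ac)
    also have "\<dots> \<le> (\<Sum>i\<in>S. \<Sum>j\<in>V. D i j * g j)" unfolding S_def by (rule pick[OF f])
    also have "\<dots> = (\<Sum>j\<in>V. (\<Sum>i\<in>S. D i j) * g j)"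
      by (subst sum.swap) (simp add: sum_distrib_right)
    also have "\<dots> \<le> (\<Sum>j\<in>{j \<in> V. (\<Sum>i\<in>S. D i j) > 0}. \<Sum>i\<in>S. D i j)" by (rule pick[OF g])
    also have "\<dots> = (\<Sum>i\<in>S. \<Sum>j\<in>{j \<in> V. (\<Sum>i\<in>S. D i j) > 0}. D i j)" by (rule sum.swap)
    also have "\<dots> \<le> B" by (rule D) (auto simp: S_def)
    finally show ?thesis .
  qed
  have "(\<Sum>i\<in>V. \<Sum>j\<in>V. D i j * f i * g j) \<le> B"
  proof (rule half)
    show "(\<Sum>i\<in>S. \<Sum>j\<in>T. D i j) \<le> B" if "S \<subseteq> V" "T \<subseteq> V" for S T using D[OF that] by linarith
  qed
  moreover have "(\<Sum>i\<in>V. \<Sum>j\<in>V. (- D i j) * f i * g j) \<le> B"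
  proof (rule half)
    show "(\<Sum>i\<in>S. \<Sum>j\<in>T. - D i j) \<le> B" if "S \<subseteq> V" "T \<subseteq> V" for S T
      using D[OF that] unfolding sum_negf by linarith
  qed
  ultimately show ?thesis by (simp add: abs_le_iff sum_negf)
qed

text \<open>The three factors are exchanged one at a time. With the vertex opposite to the exchanged
  edge fixed, the two other factors are weights on the ends of that edge.\<close>

lemma triangle_counting:
  fixes A W :: "'a \<Rightarrow> 'a \<Rightarrow> real"
  assumes V: "finite V" and D: "\<And>S T. S \<subseteq> V \<Longrightarrow> T \<subseteq> V \<Longrightarrow> \<bar>\<Sum>i\<in>S. \<Sum>j\<in>T. A i j - W i j\<bar> \<le> B"
    and A: "\<And>i j. 0 \<le> A i j \<and> A i j \<le> 1" and W: "\<And>i j. 0 \<le> W i j \<and> W i j \<le> 1"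
  shows "\<bar>(\<Sum>i\<in>V. \<Sum>j\<in>V. \<Sum>k\<in>V. A i j * A j k * A k i) - (\<Sum>i\<in>V. \<Sum>j\<in>V. \<Sum>k\<in>V. W i j * W j k * W k i)\<bar>
    \<le> 3 * real (card V) * B"
proof -
  let ?D = "\<lambda>i j. A i j - W i j"
  have outer: "\<bar>\<Sum>z\<in>V. X z\<bar> \<le> real (card V) * B" if "\<And>z. \<bar>X z\<bar> \<le> B" for X :: "'a \<Rightarrow> real"
  proof -
    have "\<bar>\<Sum>z\<in>V. X z\<bar> \<le> (\<Sum>z\<in>V. \<bar>X z\<bar>)" by (rule sum_abs)
    also have "\<dots> \<le> (\<Sum>z\<in>V. B)" by (intro sum_mono that)
    finally show ?thesis by simp
  qed
  have cw: "\<bar>\<Sum>i\<in>V. \<Sum>j\<in>V. ?D i j * f i * g j\<bar> \<le> B"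
    if "\<And>i. 0 \<le> f i \<and> f i \<le> 1" "\<And>i. 0 \<le> g i \<and> g i \<le> 1" for f g :: "'a \<Rightarrow> real"
    by (rule cut_bound_weights[OF V _ that]) (rule D)
  have 1: "\<bar>\<Sum>i\<in>V. \<Sum>j\<in>V. \<Sum>k\<in>V. ?D i j * A j k * A k i\<bar> \<le> real (card V) * B"
  proof -
    have "(\<Sum>i\<in>V. \<Sum>j\<in>V. \<Sum>k\<in>V. ?D i j * A j k * A k i) = (\<Sum>k\<in>V. \<Sum>i\<in>V. \<Sum>j\<in>V. ?D i j * A k i * A j k)"
    proof -
      have "(\<Sum>i\<in>V. \<Sum>j\<in>V. \<Sum>k\<in>V. ?D i j * A j k * A k i) = (\<Sum>i\<in>V. \<Sum>k\<in>V. \<Sum>j\<in>V. ?D i j * A j k * A k i)"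
        by (intro sum.cong refl sum.swap)
      also have "\<dots> = (\<Sum>k\<in>V. \<Sum>i\<in>V. \<Sum>j\<in>V. ?D i j * A j k * A k i)" by (rule sum.swap)
      finally show ?thesis by (simp only: mult_ac)
    qed
    moreover have "\<bar>\<Sum>k\<in>V. \<Sum>i\<in>V. \<Sum>j\<in>V. ?D i j * A k i * A j k\<bar> \<le> real (card V) * B"
      by (intro outer cw A)
    ultimately show ?thesis by simp
  qed
  have 2: "\<bar>\<Sum>i\<in>V. \<Sum>j\<in>V. \<Sum>k\<in>V. ?D j k * W i j * A k i\<bar> \<le> real (card V) * B"
    by (intro outer cw W A)
  have 3: "\<bar>\<Sum>i\<in>V. \<Sum>j\<in>V. \<Sum>k\<in>V. ?D k i * W j k * W i j\<bar> \<le> real (card V) * B"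
  proof -
    have "(\<Sum>i\<in>V. \<Sum>j\<in>V. \<Sum>k\<in>V. ?D k i * W j k * W i j) = (\<Sum>j\<in>V. \<Sum>i\<in>V. \<Sum>k\<in>V. ?D k i * W j k * W i j)"
      by (rule sum.swap)
    also have "\<dots> = (\<Sum>j\<in>V. \<Sum>k\<in>V. \<Sum>i\<in>V. ?D k i * W j k * W i j)"
      by (intro sum.cong refl sum.swap)
    moreover have "\<bar>\<Sum>j\<in>V. \<Sum>k\<in>V. \<Sum>i\<in>V. ?D k i * W j k * W i j\<bar> \<le> real (card V) * B"
      by (intro outer cw W)
    ultimately show ?thesis by simp
  qed
  have "A i j * A j k * A k i = W i j * W j k * W k i + ?D i j * A j k * A k i + ?D j k * W i j * A k i + ?D k i * W j k * W i j" for i j k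
    by (simp add: algebra_simps)
  then have "(\<Sum>i\<in>V. \<Sum>j\<in>V. \<Sum>k\<in>V. A i j * A j k * A k i) - (\<Sum>i\<in>V. \<Sum>j\<in>V. \<Sum>k\<in>V. W i j * W j k * W k i)
     = (\<Sum>i\<in>V. \<Sum>j\<in>V. \<Sum>k\<in>V. ?D i j * A j k * A k i) + (\<Sum>i\<in>V. \<Sum>j\<in>V. \<Sum>k\<in>V. ?D j k * W i j * A k i)
       + (\<Sum>i\<in>V. \<Sum>j\<in>V. \<Sum>k\<in>V. ?D k i * W j k * W i j)"
    by (simp only: sum.distrib)
  then show ?thesis using 1 2 3 by linarith
qed

section \<open>Entropy of matrices and random graphs\<close>

text \<open>\<open>kernel_entropy\<close> on the uniform probability space on \<open>V\<close>. The
  diagonal may be nonzero, as it is for block densities.\<close>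

lemma matrix_entropy:
  fixes W :: "nat \<Rightarrow> nat \<Rightarrow> real"
  assumes V: "finite V" "V \<noteq> {}" and sym: "\<And>i j. W i j = W j i" and r: "\<And>i j. 0 \<le> W i j" "\<And>i j. W i j \<le> 1"
    and e: "(\<Sum>i\<in>V. \<Sum>j\<in>V. W i j) = e * (real (card V))\<^sup>2"
    and t: "(\<Sum>i\<in>V. \<Sum>j\<in>V. \<Sum>k\<in>V. W i j * W j k * W k i) = t * real (card V) ^ 3"
    and reg: "(e, t) \<in> region"
  shows "(\<Sum>i\<in>V. \<Sum>j\<in>V. H (W i j)) \<le> opt_entropy e t * (real (card V))\<^sup>2"
proof -
  define M where "M = uniform_count_measure V"
  have ps: "prob_space M" unfolding M_def by (rule prob_space_uniform_count_measure[OF V])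
  let ?n = "real (card V)"
  have n: "?n > 0" using V by (simp add: card_gt_0_iff)
  have setsM: "sets M = sets (count_space V)"
    unfolding M_def by (rule sets_uniform_count_measure_count_space)
  have meas: "f \<in> borel_measurable (M \<Otimes>\<^sub>M M)" for f :: "nat \<times> nat \<Rightarrow> real"
  proof -
    have "f \<in> borel_measurable (count_space V \<Otimes>\<^sub>M count_space V)"
      using V by (intro measurable_pair_measure_countable1) (auto intro: countable_finite)
    also have "borel_measurable (count_space V \<Otimes>\<^sub>M count_space V) = borel_measurable (M \<Otimes>\<^sub>M M)"
      by (intro measurable_cong_sets sets_pair_measure_cong refl) (simp_all add: setsM)
    finally show ?thesis .
  qed
  interpret kernel M W
    unfolding kernel_def kernel_axioms_def using ps meas sym r by (auto simp: abs_le_iff intro: order_trans[OF _ r(1)])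
  have IM: "(\<integral>x. f x \<partial>M) = (\<Sum>x\<in>V. f x) / ?n" for f :: "nat \<Rightarrow> real"
    unfolding M_def using V by (simp add: integral_uniform_count_measure)
  have IP: "(\<integral>p. f (fst p) (snd p) \<partial>P) = (\<Sum>i\<in>V. \<Sum>j\<in>V. f i j) / ?n\<^sup>2" if "\<And>i j. \<bar>f i j\<bar> \<le> 1" for f :: "nat \<Rightarrow> nat \<Rightarrow> real"
  proof -
    have "bounded_measurable P (\<lambda>p. f (fst p) (snd p))" by (rule bounded_measurableI[OF meas that])
    from integral_P_iterated(1)[OF this] show ?thesis
      by (simp add: IM power2_eq_square sum_divide_distrib)
  qed
  have Wabs: "\<bar>W i j\<bar> \<le> 1" for i j by (rule kernel_le_1)
  have e': "(\<integral>p. W (fst p) (snd p) \<partial>P) = e" using IP[of W, OF Wabs] e n by simp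
  have t': "(\<integral>p. W (fst p) (snd p) * (\<integral>z. W (snd p) z * W z (fst p) \<partial>M) \<partial>P) = t"
  proof -
    have inner: "\<bar>W i j * (\<integral>z. W j z * W z i \<partial>M)\<bar> \<le> 1" for i j
    proof -
      have "\<bar>\<integral>z. W j z * W z i \<partial>M\<bar> \<le> 1"
      proof (rule abs_integral_le)
        show "\<bar>W j z * W z i\<bar> \<le> 1" for z using Wabs[of j z] Wabs[of z i] by (simp add: abs_mult mult_le_one)
        show "(\<lambda>z. W j z * W z i) \<in> borel_measurable M"
          by (simp add: measurable_cong_sets[OF setsM refl])
      qed
      then show ?thesis using Wabs[of i j] by (simp add: abs_mult mult_le_one)
    qed
    have "(\<integral>p. W (fst p) (snd p) * (\<integral>z. W (snd p) z * W z (fst p) \<partial>M) \<partial>P)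
        = (\<Sum>i\<in>V. \<Sum>j\<in>V. W i j * (\<integral>z. W j z * W z i \<partial>M)) / ?n\<^sup>2"
      by (rule IP[OF inner])
    also have "\<dots> = (\<Sum>i\<in>V. \<Sum>j\<in>V. \<Sum>k\<in>V. W i j * W j k * W k i) / ?n ^ 3"
      by (simp add: IM sum_distrib_left sum_divide_distrib power2_eq_square power3_eq_cube mult.assoc)
    finally show ?thesis using t n by simp
  qed
  have "(\<integral>p. H (W (fst p) (snd p)) \<partial>P) \<le> opt_entropy e t"
    by (rule kernel_entropy(1)[OF ps meas sym r e' t' reg])
  moreover have "(\<integral>p. H (W (fst p) (snd p)) \<partial>P) = (\<Sum>i\<in>V. \<Sum>j\<in>V. H (W i j)) / ?n\<^sup>2"
    by (rule IP) (simp add: abs_le_iff H_le_1[OF r] order_trans[OF _ H_nonneg[OF r]])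
  ultimately show ?thesis using n by (simp add: divide_le_eq)
qed

text \<open>The probability of the edge set \<open>E\<close> when the elements \<open>d\<close> of
  \<open>D\<close> are chosen independently with probability \<open>p d\<close>.\<close>

definition graph_weight :: "'a set \<Rightarrow> ('a \<Rightarrow> real) \<Rightarrow> 'a set \<Rightarrow> real" where
  "graph_weight D p E = (\<Prod>d\<in>E. p d) * (\<Prod>d\<in>D - E. 1 - p d)"

lemma sum_graph_weight:
  assumes "finite D"
  shows "(\<Sum>E\<in>Pow D. graph_weight D p E) = 1"
  using prod_add[OF assms, of p "\<lambda>d. 1 - p d"] by (simp add: graph_weight_def)

lemma graph_weight_nonneg:
  assumes "E \<subseteq> D" "\<And>d. d \<in> D \<Longrightarrow> 0 \<le> p d \<and> p d \<le> 1"
  shows "0 \<le> graph_weight D p E"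
  unfolding graph_weight_def using assms by (intro mult_nonneg_nonneg prod_nonneg ballI) auto

lemma graph_weight_exp:
  assumes D: "finite D" "E \<subseteq> D" and p: "\<And>d. d \<in> E \<Longrightarrow> 0 < p d" "\<And>d. d \<in> D - E \<Longrightarrow> p d < 1"
  shows "graph_weight D p E = exp (\<Sum>d\<in>D. if d \<in> E then ln (p d) else ln (1 - p d))"
proof -
  have "(\<Sum>d\<in>D. if d \<in> E then ln (p d) else ln (1 - p d)) = (\<Sum>d\<in>E. ln (p d)) + (\<Sum>d\<in>D - E. ln (1 - p d))"
    using D by (simp add: sum.If_cases Int_absorb1 Diff_eq)
  moreover have "exp (\<Sum>d\<in>E. ln (p d)) = (\<Prod>d\<in>E. p d)"
    using p(1) finite_subset[OF D(2,1)] by (simp add: exp_sum)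
  moreover have "exp (\<Sum>d\<in>D - E. ln (1 - p d)) = (\<Prod>d\<in>D - E. 1 - p d)"
  proof -
    have "exp (ln (1 - p d)) = 1 - p d" if "d \<in> D - E" for d using p(2)[OF that] by simp
    then show ?thesis using D(1) by (simp add: exp_sum)
  qed
  ultimately show ?thesis by (simp add: graph_weight_def exp_add)
qed

text \<open>The graphs with prescribed block densities have the same weight \<open>exp (- S/2)\<close> under the
  product measure with these densities, up to the diagonal terms, which only help.\<close>

lemma card_fibre_le:
  fixes c :: "nat \<Rightarrow> nat"
  assumes V: "finite V" and \<E>: "\<E> \<subseteq> Pow (pairs V)"
    and w: "\<And>E i j. E \<in> \<E> \<Longrightarrow> i \<in> V \<Longrightarrow> j \<in> V \<Longrightarrow> dens V c (adj E) (c i) (c j) = w (c i) (c j)"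
  shows "real (card \<E>) \<le> exp (1/2 * (\<Sum>i\<in>V. \<Sum>j\<in>V. H (w (c i) (c j))))"
proof (cases "\<E> = {}")
  case False
  then obtain E0 where E0: "E0 \<in> \<E>" by blast
  \<comment> \<open>\<open>Min\<close> and \<open>Max\<close> pick an ordering of the unordered
    pair; by the symmetry of \<open>w\<close> the choice does not matter.\<close>
  define p where "p d = w (c (Min d)) (c (Max d))" for d
  define S where "S = (\<Sum>i\<in>V. \<Sum>j\<in>V. H (w (c i) (c j)))"
  let ?D = "pairs V"
  have finD: "finite ?D" by (rule finite_pairs[OF V])
  have wsym: "w (c i) (c j) = w (c j) (c i)" if "i \<in> V" "j \<in> V" for i j
    using w[OF E0 that] w[OF E0 that(2,1)] dens_sym[of "adj E0" V c, OF adj_sym] by metis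
  have pij: "p {i, j} = w (c i) (c j)" if "i \<in> V" "j \<in> V" for i j
  proof (cases "i \<le> j")
    case True
    then show ?thesis by (simp add: p_def)
  next
    case False
    then show ?thesis using wsym[OF that] by (simp add: p_def)
  qed
  have wr: "0 \<le> w (c i) (c j) \<and> w (c i) (c j) \<le> 1" if "i \<in> V" "j \<in> V" for i j
    using dens_range[of "adj E0" V c "c i" "c j"] adj_range[of E0] w[OF E0 that] by auto
  have pr: "0 \<le> p d \<and> p d \<le> 1" if d: "d \<in> ?D" for d
  proof -
    obtain i j where "d = {i, j}" "i \<in> V" "j \<in> V" using d by (auto simp: pairs_def card_2_iff)
    then show ?thesis using wr pij by simp
  qed
  have main: "exp (- 1/2 * S) \<le> graph_weight ?D p E" if E: "E \<in> \<E>" for E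
  proof -
    have ED: "E \<subseteq> ?D" using \<E> E by blast
    have posA: "0 < w (c i) (c j)" if "i \<in> V" "j \<in> V" "{i, j} \<in> E" for i j
      using dens_pos[OF V, of "adj E" i j c] adj_range(1)[of E] that w[OF E that(1,2)] by (simp add: adj_def)
    have posB: "w (c i) (c j) < 1" if "i \<in> V" "j \<in> V" "{i, j} \<notin> E" for i j
      using dens_pos[OF V, of "\<lambda>i j. 1 - adj E i j" i j c] adj_range(2)[of E] that w[OF E that(1,2)]
        dens_one_minus[OF V that(1,2), of c "adj E"] by (simp add: adj_def)
    have "graph_weight ?D p E = exp (\<Sum>d\<in>?D. if d \<in> E then ln (p d) else ln (1 - p d))"
    proof (rule graph_weight_exp[OF finD ED])
      fix d assume "d \<in> E"
      then obtain i j where "d = {i, j}" "i \<in> V" "j \<in> V" using ED by (auto simp: pairs_def card_2_iff)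
      then show "0 < p d" using posA pij \<open>d \<in> E\<close> by simp
    next
      fix d assume d: "d \<in> ?D - E"
      then obtain i j where "d = {i, j}" "i \<in> V" "j \<in> V" by (auto simp: pairs_def card_2_iff)
      then show "p d < 1" using posB pij d by simp
    qed
    moreover have "- 1/2 * S \<le> (\<Sum>d\<in>?D. if d \<in> E then ln (p d) else ln (1 - p d))"
    proof -
      let ?L = "\<lambda>d. if d \<in> E then ln (p d) else ln (1 - p d)"
      \<comment> \<open>Off the diagonal the sum of \<open>?l\<close> is twice the log-likelihood.
        Since the logarithms depend on the colours only, \<open>sum_dens\<close> replaces
        \<open>adj E\<close> by block densities and the full sum is exactly \<open>- S\<close>.
        Diagonal terms are \<open>ln (1 - w)\<close>, at most 0, so dropping them can only increase
        the sum.\<close>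
      let ?l = "\<lambda>i j. adj E i j * ln (w (c i) (c j)) + (1 - adj E i j) * ln (1 - w (c i) (c j))"
      let ?f = "\<lambda>i j. w (c i) (c j)"
      have "(\<Sum>i\<in>V. \<Sum>j\<in>V. ?l i j)
        = (\<Sum>i\<in>V. \<Sum>j\<in>V. adj E i j * ln (?f i j)) + (\<Sum>i\<in>V. \<Sum>j\<in>V. ln (1 - ?f i j))
          - (\<Sum>i\<in>V. \<Sum>j\<in>V. adj E i j * ln (1 - ?f i j))"
        by (simp add: left_diff_distrib sum.distrib sum_subtractf)
      also have "(\<Sum>i\<in>V. \<Sum>j\<in>V. adj E i j * ln (?f i j)) = (\<Sum>i\<in>V. \<Sum>j\<in>V. ?f i j * ln (?f i j))"
        unfolding sum_dens[OF V, of c "adj E" "\<lambda>p q. ln (w p q)", symmetric]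
        by (intro sum.cong refl) (simp add: w[OF E])
      also have "(\<Sum>i\<in>V. \<Sum>j\<in>V. adj E i j * ln (1 - ?f i j)) = (\<Sum>i\<in>V. \<Sum>j\<in>V. ?f i j * ln (1 - ?f i j))"
        unfolding sum_dens[OF V, of c "adj E" "\<lambda>p q. ln (1 - w p q)", symmetric]
        by (intro sum.cong refl) (simp add: w[OF E])
      also have "(\<Sum>i\<in>V. \<Sum>j\<in>V. ?f i j * ln (?f i j)) + (\<Sum>i\<in>V. \<Sum>j\<in>V. ln (1 - ?f i j))
          - (\<Sum>i\<in>V. \<Sum>j\<in>V. ?f i j * ln (1 - ?f i j)) = - S"
        by (simp add: S_def H_def left_diff_distrib sum.distrib sum_subtractf sum_negf)
      finally have l: "(\<Sum>i\<in>V. \<Sum>j\<in>V. ?l i j) = - S" .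
      have "(\<Sum>i\<in>V. \<Sum>j\<in>V. ?l i j) \<le> (\<Sum>i\<in>V. \<Sum>j\<in>V. if i = j then 0 else ?L {i, j})"
      proof (intro sum_mono)
        fix i j assume ij: "i \<in> V" "j \<in> V"
        show "?l i j \<le> (if i = j then 0 else ?L {i, j})"
        proof (cases "i = j")
          case True
          have "adj E i i = 0" by (rule adj_diag[OF ED])
          moreover have "{i, i} \<notin> E" using ED by (auto simp: pairs_def)
          then have "ln (1 - ?f i i) \<le> 0" using posB[OF ij(1) ij(1)] wr[OF ij(1) ij(1)] by simp
          ultimately show ?thesis using True by simp
        next
          case False
          then show ?thesis using pij[OF ij] by (simp add: adj_def)
        qed
      qed
      also have "\<dots> = 2 * (\<Sum>d\<in>?D. ?L d)" by (rule sum_pairs[OF V])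
      finally show ?thesis unfolding l by simp
    qed
    ultimately show ?thesis by simp
  qed
  have "real (card \<E>) * exp (- 1/2 * S) = (\<Sum>E\<in>\<E>. exp (- 1/2 * S))" by simp
  also have "\<dots> \<le> (\<Sum>E\<in>\<E>. graph_weight ?D p E)" by (rule sum_mono) (rule main)
  also have "\<dots> \<le> (\<Sum>E\<in>Pow ?D. graph_weight ?D p E)"
    using \<E> finD pr by (intro sum_mono2) (auto intro: graph_weight_nonneg)
  also have "\<dots> = 1" by (rule sum_graph_weight[OF finD])
  finally have "real (card \<E>) * exp (- 1/2 * S) * exp (1/2 * S) \<le> 1 * exp (1/2 * S)"
    by (rule mult_right_mono) simp
  then show ?thesis unfolding S_def[symmetric] by (simp add: mult.assoc flip: exp_add)
qed simp

lemma card_le_fibres: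
  assumes A: "finite A" and B: "finite B" and f: "\<And>a. a \<in> A \<Longrightarrow> f a \<in> B"
    and m: "\<And>b. b \<in> B \<Longrightarrow> real (card {a \<in> A. f a = b}) \<le> m"
  shows "real (card A) \<le> real (card B) * m"
proof -
  have "card A = (\<Sum>b\<in>B. card {a \<in> A. f a = b})"
    using sum.group[OF A B, of f "\<lambda>_. 1::nat"] f by (simp add: image_subset_iff)
  then have "real (card A) = (\<Sum>b\<in>B. real (card {a \<in> A. f a = b}))" by simp
  also have "\<dots> \<le> (\<Sum>b\<in>B. m)" by (intro sum_mono m)
  finally show ?thesis by simp
qed

text \<open>There are at most \<open>K ^ n\<close> colourings, and at most \<open>n ^ 2 + 1\<close>
  values for each of the \<open>K * K\<close> block counts. Their logarithm is of order
  \<open>n\<close>, negligible against \<open>n ^ 2\<close>.\<close>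

lemma code_count_small:
  fixes K :: nat
  assumes K: "K > 0" and \<eta>: "\<eta> > 0"
  shows "\<forall>\<^sub>F n in sequentially. real K ^ n * (real n ^ 2 + 1) ^ (K * K) \<le> exp (\<eta> * (real n)\<^sup>2)"
proof -
  have "(\<lambda>n. real n / (real n)\<^sup>2) \<longlonglongrightarrow> 0" "(\<lambda>n. ln (real n ^ 2 + 1) / (real n)\<^sup>2) \<longlonglongrightarrow> 0"
    by real_asymp+
  then have "(\<lambda>n. ln K * (real n / (real n)\<^sup>2) + real (K * K) * (ln (real n ^ 2 + 1) / (real n)\<^sup>2))
      \<longlonglongrightarrow> ln K * 0 + real (K * K) * 0"
    by (intro tendsto_intros)
  then have "\<forall>\<^sub>F n in sequentially. ln K * (real n / (real n)\<^sup>2) + real (K * K) * (ln (real n ^ 2 + 1) / (real n)\<^sup>2) < \<eta>"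
    using \<eta> by (intro order_tendstoD(2)) auto
  then show ?thesis using eventually_gt_at_top[of "0::nat"]
  proof eventually_elim
    case (elim n)
    have n: "(real n)\<^sup>2 > 0" using elim(2) by simp
    have "(ln K * real n + real (K * K) * ln (real n ^ 2 + 1)) / (real n)\<^sup>2 < \<eta>"
      using elim(1) by (simp add: add_divide_distrib)
    then have le: "ln K * real n + real (K * K) * ln (real n ^ 2 + 1) \<le> \<eta> * (real n)\<^sup>2"
      using n by (simp add: divide_less_eq)
    have pos: "real n ^ 2 + 1 > 0" using zero_le_power2[of "real n"] by linarith
    have "real K ^ n * (real n ^ 2 + 1) ^ (K * K) = exp (ln K * real n) * exp (real (K * K) * ln (real n ^ 2 + 1))"
      using K pos by (simp only: exp_of_nat_mult exp_of_nat2_mult mult.commute[of "ln K"]) simp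
    also have "\<dots> \<le> exp (\<eta> * (real n)\<^sup>2)" using le by (simp flip: exp_add)
    finally show ?case .
  qed
qed

section \<open>Upper bound for the number of graphs\<close>

definition count_set :: "nat \<Rightarrow> real \<Rightarrow> real \<Rightarrow> real \<Rightarrow> nat set set set" where
  "count_set n \<delta> e t = {E. simple_graph n E \<and> \<bar>graph_edge_density n E - e\<bar> < \<delta> \<and> \<bar>graph_triangle_density n E - t\<bar> < \<delta>}"

lemma graph_count_eq: "graph_count n \<delta> e t = card (count_set n \<delta> e t)"
  unfolding graph_count_def count_set_def by (rule arg_cong[where f = card]) (auto simp: abs_less_iff)

lemma count_set_subset: "count_set n \<delta> e t \<subseteq> Pow (pairs {1..n})"
  by (auto simp: count_set_def simple_graph_iff)

lemma finite_count_set: "finite (count_set n \<delta> e t)"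
  by (rule finite_subset[OF count_set_subset]) (simp add: finite_pairs)

lemma card_pairs: "card (pairs {1..n::nat}) = n choose 2"
  unfolding pairs_def using n_subsets[of "{1..n}" 2] by simp

lemma card_triples: "card (triples {1..n::nat}) = n choose 3"
  unfolding triples_def using n_subsets[of "{1..n}" 3] by simp

lemma real_choose_two: "real (n choose 2) = real n * (real n - 1) / 2"
  by (induction n) (auto simp: numeral_2_eq_2 field_simps)

lemma real_choose_three: "real (n choose 3) = real n * (real n - 1) * (real n - 2) / 6"
proof (induction n)
  case (Suc n)
  have "real (Suc n choose 3) = real (n choose 2) + real (n choose 3)" by (simp add: numeral_3_eq_3 numeral_2_eq_2)
  then show ?case unfolding real_choose_two Suc by (simp add: field_simps)
qed simp

lemma divide_mult_cancel: "0 < b \<Longrightarrow> a = a / b * (b :: real)"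
  by simp

text \<open>Matrix sums are normalized by \<open>n ^ 2\<close> and graph densities by
  \<open>n * (n - 1)\<close>. For triangles the analogous change of normalization costs
  \<open>3 / n\<close>.\<close>

lemma edge_density_matrix:
  assumes n: "n \<ge> 2" and E: "E \<subseteq> pairs {1..n}"
  shows "\<bar>2 * real (card E) / (real n)\<^sup>2 - graph_edge_density n E\<bar> \<le> 1 / real n"
proof -
  define x where "x = graph_edge_density n E"
  have n': "real n \<ge> 2" using n by simp
  have ch: "real (n choose 2) > 0" using n by (simp only: of_nat_0_less_iff zero_less_binomial)
  have "card E \<le> n choose 2"
    using card_mono[OF finite_pairs[OF finite_atLeastAtMost] E] unfolding card_pairs .
  then have x: "0 \<le> x" "x \<le> 1" using ch by (auto simp: x_def graph_edge_density_def divide_le_eq)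
  have "real (card E) = x * real (n choose 2)"
    using ch unfolding x_def graph_edge_density_def by (rule divide_mult_cancel)
  then have ce: "real (card E) = x * (real n * (real n - 1) / 2)" unfolding real_choose_two .
  have "2 * real (card E) / (real n)\<^sup>2 - x = - (x / real n)"
    unfolding ce using n' by (simp add: field_simps power2_eq_square)
  then have "\<bar>2 * real (card E) / (real n)\<^sup>2 - x\<bar> = x / real n" using x by (simp only: abs_minus_cancel) simp
  also have "\<dots> \<le> 1 / real n" using x by (intro divide_right_mono) auto
  finally show ?thesis by (simp add: x_def)
qed

lemma triangle_density_matrix:
  assumes n: "n \<ge> 3" and E: "E \<subseteq> pairs {1..n}"
  shows "\<bar>6 * real (card (graph_triangles n E)) / real n ^ 3 - graph_triangle_density n E\<bar> \<le> 3 / real n"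
proof -
  define x where "x = graph_triangle_density n E"
  have n': "real n \<ge> 3" using n by simp
  have ch: "real (n choose 3) > 0" using n by (simp only: of_nat_0_less_iff zero_less_binomial)
  have sub: "graph_triangles n E \<subseteq> triples {1..n}" unfolding graph_triangles_eq by (rule Collect_restrict)
  have "card (graph_triangles n E) \<le> n choose 3"
    using card_mono[OF finite_triples[OF finite_atLeastAtMost] sub] unfolding card_triples .
  then have x: "0 \<le> x" "x \<le> 1" using ch by (auto simp: x_def graph_triangle_density_def divide_le_eq)
  have "real (card (graph_triangles n E)) = x * real (n choose 3)"
    using ch unfolding x_def graph_triangle_density_def by (rule divide_mult_cancel)
  then have ce: "real (card (graph_triangles n E)) = x * (real n * (real n - 1) * (real n - 2) / 6)"
    unfolding real_choose_three .
  have "6 * real (card (graph_triangles n E)) / real n ^ 3 - x = - (x * (3 - 2 / real n) / real n)"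
    unfolding ce using n' by (simp add: field_simps power2_eq_square power3_eq_cube)
  moreover have "0 \<le> x * (3 - 2 / real n)" using x n' by (intro mult_nonneg_nonneg) (auto simp: field_simps)
  ultimately have "\<bar>6 * real (card (graph_triangles n E)) / real n ^ 3 - x\<bar> = x * (3 - 2 / real n) / real n"
    using n' by simp
  also have "\<dots> \<le> 3 / real n"
  proof (intro divide_right_mono)
    have "x * (3 - 2 / real n) \<le> 1 * (3 - 2 / real n)" using x n' by (intro mult_right_mono) (auto simp: field_simps)
    also have "\<dots> \<le> 3" using n' by simp
    finally show "x * (3 - 2 / real n) \<le> 3" .
  qed simp
  finally show ?thesis by (simp add: x_def)
qed

text \<open>A graph is coded by a regular colouring and its block edge counts. Graphs with the same
  code share their block densities; these have edge and triangle density in the larger box, so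
  \<open>matrix_entropy\<close> and \<open>card_fibre_le\<close> bound each class, and the number of
  codes is negligible.\<close>

lemma graph_count_upper:
  assumes box: "\<And>e' t'. \<bar>e' - e\<bar> \<le> \<delta>' \<Longrightarrow> \<bar>t' - t\<bar> \<le> \<delta>' \<Longrightarrow> (e', t') \<in> region \<and> opt_entropy e' t' \<le> m"
    and \<delta>: "0 < \<delta>" "\<delta> < \<delta>'" and \<eta>: "\<eta> > 0"
  shows "\<forall>\<^sub>F n in sequentially. real (graph_count n \<delta> e t) \<le> exp ((m / 2 + \<eta>) * (real n)\<^sup>2)"
proof -
  \<comment> \<open>Triangle counting costs \<open>3 * \<epsilon>\<close> and the change of
    normalization \<open>3 / n < 3 * \<epsilon>\<close>; together this is the gap between the two
    boxes.\<close>
  define \<epsilon> where "\<epsilon> = (\<delta>' - \<delta>) / 6"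
  have \<epsilon>: "\<epsilon> > 0" using \<delta> by (simp add: \<epsilon>_def)
  have "0 < \<epsilon>\<^sup>2" using \<epsilon> by simp
  from reals_Archimedean3[OF this] obtain r :: nat where r: "real r * \<epsilon>\<^sup>2 > 1" by blast
  define K :: nat where "K = 4 ^ r"
  have K: "K > 0" by (simp add: K_def)
  have "(\<lambda>n. 3 / real n) \<longlonglongrightarrow> 0" by real_asymp
  then have "\<forall>\<^sub>F n in sequentially. 3 / real n < 3 * \<epsilon>" using \<epsilon> by (intro order_tendstoD(2)) auto
  then show ?thesis using code_count_small[OF K \<eta>] eventually_ge_at_top[of "3::nat"]
  proof eventually_elim
    case (elim n)
    have n3: "n \<ge> 3" by fact
    let ?V = "{1..n}"
    have V: "finite ?V" "?V \<noteq> {}" "card ?V = n" using n3 by auto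
    have n0: "real n > 0" using n3 by simp
    have "\<exists>c. (\<forall>i. c i < K) \<and> cut_regular ?V c (adj E) \<epsilon>" for E :: "nat set set"
    proof -
      have "0 \<le> adj E i j \<and> adj E i j \<le> 1" for i j using adj_range[of E i j] by simp
      from weak_regularity[OF V(1,2) this \<epsilon> r] show ?thesis unfolding K_def .
    qed
    then have "\<forall>E. \<exists>c. (\<forall>i. c i < K) \<and> cut_regular ?V c (adj E) \<epsilon>" by blast
    from choice[OF this] obtain col where col': "\<forall>E. (\<forall>i. col E i < K) \<and> cut_regular ?V (col E) (adj E) \<epsilon>" by blast
    then have col: "\<And>E i. col E i < K" "\<And>E. cut_regular ?V (col E) (adj E) \<epsilon>" by blast+
    \<comment> \<open>\<open>restrict\<close> fixes the values outside the vertex set, so that the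
      codes lie in a finite function space.\<close>
    define c where "c E = restrict (col E) ?V" for E :: "nat set set"
    define N where "N E = (\<lambda>q\<in>{..<K} \<times> {..<K}. card {(i, j). i \<in> ?V \<and> j \<in> ?V \<and> c E i = fst q \<and> c E j = snd q \<and> {i, j} \<in> E})"
      for E :: "nat set set"
    have cV: "c E i = col E i" if "i \<in> ?V" for E i using that by (simp add: c_def)
    have cellc: "cell ?V (c E) p = cell ?V (col E) p" for E p by (auto simp: cell_def cV)
    have densc: "dens ?V (c E) A p q = dens ?V (col E) A p q" for E A p q unfolding dens_def cellc ..
    have cN: "(c E, N E) \<in> (?V \<rightarrow>\<^sub>E {..<K}) \<times> (({..<K} \<times> {..<K}) \<rightarrow>\<^sub>E {..n ^ 2})" for E
    proof -
      have "card {(i, j). i \<in> ?V \<and> j \<in> ?V \<and> c E i = fst q \<and> c E j = snd q \<and> {i, j} \<in> E} \<le> card (?V \<times> ?V)" for q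
        by (rule card_mono) auto
      then have "N E \<in> ({..<K} \<times> {..<K}) \<rightarrow>\<^sub>E {..n ^ 2}"
        unfolding N_def by (intro restrict_PiE_iff[THEN iffD2] ballI) (simp add: power2_eq_square)
      moreover have "c E \<in> ?V \<rightarrow>\<^sub>E {..<K}"
        unfolding c_def by (intro restrict_PiE_iff[THEN iffD2] ballI) (simp add: col(1))
      ultimately show ?thesis by simp
    qed
    have blocks: "(\<Sum>k\<in>cell ?V (c E) p. \<Sum>l\<in>cell ?V (c E) q. adj E k l) = real (N E (p, q))" if "p < K" "q < K" for E p q
    proof -
      have fin: "finite (cell ?V (c E) p')" for p' by (simp add: cell_def)
      have "(\<Sum>k\<in>cell ?V (c E) p. \<Sum>l\<in>cell ?V (c E) q. adj E k l)
          = (\<Sum>x\<in>cell ?V (c E) p \<times> cell ?V (c E) q. if {fst x, snd x} \<in> E then 1 else 0)"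
        by (simp add: sum.cartesian_product split_def adj_def)
      also have "\<dots> = real (card {x \<in> cell ?V (c E) p \<times> cell ?V (c E) q. {fst x, snd x} \<in> E})"
        using fin by (simp flip: sum.inter_filter)
      also have "{x \<in> cell ?V (c E) p \<times> cell ?V (c E) q. {fst x, snd x} \<in> E}
          = {(i, j). i \<in> ?V \<and> j \<in> ?V \<and> c E i = p \<and> c E j = q \<and> {i, j} \<in> E}"
        by (auto simp: cell_def)
      finally show ?thesis using that by (simp add: N_def)
    qed
    let ?A = "count_set n \<delta> e t"
    let ?B = "(?V \<rightarrow>\<^sub>E {..<K}) \<times> (({..<K} \<times> {..<K}) \<rightarrow>\<^sub>E {..n ^ 2})"
    have fibre: "real (card {E \<in> ?A. (c E, N E) = b}) \<le> exp (m / 2 * (real n)\<^sup>2)" for b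
    proof (cases "{E \<in> ?A. (c E, N E) = b} = {}")
      case False
      then obtain E0 where E0: "E0 \<in> ?A" "(c E0, N E0) = b" by blast
      define c0 where "c0 = c E0"
      define w where "w = dens ?V c0 (adj E0)"
      define W where "W i j = w (c0 i) (c0 j)" for i j
      have dens_block: "dens ?V c' A p q = (\<Sum>k\<in>cell ?V c' p. \<Sum>l\<in>cell ?V c' q. A k l) / card (cell ?V c' q) / card (cell ?V c' p)"
        for c' A p q by (simp add: dens_def sum_divide_distrib)
      have "real (card {E \<in> ?A. (c E, N E) = b}) \<le> exp (1/2 * (\<Sum>i\<in>?V. \<Sum>j\<in>?V. H (w (c0 i) (c0 j))))"
      proof (rule card_fibre_le[OF V(1)])
        show "{E \<in> ?A. (c E, N E) = b} \<subseteq> Pow (pairs ?V)" using count_set_subset by blast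
        fix E i j assume E: "E \<in> {E \<in> ?A. (c E, N E) = b}" and ij: "i \<in> ?V" "j \<in> ?V"
        have eq: "c E = c0" "N E = N E0" using E E0(2) by (auto simp: c0_def)
        have K: "c0 i < K" "c0 j < K" using col(1) ij by (auto simp: c0_def cV)
        show "dens ?V c0 (adj E) (c0 i) (c0 j) = w (c0 i) (c0 j)"
          unfolding w_def dens_block using blocks[OF K, of E] blocks[OF K, of E0] eq by (simp add: c0_def)
      qed
      also have "\<dots> \<le> exp (m / 2 * (real n)\<^sup>2)"
      proof -
        have E0D: "E0 \<subseteq> pairs ?V" using E0(1) count_set_subset by blast
        have Ar: "0 \<le> adj E0 i j \<and> adj E0 i j \<le> 1" for i j using adj_range[of E0 i j] by simp
        have Wr: "0 \<le> W i j" "W i j \<le> 1" for i j unfolding W_def w_def using dens_range[of "adj E0", OF Ar] by auto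
        have Wsym: "W i j = W j i" for i j unfolding W_def w_def by (rule dens_sym[OF adj_sym])
        define e' where "e' = 2 * real (card E0) / (real n)\<^sup>2"
        define t' where "t' = (\<Sum>i\<in>?V. \<Sum>j\<in>?V. \<Sum>k\<in>?V. W i j * W j k * W k i) / real n ^ 3"
        \<comment> \<open>Averaging preserves the sum of the entries, so the edge density of the
          matrix is exact; regularity is used for the triangle density only.\<close>
        have We: "(\<Sum>i\<in>?V. \<Sum>j\<in>?V. W i j) = e' * (real (card ?V))\<^sup>2"
          using sum_dens[OF V(1), of c0 "adj E0" "\<lambda>_ _. 1"] sum_adj[OF V(1) E0D] n0
          by (simp add: W_def w_def e'_def)
        have Wt: "(\<Sum>i\<in>?V. \<Sum>j\<in>?V. \<Sum>k\<in>?V. W i j * W j k * W k i) = t' * real (card ?V) ^ 3"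
          using n0 by (simp add: t'_def)
        have cut: "\<bar>\<Sum>i\<in>S. \<Sum>j\<in>T. adj E0 i j - W i j\<bar> \<le> \<epsilon> * (real n)\<^sup>2" if "S \<subseteq> ?V" "T \<subseteq> ?V" for S T
        proof -
          have "(\<Sum>i\<in>S. \<Sum>j\<in>T. adj E0 i j - W i j) = (\<Sum>i\<in>S. \<Sum>j\<in>T. adj E0 i j - dens ?V (col E0) (adj E0) (col E0 i) (col E0 j))"
          proof (intro sum.cong refl)
            fix i j assume "i \<in> S" "j \<in> T"
            then have "i \<in> ?V" "j \<in> ?V" using that by blast+
            then show "adj E0 i j - W i j = adj E0 i j - dens ?V (col E0) (adj E0) (col E0 i) (col E0 j)"
              unfolding W_def w_def c0_def densc by (simp only: cV)
          qed
          then show ?thesis using col(2)[of E0] that unfolding cut_regular_def by simp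
        qed
        have "\<bar>6 * real (card (graph_triangles n E0)) - (\<Sum>i\<in>?V. \<Sum>j\<in>?V. \<Sum>k\<in>?V. W i j * W j k * W k i)\<bar>
            \<le> 3 * real n * (\<epsilon> * (real n)\<^sup>2)"
          using triangle_counting[OF V(1) cut Ar conjI[OF Wr]] sum_adj_triangles[OF E0D] by simp
        then have "\<bar>6 * real (card (graph_triangles n E0)) - t' * real n ^ 3\<bar> \<le> (3 * \<epsilon>) * real n ^ 3"
          using n0 by (simp add: t'_def power2_eq_square power3_eq_cube mult_ac)
        then have "\<bar>(6 * real (card (graph_triangles n E0)) / real n ^ 3 - t') * real n ^ 3\<bar> \<le> (3 * \<epsilon>) * real n ^ 3"
          using n0 by (simp add: left_diff_distrib)
        then have "\<bar>6 * real (card (graph_triangles n E0)) / real n ^ 3 - t'\<bar> * real n ^ 3 \<le> (3 * \<epsilon>) * real n ^ 3"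
          by (simp add: abs_mult)
        then have tt: "\<bar>6 * real (card (graph_triangles n E0)) / real n ^ 3 - t'\<bar> \<le> 3 * \<epsilon>"
          using n0 by (simp only: mult_le_cancel_right) simp
        have dens: "\<bar>graph_edge_density n E0 - e\<bar> < \<delta>" "\<bar>graph_triangle_density n E0 - t\<bar> < \<delta>"
          using E0(1) by (auto simp: count_set_def)
        have ee: "\<bar>e' - graph_edge_density n E0\<bar> \<le> 1 / real n"
          unfolding e'_def using edge_density_matrix[OF _ E0D] n3 by simp
        have td: "\<bar>6 * real (card (graph_triangles n E0)) / real n ^ 3 - graph_triangle_density n E0\<bar> \<le> 3 / real n"
          by (rule triangle_density_matrix[OF n3 E0D])
        have small: "3 / real n < 3 * \<epsilon>" "6 * \<epsilon> = \<delta>' - \<delta>" using elim(1) by (auto simp: \<epsilon>_def)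
        have "1 / real n \<le> 3 / real n" using n0 by (intro divide_right_mono) auto
        then have "\<bar>e' - e\<bar> \<le> \<delta>'" using ee dens(1) small \<epsilon> by linarith
        moreover have "\<bar>t' - t\<bar> \<le> \<delta>'" using tt td dens(2) small by linarith
        ultimately have b: "(e', t') \<in> region" "opt_entropy e' t' \<le> m" using box by auto
        have "(\<Sum>i\<in>?V. \<Sum>j\<in>?V. H (W i j)) \<le> opt_entropy e' t' * (real (card ?V))\<^sup>2"
          by (rule matrix_entropy[OF V(1,2) Wsym Wr We Wt b(1)])
        also have "\<dots> \<le> m * (real n)\<^sup>2" using b(2) by (simp add: mult_right_mono)
        finally show ?thesis by (simp add: W_def)
      qed
      finally show ?thesis .
    next
      case True
      show ?thesis unfolding True by simp
    qed
    have "real (card ?A) \<le> real (card ?B) * exp (m / 2 * (real n)\<^sup>2)"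
      by (rule card_le_fibres[OF finite_count_set _ cN fibre]) (intro finite_cartesian_product finite_PiE; simp)
    also have "real (card ?B) = real K ^ n * (real n ^ 2 + 1) ^ (K * K)"
      by (simp add: card_cartesian_product card_funcsetE add.commute)
    also have "real K ^ n * (real n ^ 2 + 1) ^ (K * K) * exp (m / 2 * (real n)\<^sup>2)
        \<le> exp (\<eta> * (real n)\<^sup>2) * exp (m / 2 * (real n)\<^sup>2)"
      using elim(2) by (intro mult_right_mono) auto
    also have "\<dots> = exp ((m / 2 + \<eta>) * (real n)\<^sup>2)" by (simp add: algebra_simps flip: exp_add)
    finally show ?case by (simp add: graph_count_eq)
  qed
qed

section \<open>Expectation and variance for independent edges\<close>

definition gexp :: "'a set \<Rightarrow> ('a \<Rightarrow> real) \<Rightarrow> ('a set \<Rightarrow> real) \<Rightarrow> real" where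
  "gexp D p f = (\<Sum>E\<in>Pow D. graph_weight D p E * f E)"

lemma gexp_superset:
  assumes D: "finite D" and B: "B \<subseteq> D"
  shows "gexp D p (\<lambda>E. of_bool (B \<subseteq> E)) = (\<Prod>d\<in>B. p d)"
proof -
  \<comment> \<open>Giving weight 0 to the absence of an element of \<open>B\<close> kills exactly
    the sets that miss part of \<open>B\<close>; the remaining sum factorizes by
    \<open>prod_add\<close>.\<close>
  let ?q = "\<lambda>d. if d \<in> B then 0 else 1 - p d"
  have "graph_weight D p E * of_bool (B \<subseteq> E) = (\<Prod>d\<in>E. p d) * (\<Prod>d\<in>D - E. ?q d)" if E: "E \<in> Pow D" for E
  proof (cases "B \<subseteq> E")
    case True
    then have "(\<Prod>d\<in>D - E. ?q d) = (\<Prod>d\<in>D - E. 1 - p d)" by (intro prod.cong) auto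
    then show ?thesis using True by (simp add: graph_weight_def)
  next
    case False
    then obtain d where "d \<in> B" "d \<notin> E" by blast
    then have "(\<Prod>d\<in>D - E. ?q d) = 0" using B D by (intro prod_zero) auto
    then show ?thesis using False by simp
  qed
  then have "gexp D p (\<lambda>E. of_bool (B \<subseteq> E)) = (\<Sum>E\<in>Pow D. (\<Prod>d\<in>E. p d) * (\<Prod>d\<in>D - E. ?q d))"
    unfolding gexp_def by (rule sum.cong[OF refl])
  also have "\<dots> = (\<Prod>d\<in>D. p d + ?q d)" by (rule prod_add[OF D, symmetric])
  also have "\<dots> = (\<Prod>d\<in>D. if d \<in> B then p d else 1)" by (intro prod.cong) auto
  also have "\<dots> = (\<Prod>d\<in>B. p d)" using D B by (simp add: prod.If_cases Int_absorb1)
  finally show ?thesis .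
qed

lemma gexp_sum: "gexp D p (\<lambda>E. \<Sum>i\<in>I. f i E) = (\<Sum>i\<in>I. gexp D p (f i))"
  unfolding gexp_def sum_distrib_left by (rule sum.swap)

lemma gexp_cmult: "gexp D p (\<lambda>E. c * f E) = c * gexp D p f"
  by (simp add: gexp_def sum_distrib_left mult.left_commute)

text \<open>Inclusion events of disjoint sets are independent and have covariance 0; any other pair
  contributes at most \<open>C\<^sup>2\<close>. The same lemma serves the edge count, the triangle
  count and the log-likelihood.\<close>

lemma gexp_variance:
  fixes B :: "'i \<Rightarrow> 'a set" and w :: "'i \<Rightarrow> real"
  assumes D: "finite D" and p: "\<And>d. d \<in> D \<Longrightarrow> 0 \<le> p d \<and> p d \<le> 1" and I: "finite I"
    and B: "\<And>i. i \<in> I \<Longrightarrow> B i \<subseteq> D" and w: "\<And>i. i \<in> I \<Longrightarrow> \<bar>w i\<bar> \<le> C"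
  shows "gexp D p (\<lambda>E. ((\<Sum>i\<in>I. w i * of_bool (B i \<subseteq> E)) - (\<Sum>i\<in>I. w i * (\<Prod>d\<in>B i. p d)))\<^sup>2)
    \<le> C\<^sup>2 * real (card {q \<in> I \<times> I. B (fst q) \<inter> B (snd q) \<noteq> {}})"
proof -
  let ?P = "\<lambda>i. \<Prod>d\<in>B i. p d" let ?\<mu> = "\<Sum>i\<in>I. w i * ?P i"
  let ?X = "\<lambda>E. \<Sum>i\<in>I. w i * of_bool (B i \<subseteq> E)"
  have finB: "finite (B i)" if "i \<in> I" for i using B[OF that] D finite_subset by blast
  have one: "gexp D p (\<lambda>_. c) = c" for c
    unfolding gexp_def sum_distrib_right[symmetric] sum_graph_weight[OF D] by simp
  have X1: "gexp D p ?X = ?\<mu>"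
    unfolding gexp_sum gexp_cmult by (intro sum.cong refl) (simp add: gexp_superset[OF D B])
  have sq: "(?X E - ?\<mu>)\<^sup>2 = (\<Sum>i\<in>I. \<Sum>j\<in>I. (w i * w j) * of_bool (B i \<union> B j \<subseteq> E)) - 2 * ?\<mu> * ?X E + ?\<mu>\<^sup>2" for E
  proof -
    have "(?X E)\<^sup>2 = (\<Sum>i\<in>I. \<Sum>j\<in>I. (w i * w j) * of_bool (B i \<union> B j \<subseteq> E))"
      unfolding power2_eq_square sum_product by (intro sum.cong refl) auto
    moreover have "(?X E - ?\<mu>)\<^sup>2 = (?X E)\<^sup>2 - 2 * ?\<mu> * ?X E + ?\<mu>\<^sup>2"
      by (simp add: power2_diff mult_ac)
    ultimately show ?thesis by simp
  qed
  have lin: "gexp D p (\<lambda>E. f E - c * g E + c') = gexp D p f - c * gexp D p g + c'" for f g c c'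
  proof -
    have "gexp D p (\<lambda>E. f E - c * g E + c') = gexp D p f - c * gexp D p g + gexp D p (\<lambda>_. c')"
      by (simp add: gexp_def algebra_simps sum.distrib sum_subtractf sum_distrib_left)
    then show ?thesis by (simp add: one)
  qed
  have "gexp D p (\<lambda>E. (?X E - ?\<mu>)\<^sup>2)
      = (\<Sum>i\<in>I. \<Sum>j\<in>I. (w i * w j) * (\<Prod>d\<in>B i \<union> B j. p d)) - 2 * ?\<mu> * ?\<mu> + ?\<mu>\<^sup>2"
  proof -
    have "gexp D p (\<lambda>E. \<Sum>i\<in>I. \<Sum>j\<in>I. (w i * w j) * of_bool (B i \<union> B j \<subseteq> E))
        = (\<Sum>i\<in>I. \<Sum>j\<in>I. (w i * w j) * (\<Prod>d\<in>B i \<union> B j. p d))"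
      unfolding gexp_sum gexp_cmult
      by (intro sum.cong refl arg_cong2[where f = "(*)"] gexp_superset[OF D] Un_least B)
    then show ?thesis unfolding sq lin X1 by simp
  qed
  also have "\<dots> = (\<Sum>i\<in>I. \<Sum>j\<in>I. (w i * w j) * ((\<Prod>d\<in>B i \<union> B j. p d) - ?P i * ?P j))"
  proof -
    have "?\<mu>\<^sup>2 = (\<Sum>i\<in>I. \<Sum>j\<in>I. (w i * w j) * (?P i * ?P j))"
      unfolding power2_eq_square sum_product by (intro sum.cong refl) (simp add: mult_ac)
    then show ?thesis by (simp add: right_diff_distrib sum_subtractf power2_eq_square)
  qed
  also have "\<dots> \<le> (\<Sum>i\<in>I. \<Sum>j\<in>I. if B i \<inter> B j \<noteq> {} then C\<^sup>2 else 0)"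
  proof (intro sum_mono)
    fix i j assume ij: "i \<in> I" "j \<in> I"
    show "(w i * w j) * ((\<Prod>d\<in>B i \<union> B j. p d) - ?P i * ?P j) \<le> (if B i \<inter> B j \<noteq> {} then C\<^sup>2 else 0)"
    proof (cases "B i \<inter> B j = {}")
      case True
      then show ?thesis using finB[OF ij(1)] finB[OF ij(2)] by (simp add: prod.union_disjoint)
    next
      case False
      have r: "0 \<le> (\<Prod>d\<in>A. p d) \<and> (\<Prod>d\<in>A. p d) \<le> 1" if "A \<subseteq> D" for A
        using that p by (intro conjI prod_nonneg prod_le_1) auto
      have "0 \<le> ?P i * ?P j" "?P i * ?P j \<le> 1"
        using r[OF B[OF ij(1)]] r[OF B[OF ij(2)]] by (auto simp: mult_le_one)
      moreover have "0 \<le> (\<Prod>d\<in>B i \<union> B j. p d)" "(\<Prod>d\<in>B i \<union> B j. p d) \<le> 1"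
        using r[OF Un_least[OF B[OF ij(1)] B[OF ij(2)]]] by auto
      ultimately have d1: "\<bar>(\<Prod>d\<in>B i \<union> B j. p d) - ?P i * ?P j\<bar> \<le> 1" by linarith
      have ww: "\<bar>w i\<bar> * \<bar>w j\<bar> \<le> C * C" using w[OF ij(1)] w[OF ij(2)] by (intro mult_mono) auto
      have "(\<bar>w i\<bar> * \<bar>w j\<bar>) * \<bar>(\<Prod>d\<in>B i \<union> B j. p d) - ?P i * ?P j\<bar> \<le> (C * C) * 1"
        by (rule mult_mono[OF ww d1]) simp_all
      then have "\<bar>(w i * w j) * ((\<Prod>d\<in>B i \<union> B j. p d) - ?P i * ?P j)\<bar> \<le> C\<^sup>2"
        by (simp add: abs_mult power2_eq_square)
      then show ?thesis using False by (simp add: abs_le_iff)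
    qed
  qed
  also have "\<dots> = (\<Sum>q\<in>I \<times> I. if B (fst q) \<inter> B (snd q) \<noteq> {} then C\<^sup>2 else 0)"
    by (simp add: sum.cartesian_product split_def)
  also have "\<dots> = C\<^sup>2 * real (card {q \<in> I \<times> I. B (fst q) \<inter> B (snd q) \<noteq> {}})"
    using I by (subst sum.inter_filter[symmetric]) simp_all
  finally show ?thesis .
qed

lemma abs_scaled_diff:
  fixes k N x y :: real
  assumes "k \<ge> 0" "N > 0"
  shows "\<bar>k * x / N - k * y / N\<bar> = k * (\<bar>x - y\<bar> / N)"
proof -
  have "k * x / N - k * y / N = k * ((x - y) / N)"
    by (simp add: right_diff_distrib diff_divide_distrib)
  then show ?thesis using assms by (simp add: abs_mult)
qed

lemma gexp_chebyshev:
  assumes D: "finite D" and p: "\<And>d. d \<in> D \<Longrightarrow> 0 \<le> p d \<and> p d \<le> 1"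
    and v: "gexp D p (\<lambda>E. (Y E)\<^sup>2) \<le> v" and l: "l > 0"
  shows "(\<Sum>E\<in>{E \<in> Pow D. \<bar>Y E\<bar> \<ge> l}. graph_weight D p E) \<le> v / l\<^sup>2"
proof -
  have nn: "0 \<le> graph_weight D p E" if "E \<in> Pow D" for E
    using that by (intro graph_weight_nonneg p) auto
  have "(\<Sum>E\<in>{E \<in> Pow D. \<bar>Y E\<bar> \<ge> l}. graph_weight D p E) * l\<^sup>2
      = (\<Sum>E\<in>{E \<in> Pow D. \<bar>Y E\<bar> \<ge> l}. graph_weight D p E * l\<^sup>2)" by (rule sum_distrib_right)
  also have "\<dots> \<le> (\<Sum>E\<in>{E \<in> Pow D. \<bar>Y E\<bar> \<ge> l}. graph_weight D p E * (Y E)\<^sup>2)"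
  proof (rule sum_mono)
    fix E assume E: "E \<in> {E \<in> Pow D. \<bar>Y E\<bar> \<ge> l}"
    then have "l\<^sup>2 \<le> \<bar>Y E\<bar>\<^sup>2" using l by (intro power_mono) auto
    then show "graph_weight D p E * l\<^sup>2 \<le> graph_weight D p E * (Y E)\<^sup>2"
      using nn E by (intro mult_left_mono) auto
  qed
  also have "\<dots> \<le> gexp D p (\<lambda>E. (Y E)\<^sup>2)"
    unfolding gexp_def using D nn by (intro sum_mono2) auto
  also have "\<dots> \<le> v" by (rule v)
  finally show ?thesis using l by (simp add: pos_le_divide_eq)
qed

section \<open>Lower bound from a random graph with two nearly equal vertex classes\<close>

definition par :: "nat \<Rightarrow> real" where
  "par i = (if even i then 1 else -1)"

lemma par_sq: "par i * par i = 1"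
  by (simp add: par_def)

lemma sum_par: "(\<Sum>i\<in>{1..n}. par i)\<^sup>2 \<le> 1"
proof -
  have "(\<Sum>i\<in>{1..n}. par i) = (if even n then 0 else -1)"
    by (induction n) (auto simp: par_def)
  then show ?thesis by simp
qed

lemma sum_pairs_par:
  "(\<Sum>d\<in>pairs {1..n}. \<alpha> + \<beta> * (\<Prod>k\<in>d. par k))
    = (\<alpha> * (real n)\<^sup>2 + \<beta> * (\<Sum>i\<in>{1..n}. par i)\<^sup>2 - (\<alpha> + \<beta>) * real n) / 2"
proof -
  have "2 * (\<Sum>d\<in>pairs {1..n}. \<alpha> + \<beta> * (\<Prod>k\<in>d. par k))
      = (\<Sum>i\<in>{1..n}. \<Sum>j\<in>{1..n}. if i = j then 0 else \<alpha> + \<beta> * (\<Prod>k\<in>{i, j}. par k))"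
    by (rule sum_pairs[symmetric]) simp
  also have "\<dots> = (\<Sum>i\<in>{1..n}. \<Sum>j\<in>{1..n}. (\<alpha> + \<beta> * (par i * par j)) - (if j = i then \<alpha> + \<beta> else 0))"
  proof (intro sum.cong refl)
    fix i j :: nat
    show "(if i = j then 0 else \<alpha> + \<beta> * (\<Prod>k\<in>{i, j}. par k)) = (\<alpha> + \<beta> * (par i * par j)) - (if j = i then \<alpha> + \<beta> else 0)"
      using par_sq[of i] by (cases "i = j") simp_all
  qed
  also have "\<dots> = \<alpha> * (real n)\<^sup>2 + \<beta> * (\<Sum>i\<in>{1..n}. par i)\<^sup>2 - (\<alpha> + \<beta>) * real n"
  proof -
    have "(\<Sum>i\<in>{1..n}. \<Sum>j\<in>{1..n}. \<alpha> + \<beta> * (par i * par j))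
      = \<alpha> * (real n)\<^sup>2 + \<beta> * (\<Sum>i\<in>{1..n}. \<Sum>j\<in>{1..n}. par i * par j)"
      by (simp add: sum.distrib sum_distrib_left power2_eq_square)
    also have "(\<Sum>i\<in>{1..n}. \<Sum>j\<in>{1..n}. par i * par j) = (\<Sum>i\<in>{1..n}. par i)\<^sup>2"
      unfolding power2_eq_square sum_product ..
    finally have 1: "(\<Sum>i\<in>{1..n}. \<Sum>j\<in>{1..n}. \<alpha> + \<beta> * (par i * par j))
      = \<alpha> * (real n)\<^sup>2 + \<beta> * (\<Sum>i\<in>{1..n}. par i)\<^sup>2" .
    have 2: "(\<Sum>i\<in>{1..n}. \<Sum>j\<in>{1..n}. if j = i then \<alpha> + \<beta> else 0) = (\<alpha> + \<beta>) * real n"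
      by (subst sum.delta) simp_all
    show ?thesis unfolding sum_subtractf 1 2 ..
  qed
  finally show ?thesis by simp
qed

text \<open>The product of the two signs is 1 or -1, so every function of the edge probability is
  affine in it. Sums of probabilities and of entropies thus both reduce to
  \<open>sum_pairs_par\<close>.\<close>

lemma pair_function_par:
  fixes f :: "real \<Rightarrow> real"
  assumes "d \<in> pairs {1..n::nat}"
  shows "f (e - a * (\<Prod>k\<in>d. par k)) = (f (e - a) + f (e + a)) / 2 + (f (e - a) - f (e + a)) / 2 * (\<Prod>k\<in>d. par k)"
proof -
  obtain i j where "d = {i, j}" "i \<noteq> j" using assms by (auto simp: pairs_def card_2_iff)
  then have "(\<Prod>k\<in>d. par k) = 1 \<or> (\<Prod>k\<in>d. par k) = -1" by (auto simp: par_def)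
  then show ?thesis by (auto simp: field_simps)
qed

text \<open>In the product over a triangle every sign occurs squared or in a pair, so the sum over
  all ordered triples is \<open>(e ^ 3 - a ^ 3) * n ^ 3\<close> plus a multiple of the squared sum
  of signs, which is at most 1; this gives the error \<open>3 * n\<close>. Degenerate triples
  account for \<open>3 * n ^ 2\<close>.\<close>

lemma sum_triples_par:
  fixes e a :: real
  assumes e: "0 < a" "a < e" "a < 1 - e"
  shows "\<bar>6 * (\<Sum>T\<in>triples {1..n}. \<Prod>d\<in>edges_of T. e - a * (\<Prod>k\<in>d. par k)) - (e ^ 3 - a ^ 3) * real n ^ 3\<bar>
    \<le> 3 * real n + 3 * (real n)\<^sup>2"
proof -
  let ?V = "{1..n}"
  define g where "g i j = e - a * (par i * par j)" for i j
  define c where "c = e * a\<^sup>2 - a * e\<^sup>2"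
  define m where "m = (\<Sum>i\<in>?V. par i)"
  have g01: "0 \<le> g i j" "g i j \<le> 1" for i j using e by (auto simp: g_def par_def)
  have F: "(\<Prod>d\<in>edges_of {i, j, k}. e - a * (\<Prod>k\<in>d. par k)) = g i j * g j k * g k i"
    if "i \<noteq> j" "j \<noteq> k" "k \<noteq> i" for i j k
  proof -
    have "{i, j} \<noteq> {j, k}" "{i, j} \<noteq> {k, i}" "{j, k} \<noteq> {k, i}" using that by (auto simp: doubleton_eq_iff)
    then show ?thesis
      unfolding edges_of_triple[OF that] g_def using that by (simp add: mult_ac)
  qed
  have "6 * (\<Sum>T\<in>triples ?V. \<Prod>d\<in>edges_of T. e - a * (\<Prod>k\<in>d. par k))
      = (\<Sum>i\<in>?V. \<Sum>j\<in>?V. \<Sum>k\<in>?V. if i = j \<or> j = k \<or> k = i then 0 else g i j * g j k * g k i)"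
    unfolding sum_triples[OF finite_atLeastAtMost, symmetric] using F by (intro sum.cong refl) simp
  also have "\<dots> = (\<Sum>i\<in>?V. \<Sum>j\<in>?V. \<Sum>k\<in>?V. g i j * g j k * g k i)
      - (\<Sum>i\<in>?V. \<Sum>j\<in>?V. \<Sum>k\<in>?V. if i = j \<or> j = k \<or> k = i then g i j * g j k * g k i else 0)"
    unfolding sum_subtractf[symmetric] by (intro sum.cong refl) simp
  finally have split: "6 * (\<Sum>T\<in>triples ?V. \<Prod>d\<in>edges_of T. e - a * (\<Prod>k\<in>d. par k))
      = (\<Sum>i\<in>?V. \<Sum>j\<in>?V. \<Sum>k\<in>?V. g i j * g j k * g k i)
      - (\<Sum>i\<in>?V. \<Sum>j\<in>?V. \<Sum>k\<in>?V. if i = j \<or> j = k \<or> k = i then g i j * g j k * g k i else 0)" .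
  have full: "(\<Sum>i\<in>?V. \<Sum>j\<in>?V. \<Sum>k\<in>?V. g i j * g j k * g k i) = (e ^ 3 - a ^ 3) * real n ^ 3 + 3 * c * real n * m\<^sup>2"
  proof -
    have "g i j * g j k * g k i = (e ^ 3 - a ^ 3) + c * (par i * par j) + c * (par j * par k) + c * (par k * par i)" for i j k
      by (auto simp: g_def c_def par_def power2_eq_square power3_eq_cube algebra_simps)
    then have F0: "(\<Sum>i\<in>?V. \<Sum>j\<in>?V. \<Sum>k\<in>?V. g i j * g j k * g k i)
      = (\<Sum>i\<in>?V. \<Sum>j\<in>?V. \<Sum>k\<in>?V. e ^ 3 - a ^ 3) + (\<Sum>i\<in>?V. \<Sum>j\<in>?V. \<Sum>k\<in>?V. c * (par i * par j))
        + (\<Sum>i\<in>?V. \<Sum>j\<in>?V. \<Sum>k\<in>?V. c * (par j * par k)) + (\<Sum>i\<in>?V. \<Sum>j\<in>?V. \<Sum>k\<in>?V. c * (par k * par i))"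
      by (simp only: sum.distrib)
    have mm: "m\<^sup>2 = (\<Sum>i\<in>?V. \<Sum>j\<in>?V. par i * par j)"
      unfolding m_def power2_eq_square sum_product ..
    have F1: "(\<Sum>i\<in>?V. \<Sum>j\<in>?V. \<Sum>k\<in>?V. c * (par j * par k)) = c * real n * m\<^sup>2"
      unfolding mm by (simp add: sum_distrib_left mult_ac)
    have F2: "(\<Sum>i\<in>?V. \<Sum>j\<in>?V. \<Sum>k\<in>?V. c * (par i * par j)) = c * real n * m\<^sup>2"
      unfolding mm by (simp add: sum_distrib_left mult_ac)
    have "(\<Sum>i\<in>?V. \<Sum>j\<in>?V. \<Sum>k\<in>?V. c * (par k * par i)) = (\<Sum>j\<in>?V. \<Sum>i\<in>?V. \<Sum>k\<in>?V. c * (par k * par i))"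
      by (rule sum.swap)
    also have "\<dots> = c * real n * m\<^sup>2"
      unfolding mm by (simp add: sum_distrib_left mult_ac)
    finally have F3: "(\<Sum>i\<in>?V. \<Sum>j\<in>?V. \<Sum>k\<in>?V. c * (par k * par i)) = c * real n * m\<^sup>2" .
    have F4: "(\<Sum>i\<in>?V. \<Sum>j\<in>?V. \<Sum>k\<in>?V. e ^ 3 - a ^ 3) = (e ^ 3 - a ^ 3) * real n ^ 3"
      by (simp add: power3_eq_cube)
    show ?thesis unfolding F0 F1 F2 F3 F4 by simp
  qed
  let ?R = "\<Sum>i\<in>?V. \<Sum>j\<in>?V. \<Sum>k\<in>?V. if i = j \<or> j = k \<or> k = i then g i j * g j k * g k i else 0"
  have ggg: "0 \<le> g i j * g j k * g k i" "g i j * g j k * g k i \<le> 1" for i j k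
    using g01 by (simp_all add: mult_le_one)
  have R0: "0 \<le> ?R" by (intro sum_nonneg) (simp add: ggg)
  have R1: "?R \<le> 3 * (real n)\<^sup>2"
  proof -
    define dl :: "nat \<Rightarrow> nat \<Rightarrow> real" where "dl i j = (if j = i then 1 else 0)" for i j
    have dl: "(\<Sum>j\<in>?V. dl i j) = 1" if "i \<in> ?V" for i
      using that by (simp add: dl_def)
    have "?R \<le> (\<Sum>i\<in>?V. \<Sum>j\<in>?V. \<Sum>k\<in>?V. dl i j + dl j k + dl i k)"
    proof (intro sum_mono)
      fix i j k
      show "(if i = j \<or> j = k \<or> k = i then g i j * g j k * g k i else 0) \<le> dl i j + dl j k + dl i k"
        using ggg[of i j k] by (auto simp: dl_def)
    qed
    also have "\<dots> = (\<Sum>i\<in>?V. \<Sum>j\<in>?V. real n * dl i j) + (\<Sum>i\<in>?V. \<Sum>j\<in>?V. \<Sum>k\<in>?V. dl j k)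
        + (\<Sum>i\<in>?V. \<Sum>j\<in>?V. \<Sum>k\<in>?V. dl i k)"
      by (simp add: sum.distrib)
    also have "\<dots> = (\<Sum>i\<in>?V. real n * 1) + (\<Sum>i\<in>?V. \<Sum>j\<in>?V. 1) + (\<Sum>i\<in>?V. \<Sum>j\<in>?V. 1)"
      by (intro arg_cong2[where f = "(+)"] sum.cong refl dl) (simp_all only: sum_distrib_left[symmetric] dl)
    also have "\<dots> = 3 * (real n)\<^sup>2" by (simp add: power2_eq_square)
    finally show ?thesis .
  qed
  have c1: "\<bar>c\<bar> \<le> 1"
  proof -
    have "c = (e * a) * (a - e)" by (simp add: c_def power2_eq_square algebra_simps)
    moreover have "\<bar>e * a\<bar> \<le> 1" "\<bar>a - e\<bar> \<le> 1" using e by (auto simp: abs_mult intro: mult_le_one)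
    ultimately show ?thesis using mult_le_one[of "\<bar>e * a\<bar>" "\<bar>a - e\<bar>"] by (simp add: abs_mult)
  qed
  have "\<bar>3 * c * real n * m\<^sup>2\<bar> \<le> 3 * real n"
  proof -
    have "\<bar>c\<bar> * m\<^sup>2 \<le> 1" using c1 sum_par[of n] by (intro mult_le_one) (auto simp: m_def)
    then have "(3 * real n) * (\<bar>c\<bar> * m\<^sup>2) \<le> (3 * real n) * 1" by (intro mult_left_mono) auto
    then show ?thesis by (simp add: abs_mult mult_ac)
  qed
  then show ?thesis unfolding split full using R0 R1 by linarith
qed

text \<open>Two triples with a common edge are \<open>{x, y, z}\<close> and \<open>{x, y, w}\<close>.\<close>

lemma card_edge_sharing:
  "card {q \<in> triples {1..n} \<times> triples {1..n::nat}. edges_of (fst q) \<inter> edges_of (snd q) \<noteq> {}} \<le> n ^ 4"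
proof -
  let ?V = "{1..n}" let ?f = "\<lambda>(x, y, z, w). ({x, y, z}, {x, y, w})"
  have "{q \<in> triples ?V \<times> triples ?V. edges_of (fst q) \<inter> edges_of (snd q) \<noteq> {}} \<subseteq> ?f ` (?V \<times> ?V \<times> ?V \<times> ?V)"
  proof
    fix q assume "q \<in> {q \<in> triples ?V \<times> triples ?V. edges_of (fst q) \<inter> edges_of (snd q) \<noteq> {}}"
    then obtain S T where q: "q = (S, T)" "S \<in> triples ?V" "T \<in> triples ?V" "edges_of S \<inter> edges_of T \<noteq> {}"
      by (cases q) auto
    then obtain d where d: "d \<subseteq> S" "d \<subseteq> T" "card d = 2" unfolding edges_of_def pairs_def by blast
    obtain x y where xy: "d = {x, y}" "x \<noteq> y" using d(3) by (auto simp: card_2_iff)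
    have third: "\<exists>z\<in>?V. S' = {x, y, z}" if S': "S' \<in> triples ?V" "d \<subseteq> S'" for S'
    proof -
      have fin: "finite S'" and c: "card S' = 3" and sub: "S' \<subseteq> ?V"
        using S' finite_subset[of S' ?V] by (auto simp: triples_def)
      have "card (S' - d) = 1" using card_Diff_subset[of d S'] d(3) c S'(2) finite_subset[OF S'(2) fin] by simp
      then obtain z where z: "S' - d = {z}" by (auto simp: card_1_singleton_iff)
      then have "S' = {x, y, z}" using S'(2) xy by blast
      moreover have "z \<in> ?V" using z sub by blast
      ultimately show ?thesis by blast
    qed
    obtain z w where "z \<in> ?V" "S = {x, y, z}" "w \<in> ?V" "T = {x, y, w}"
      using third[OF q(2) d(1)] third[OF q(3) d(2)] by blast
    moreover have "x \<in> ?V" "y \<in> ?V" using xy d q(2) by (auto simp: triples_def)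
    ultimately have "q = ?f (x, y, z, w)" "(x, y, z, w) \<in> ?V \<times> ?V \<times> ?V \<times> ?V" using q(1) by auto
    then show "q \<in> ?f ` (?V \<times> ?V \<times> ?V \<times> ?V)" by (rule image_eqI)
  qed
  then have "card {q \<in> triples ?V \<times> triples ?V. edges_of (fst q) \<inter> edges_of (snd q) \<noteq> {}}
      \<le> card (?f ` (?V \<times> ?V \<times> ?V \<times> ?V))" by (rule card_mono[rotated]) simp
  also have "\<dots> \<le> card (?V \<times> ?V \<times> ?V \<times> ?V)" by (rule card_image_le) simp
  also have "\<dots> = n ^ 4" by (simp add: card_cartesian_product power4_eq_xxxx)
  finally show ?thesis .
qed

lemma card_singleton_sharing:
  "card {q \<in> pairs {1..n} \<times> pairs {1..n::nat}. {fst q} \<inter> {snd q} \<noteq> {}} \<le> n ^ 2"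
proof -
  have "{q \<in> pairs {1..n} \<times> pairs {1..n}. {fst q} \<inter> {snd q} \<noteq> {}} = (\<lambda>d. (d, d)) ` pairs {1..n}" by auto
  then have "card {q \<in> pairs {1..n} \<times> pairs {1..n}. {fst q} \<inter> {snd q} \<noteq> {}} \<le> card (pairs {1..n})"
    by (simp only:) (rule card_image_le, simp add: finite_pairs)
  also have "\<dots> \<le> n ^ 2" unfolding card_pairs
    by (cases "2 \<le> n") (simp_all add: binomial_le_pow binomial_eq_0)
  finally show ?thesis .
qed

text \<open>The good graphs have total weight at least 1/2, while each has weight at most
  \<open>exp (l2 - S)\<close> with \<open>S\<close> the entropy of the product measure; so there are
  at least \<open>exp (S - l2) / 2\<close> of them. The model \<open>(e0, t0)\<close> may differ
  from the centre \<open>(e, t)\<close> because for fixed \<delta> the count is governed by the best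
  point of the box.\<close>

lemma graph_count_lower:
  assumes dom: "(e0, t0) \<in> amp_domain" and e0: "\<bar>e0 - e\<bar> < \<delta>" and t0: "\<bar>t0 - t\<bar> < \<delta>" and \<eta>: "\<eta> > 0"
  shows "\<forall>\<^sub>F n in sequentially. exp ((opt_entropy e0 t0 / 2 - \<eta>) * (real n)\<^sup>2) \<le> real (graph_count n \<delta> e t)"
proof -
  define a where "a = amp e0 t0"
  have a: "0 < a" "a < e0" "a < 1 - e0" using dom by (auto simp: amp_domain_def a_def)
  have t0a: "t0 = e0 ^ 3 - a ^ 3" using amp_cubed[of e0 t0] by (simp add: a_def)
  \<comment> \<open>A bound for the log-odds of both edge probabilities. It is at least 1, so that
    the bound \<open>q\<close> below also covers the unweighted counts.\<close>
  define C where "C = max 1 (max \<bar>ln ((e0 - a) / (1 - (e0 - a)))\<bar> \<bar>ln ((e0 + a) / (1 - (e0 + a)))\<bar>)"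
  have C1: "C \<ge> 1" by (simp add: C_def)
  define \<gamma> where "\<gamma> = min (\<delta> - \<bar>e0 - e\<bar>) (\<delta> - \<bar>t0 - t\<bar>)"
  have \<gamma>: "\<gamma> > 0" using e0 t0 by (simp add: \<gamma>_def)
  \<comment> \<open>The deviation \<open>6 * \<epsilon>\<close> of the triangle density takes half
    of the slack \<gamma>, leaving the other half to the error \<open>12 / n\<close>. The deviation
    of the log-likelihood takes half of \<eta>.\<close>
  define \<epsilon> where "\<epsilon> = min (\<gamma> / 12) (\<eta> / 2)"
  have \<epsilon>: "\<epsilon> > 0" "6 * \<epsilon> \<le> \<gamma> / 2" "\<epsilon> \<le> \<eta> / 2" using \<gamma> \<eta> by (auto simp: \<epsilon>_def)
  have "(\<lambda>n. 12 / real n) \<longlonglongrightarrow> 0" by real_asymp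
  then have ev1: "\<forall>\<^sub>F n in sequentially. 12 / real n < \<gamma> / 2" using \<gamma> by (intro order_tendstoD(2)) auto
  have "(\<lambda>n. 3 * C\<^sup>2 / \<epsilon>\<^sup>2 * (1 / (real n)\<^sup>2)) \<longlonglongrightarrow> 3 * C\<^sup>2 / \<epsilon>\<^sup>2 * 0"
    by (intro tendsto_mult tendsto_const) real_asymp
  then have ev2: "\<forall>\<^sub>F n in sequentially. 3 * C\<^sup>2 / \<epsilon>\<^sup>2 * (1 / (real n)\<^sup>2) < 1/2" by (intro order_tendstoD(2)) auto
  have "(\<lambda>n. (real n + ln 2) / (real n)\<^sup>2) \<longlonglongrightarrow> 0" by real_asymp
  then have ev3: "\<forall>\<^sub>F n in sequentially. (real n + ln 2) / (real n)\<^sup>2 < \<eta> / 2" using \<eta> by (intro order_tendstoD(2)) auto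
  show ?thesis using ev1 ev2 ev3 eventually_ge_at_top[of "3::nat"]
  proof eventually_elim
    case (elim n)
    let ?V = "{1..n}" let ?D = "pairs {1..n}"
    have n3: "n \<ge> 3" and n: "real n \<ge> 3" using elim by auto
    have n2: "(real n)\<^sup>2 > 0" using n by simp
    have finD: "finite ?D" by (rule finite_pairs) simp
    define s where "s d = (\<Prod>k\<in>d. par k)" for d
    define p where "p d = e0 - a * s d" for d
    have pf: "f (p d) = (f (e0 - a) + f (e0 + a)) / 2 + (f (e0 - a) - f (e0 + a)) / 2 * s d" if "d \<in> ?D" for f :: "real \<Rightarrow> real" and d
      unfolding p_def s_def by (rule pair_function_par[OF that])
    have pcase: "p d = e0 - a \<or> p d = e0 + a" if d: "d \<in> ?D" for d
    proof -
      obtain i j where "d = {i, j}" "i \<noteq> j" using d by (auto simp: pairs_def card_2_iff)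
      then show ?thesis by (auto simp: p_def s_def par_def)
    qed
    have p01: "0 < p d" "p d < 1" if "d \<in> ?D" for d using pcase[OF that] a by auto
    have pr: "0 \<le> p d \<and> p d \<le> 1" if "d \<in> ?D" for d using p01[OF that] by simp
    define w where "w d = ln (p d / (1 - p d))" for d
    have wC: "\<bar>w d\<bar> \<le> C" if "d \<in> ?D" for d using pcase[OF that] by (auto simp: w_def C_def)
    let ?G = "graph_weight ?D p"
    \<comment> \<open>\<open>?Y3\<close> is the deviation of the log-likelihood\<close>
    let ?Y1 = "\<lambda>E. (\<Sum>d\<in>?D. 1 * of_bool ({d} \<subseteq> E)) - (\<Sum>d\<in>?D. 1 * (\<Prod>d'\<in>{d}. p d'))"
    let ?Y2 = "\<lambda>E. (\<Sum>T\<in>triples ?V. 1 * of_bool (edges_of T \<subseteq> E)) - (\<Sum>T\<in>triples ?V. 1 * (\<Prod>d\<in>edges_of T. p d))"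
    let ?Y3 = "\<lambda>E. (\<Sum>d\<in>?D. w d * of_bool ({d} \<subseteq> E)) - (\<Sum>d\<in>?D. w d * (\<Prod>d'\<in>{d}. p d'))"
    have edges_sub: "edges_of T \<subseteq> ?D" if "T \<in> triples ?V" for T
      using that by (auto simp: edges_of_def pairs_def triples_def)
    have v1: "gexp ?D p (\<lambda>E. (?Y1 E)\<^sup>2) \<le> 1\<^sup>2 * real (n ^ 2)"
    proof (rule order_trans)
      show "gexp ?D p (\<lambda>E. (?Y1 E)\<^sup>2) \<le> 1\<^sup>2 * real (card {q \<in> ?D \<times> ?D. {fst q} \<inter> {snd q} \<noteq> {}})"
        by (rule gexp_variance[OF finD _ finD, where w = "\<lambda>_. 1" and B = "\<lambda>d. {d}"]) (use pr in auto)
    qed (intro mult_left_mono of_nat_mono card_singleton_sharing, simp)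
    have v2: "gexp ?D p (\<lambda>E. (?Y2 E)\<^sup>2) \<le> 1\<^sup>2 * real (n ^ 4)"
    proof (rule order_trans)
      show "gexp ?D p (\<lambda>E. (?Y2 E)\<^sup>2)
          \<le> 1\<^sup>2 * real (card {q \<in> triples ?V \<times> triples ?V. edges_of (fst q) \<inter> edges_of (snd q) \<noteq> {}})"
        by (rule gexp_variance[OF finD _ finite_triples[OF finite_atLeastAtMost], where w = "\<lambda>_. 1" and B = edges_of])
          (use pr edges_sub in auto)
    qed (intro mult_left_mono of_nat_mono card_edge_sharing, simp)
    have v3: "gexp ?D p (\<lambda>E. (?Y3 E)\<^sup>2) \<le> C\<^sup>2 * real (n ^ 2)"
    proof (rule order_trans)
      show "gexp ?D p (\<lambda>E. (?Y3 E)\<^sup>2) \<le> C\<^sup>2 * real (card {q \<in> ?D \<times> ?D. {fst q} \<inter> {snd q} \<noteq> {}})"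
        by (rule gexp_variance[OF finD _ finD, where w = w and B = "\<lambda>d. {d}"]) (use pr wC in auto)
    qed (intro mult_left_mono of_nat_mono card_singleton_sharing, simp)
    \<comment> \<open>The standard deviations are of order \<open>n\<close> for the two sums over
      pairs and at most of order \<open>n ^ 2\<close> for triangles, so by Chebyshev each of these
      deviations has probability of order at most \<open>1 / n ^ 2\<close>.\<close>
    define l2 where "l2 = \<epsilon> * (real n)\<^sup>2"
    define l3 where "l3 = \<epsilon> * real n ^ 3"
    have l: "l2 > 0" "l3 > 0" using \<epsilon> n by (auto simp: l2_def l3_def)
    let ?bad = "\<lambda>Y l. {E \<in> Pow ?D. \<bar>Y E\<bar> \<ge> l}"
    define q where "q = C\<^sup>2 / \<epsilon>\<^sup>2 * (1 / (real n)\<^sup>2)"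
    have C2: "1 \<le> C\<^sup>2" using C1 by simp
    have b1: "(\<Sum>E\<in>?bad ?Y1 l2. ?G E) \<le> q"
    proof -
      have "(\<Sum>E\<in>?bad ?Y1 l2. ?G E) \<le> 1\<^sup>2 * real (n ^ 2) / l2\<^sup>2" by (rule gexp_chebyshev[OF finD pr v1 l(1)])
      also have "\<dots> = 1 / \<epsilon>\<^sup>2 * (1 / (real n)\<^sup>2)" using n by (simp add: l2_def power_mult_distrib power2_eq_square)
      also have "\<dots> \<le> q" unfolding q_def using C2 by (intro mult_right_mono divide_right_mono) auto
      finally show ?thesis .
    qed
    have b2: "(\<Sum>E\<in>?bad ?Y2 l3. ?G E) \<le> q"
    proof -
      have "(\<Sum>E\<in>?bad ?Y2 l3. ?G E) \<le> 1\<^sup>2 * real (n ^ 4) / l3\<^sup>2" by (rule gexp_chebyshev[OF finD pr v2 l(2)])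
      also have "\<dots> = 1 / \<epsilon>\<^sup>2 * (1 / (real n)\<^sup>2)"
        using n by (simp add: l3_def power_mult_distrib power2_eq_square power3_eq_cube power4_eq_xxxx)
      also have "\<dots> \<le> q" unfolding q_def using C2 by (intro mult_right_mono divide_right_mono) auto
      finally show ?thesis .
    qed
    have b3: "(\<Sum>E\<in>?bad ?Y3 l2. ?G E) \<le> q"
    proof -
      have "(\<Sum>E\<in>?bad ?Y3 l2. ?G E) \<le> C\<^sup>2 * real (n ^ 2) / l2\<^sup>2" by (rule gexp_chebyshev[OF finD pr v3 l(1)])
      also have "\<dots> = q" using n by (simp add: l2_def q_def power_mult_distrib power2_eq_square)
      finally show ?thesis .
    qed
    define good where "good = {E \<in> Pow ?D. \<bar>?Y1 E\<bar> < l2 \<and> \<bar>?Y2 E\<bar> < l3 \<and> \<bar>?Y3 E\<bar> < l2}"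
    have nnG: "0 \<le> ?G E" if "E \<in> Pow ?D" for E using that pr by (intro graph_weight_nonneg) auto
    have "1 \<le> (\<Sum>E\<in>good. ?G E) + 3 * q"
    proof -
      have "1 = (\<Sum>E\<in>Pow ?D. ?G E)" by (rule sum_graph_weight[OF finD, symmetric])
      also have "\<dots> \<le> (\<Sum>E\<in>good \<union> (?bad ?Y1 l2 \<union> (?bad ?Y2 l3 \<union> ?bad ?Y3 l2)). ?G E)"
        by (rule sum_mono2) (use finD nnG in \<open>auto simp: good_def not_less\<close>)
      also have "\<dots> \<le> (\<Sum>E\<in>good. ?G E) + ((\<Sum>E\<in>?bad ?Y1 l2. ?G E) + ((\<Sum>E\<in>?bad ?Y2 l3. ?G E) + (\<Sum>E\<in>?bad ?Y3 l2. ?G E)))"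
      proof -
        have U: "(\<Sum>E\<in>A \<union> B. ?G E) \<le> (\<Sum>E\<in>A. ?G E) + (\<Sum>E\<in>B. ?G E)" if "A \<subseteq> Pow ?D" "B \<subseteq> Pow ?D" for A B
        proof -
          have "finite A" "finite B" using that finD finite_subset by (metis finite_Pow_iff)+
          then have "(\<Sum>E\<in>A \<union> B. ?G E) = (\<Sum>E\<in>A. ?G E) + (\<Sum>E\<in>B. ?G E) - (\<Sum>E\<in>A \<inter> B. ?G E)"
            by (rule sum_Un)
          moreover have "0 \<le> (\<Sum>E\<in>A \<inter> B. ?G E)" using that nnG by (intro sum_nonneg) auto
          ultimately show ?thesis by simp
        qed
        show ?thesis
          by (rule order_trans[OF U add_left_mono[OF order_trans[OF U add_left_mono[OF U]]]]) (auto simp: good_def)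
      qed
      finally show ?thesis using b1 b2 b3 by linarith
    qed
    moreover have "3 * q < 1/2" using elim(2) by (simp add: q_def)
    ultimately have half: "1/2 \<le> (\<Sum>E\<in>good. ?G E)" by linarith
    define S where "S = (\<Sum>d\<in>?D. H (p d))"
    have Gup: "?G E \<le> exp (l2 - S)" if E: "E \<in> good" for E
    proof -
      have ED: "E \<subseteq> ?D" using E by (simp add: good_def)
      have "?G E = exp (\<Sum>d\<in>?D. if d \<in> E then ln (p d) else ln (1 - p d))"
        by (rule graph_weight_exp[OF finD ED]) (use p01 ED in auto)
      \<comment> \<open>The mean of the log-likelihood is \<open>- S\<close>, because
        \<open>w d * p d + H (p d) = - ln (1 - p d)\<close>.\<close>
      moreover have "(\<Sum>d\<in>?D. if d \<in> E then ln (p d) else ln (1 - p d)) = ?Y3 E - S"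
      proof -
        have "(if d \<in> E then ln (p d) else ln (1 - p d)) = w d * of_bool ({d} \<subseteq> E) - w d * (\<Prod>d'\<in>{d}. p d') - H (p d)"
          if "d \<in> ?D" for d
          using p01[OF that] by (simp add: w_def H_def ln_div algebra_simps)
        then have "(\<Sum>d\<in>?D. if d \<in> E then ln (p d) else ln (1 - p d))
          = (\<Sum>d\<in>?D. w d * of_bool ({d} \<subseteq> E) - w d * (\<Prod>d'\<in>{d}. p d') - H (p d))" by (rule sum.cong[OF refl])
        then show ?thesis unfolding S_def by (simp only: sum_subtractf)
      qed
      moreover have "?Y3 E \<le> l2" using E by (simp add: good_def abs_less_iff)
      ultimately show ?thesis by simp
    qed
    have fing: "finite good" unfolding good_def using finD by simp
    have cardg: "exp (S - l2) / 2 \<le> real (card good)"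
    proof -
      have "1/2 \<le> (\<Sum>E\<in>good. exp (l2 - S))" by (rule order_trans[OF half sum_mono[OF Gup]])
      then have "1/2 * exp (S - l2) \<le> (real (card good) * exp (l2 - S)) * exp (S - l2)"
        by (intro mult_right_mono) auto
      then show ?thesis by (simp add: mult.assoc flip: exp_add)
    qed
    define \<mu> where "\<mu> = (\<Sum>i\<in>?V. par i)"
    have \<mu>1: "\<mu>\<^sup>2 \<le> 1" "0 \<le> \<mu>\<^sup>2" using sum_par[of n] by (auto simp: \<mu>_def)
    have fsum: "(\<Sum>d\<in>?D. f (p d)) = ((f (e0 - a) + f (e0 + a)) / 2 * (real n)\<^sup>2
        + (f (e0 - a) - f (e0 + a)) / 2 * \<mu>\<^sup>2 - f (e0 - a) * real n) / 2" for f :: "real \<Rightarrow> real"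
    proof -
      have "(\<Sum>d\<in>?D. f (p d)) = (\<Sum>d\<in>?D. (f (e0 - a) + f (e0 + a)) / 2 + (f (e0 - a) - f (e0 + a)) / 2 * s d)"
        by (intro sum.cong refl pf)
      also have "\<dots> = ((f (e0 - a) + f (e0 + a)) / 2 * (real n)\<^sup>2 + (f (e0 - a) - f (e0 + a)) / 2 * \<mu>\<^sup>2
          - ((f (e0 - a) + f (e0 + a)) / 2 + (f (e0 - a) - f (e0 + a)) / 2) * real n) / 2"
        unfolding s_def \<mu>_def by (rule sum_pairs_par)
      also have "(f (e0 - a) + f (e0 + a)) / 2 + (f (e0 - a) - f (e0 + a)) / 2 = f (e0 - a)" by (simp add: field_simps)
      finally show ?thesis .
    qed
    have Slow: "opt_entropy e0 t0 / 2 * (real n)\<^sup>2 - real n \<le> S"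
    proof -
      have r: "0 \<le> H (e0 - a)" "H (e0 - a) \<le> 1" "0 \<le> H (e0 + a)" "H (e0 + a) \<le> 1"
        using a by (auto intro!: H_nonneg H_le_1)
      have S_eq: "S = (opt_entropy e0 t0 * (real n)\<^sup>2 + (H (e0 - a) - H (e0 + a)) / 2 * \<mu>\<^sup>2 - H (e0 - a) * real n) / 2"
        unfolding S_def fsum opt_entropy_def a_def ..
      have M: "- 1 \<le> (H (e0 - a) - H (e0 + a)) / 2 * \<mu>\<^sup>2"
      proof -
        have "(- 1) * \<mu>\<^sup>2 \<le> (H (e0 - a) - H (e0 + a)) / 2 * \<mu>\<^sup>2"
        proof (rule mult_right_mono[OF _ \<mu>1(2)])
          have "- 1 \<le> (x - y) / 2" if "0 \<le> x" "y \<le> 1" for x y :: real using that by simp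
          then show "- 1 \<le> (H (e0 - a) - H (e0 + a)) / 2" using r(1,4) by blast
        qed
        then show ?thesis using \<mu>1(1) by linarith
      qed
      have h: "H (e0 - a) * real n \<le> 1 * real n" using r by (intro mult_right_mono) auto
      have bound: "X / 2 * k - m \<le> (X * k + M - h) / 2" if "- 1 \<le> M" "h \<le> 1 * m" "1 \<le> m" for X k M h m :: real
        using that by (simp add: field_simps)
      show ?thesis unfolding S_eq by (rule bound[OF M h]) (use n in simp)
    qed
    have sub: "good \<subseteq> count_set n \<delta> e t"
    proof
      fix E assume E: "E \<in> good"
      then have ED: "E \<subseteq> ?D" by (simp add: good_def)
      have Y1: "?Y1 E = real (card E) - (\<Sum>d\<in>?D. p d)"
      proof -
        have "(\<Sum>d\<in>?D. 1 * of_bool ({d} \<subseteq> E)) = real (card E)"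
          using ED finD by (simp add: of_bool_def sum.If_cases Int_absorb1)
        then show ?thesis by simp
      qed
      have Y2: "?Y2 E = real (card (graph_triangles n E)) - (\<Sum>T\<in>triples ?V. \<Prod>d\<in>edges_of T. p d)"
      proof -
        have "(\<Sum>T\<in>triples ?V. 1 * of_bool (edges_of T \<subseteq> E)) = (\<Sum>T\<in>triples ?V. if edges_of T \<subseteq> E then 1 else 0 :: real)"
          by (intro sum.cong refl) (simp add: of_bool_def)
        also have "\<dots> = real (card (graph_triangles n E))"
          unfolding graph_triangles_eq using finite_triples[OF finite_atLeastAtMost[of 1 n]]
          by (simp flip: sum.inter_filter)
        finally show ?thesis by simp
      qed
      have Ed: "\<bar>graph_edge_density n E - e0\<bar> \<le> 2 * \<epsilon> + 3 / real n"
      proof -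
        have 1: "\<bar>2 * real (card E) / (real n)\<^sup>2 - graph_edge_density n E\<bar> \<le> 1 / real n"
          using n3 by (intro edge_density_matrix ED) simp
        have 2: "\<bar>2 * real (card E) / (real n)\<^sup>2 - 2 * (\<Sum>d\<in>?D. p d) / (real n)\<^sup>2\<bar> \<le> 2 * \<epsilon>"
        proof -
          have "\<bar>real (card E) - (\<Sum>d\<in>?D. p d)\<bar> \<le> l2" using E Y1 unfolding good_def by simp
          then have "\<bar>real (card E) - (\<Sum>d\<in>?D. p d)\<bar> / (real n)\<^sup>2 \<le> \<epsilon>"
            using n2 by (simp add: l2_def pos_divide_le_eq)
          moreover have "\<bar>2 * real (card E) / (real n)\<^sup>2 - 2 * (\<Sum>d\<in>?D. p d) / (real n)\<^sup>2\<bar>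
              = 2 * (\<bar>real (card E) - (\<Sum>d\<in>?D. p d)\<bar> / (real n)\<^sup>2)"
            by (rule abs_scaled_diff) (use n2 in auto)
          ultimately show ?thesis by simp
        qed
        have 3: "\<bar>2 * (\<Sum>d\<in>?D. p d) / (real n)\<^sup>2 - e0\<bar> \<le> 2 / real n"
        proof -
          have "2 * (\<Sum>d\<in>?D. p d) = e0 * (real n)\<^sup>2 - a * \<mu>\<^sup>2 - (e0 - a) * real n"
            using fsum[of "\<lambda>x. x"] by simp
          then have "2 * (\<Sum>d\<in>?D. p d) / (real n)\<^sup>2 - e0 = - (a * \<mu>\<^sup>2 + (e0 - a) * real n) / (real n)\<^sup>2"
            using n2 by (simp add: field_simps)
          moreover have "0 \<le> a * \<mu>\<^sup>2 + (e0 - a) * real n \<and> a * \<mu>\<^sup>2 + (e0 - a) * real n \<le> 2 * real n"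
          proof -
            have "a * \<mu>\<^sup>2 \<le> 1" "0 \<le> a * \<mu>\<^sup>2" using a \<mu>1 by (auto intro: mult_le_one)
            moreover have "(e0 - a) * real n \<le> 1 * real n"
              by (rule mult_right_mono) (use a in linarith, simp)
            moreover have "0 \<le> (e0 - a) * real n" using a by simp
            ultimately show ?thesis using n by linarith
          qed
          ultimately have "\<bar>2 * (\<Sum>d\<in>?D. p d) / (real n)\<^sup>2 - e0\<bar> \<le> (2 * real n) / (real n)\<^sup>2"
            by (simp only: minus_divide_left[symmetric] abs_minus_cancel abs_divide abs_power2 abs_of_nonneg divide_right_mono zero_le_power2)
          then show ?thesis using n by (simp add: power2_eq_square)
        qed
        have "3 / real n = 1 / real n + 2 / real n" by (simp add: add_divide_distrib[symmetric])
        then show ?thesis using 1 2 3 by linarith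
      qed
      have Td: "\<bar>graph_triangle_density n E - t0\<bar> \<le> 6 * \<epsilon> + 12 / real n"
      proof -
        let ?P = "\<Sum>T\<in>triples ?V. \<Prod>d\<in>edges_of T. p d"
        have n3': "real n ^ 3 > 0" using n by simp
        have 1: "\<bar>6 * real (card (graph_triangles n E)) / real n ^ 3 - graph_triangle_density n E\<bar> \<le> 3 / real n"
          by (rule triangle_density_matrix[OF n3 ED])
        have 2: "\<bar>6 * real (card (graph_triangles n E)) / real n ^ 3 - 6 * ?P / real n ^ 3\<bar> \<le> 6 * \<epsilon>"
        proof -
          have "\<bar>real (card (graph_triangles n E)) - ?P\<bar> \<le> l3" using E Y2 unfolding good_def by simp
          then have "\<bar>real (card (graph_triangles n E)) - ?P\<bar> / real n ^ 3 \<le> \<epsilon>"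
            using n3' by (simp add: l3_def pos_divide_le_eq)
          moreover have "\<bar>6 * real (card (graph_triangles n E)) / real n ^ 3 - 6 * ?P / real n ^ 3\<bar>
              = 6 * (\<bar>real (card (graph_triangles n E)) - ?P\<bar> / real n ^ 3)"
            by (rule abs_scaled_diff) (use n3' in auto)
          ultimately show ?thesis by simp
        qed
        have 3: "\<bar>6 * ?P / real n ^ 3 - t0\<bar> \<le> 9 / real n"
        proof -
          have "\<bar>6 * ?P - t0 * real n ^ 3\<bar> \<le> 3 * real n + 3 * (real n)\<^sup>2"
            unfolding p_def s_def t0a by (rule sum_triples_par[OF a])
          also have "\<dots> \<le> 9 * (real n)\<^sup>2"
          proof -
            have "real n * 1 \<le> real n * real n" using n by (intro mult_left_mono) auto
            then show ?thesis by (simp add: power2_eq_square)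
          qed
          finally have "\<bar>6 * ?P - t0 * real n ^ 3\<bar> / real n ^ 3 \<le> 9 * (real n)\<^sup>2 / real n ^ 3"
            by (rule divide_right_mono) simp
          moreover have "\<bar>6 * ?P - t0 * real n ^ 3\<bar> / real n ^ 3 = \<bar>6 * ?P / real n ^ 3 - t0\<bar>"
          proof -
            have "6 * ?P / real n ^ 3 - t0 = (6 * ?P - t0 * real n ^ 3) / real n ^ 3"
              using n3' by (simp add: diff_divide_distrib)
            then show ?thesis using n3' by (simp add: abs_divide)
          qed
          moreover have "9 * (real n)\<^sup>2 / real n ^ 3 = 9 / real n" using n by (simp add: power2_eq_square power3_eq_cube)
          ultimately show ?thesis by simp
        qed
        have "12 / real n = 3 / real n + 9 / real n" by (simp add: add_divide_distrib[symmetric])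
        then show ?thesis using 1 2 3 by linarith
      qed
      have small: "12 / real n < \<gamma> / 2" "3 / real n \<le> 12 / real n" using elim(1) n by (auto intro: divide_right_mono)
      have "\<bar>graph_edge_density n E - e0\<bar> < \<gamma>" using Ed small \<epsilon> by linarith
      moreover have "\<bar>graph_triangle_density n E - t0\<bar> < \<gamma>" using Td small \<epsilon> by linarith
      moreover have "\<gamma> \<le> \<delta> - \<bar>e0 - e\<bar>" "\<gamma> \<le> \<delta> - \<bar>t0 - t\<bar>" by (auto simp: \<gamma>_def)
      ultimately show "E \<in> count_set n \<delta> e t"
        using ED by (auto simp: count_set_def simple_graph_iff)
    qed
    have "(opt_entropy e0 t0 / 2 - \<eta>) * (real n)\<^sup>2 \<le> S - l2 - ln 2"
    proof -
      have "real n + ln 2 \<le> \<eta> / 2 * (real n)\<^sup>2" using elim(3) n2 by (simp add: pos_divide_less_eq)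
      moreover have "l2 \<le> \<eta> / 2 * (real n)\<^sup>2" unfolding l2_def using \<epsilon>(3) by (intro mult_right_mono) auto
      moreover have "(opt_entropy e0 t0 / 2 - \<eta>) * (real n)\<^sup>2
          = opt_entropy e0 t0 / 2 * (real n)\<^sup>2 - \<eta> / 2 * (real n)\<^sup>2 - \<eta> / 2 * (real n)\<^sup>2"
        by (simp add: left_diff_distrib)
      ultimately show ?thesis using Slow by linarith
    qed
    then have "exp ((opt_entropy e0 t0 / 2 - \<eta>) * (real n)\<^sup>2) \<le> exp (S - l2 - ln 2)" by simp
    also have "\<dots> = exp (S - l2) / 2" by (simp add: exp_diff)
    also have "\<dots> \<le> real (card good)" by (rule cardg)
    also have "\<dots> \<le> real (graph_count n \<delta> e t)"
      unfolding graph_count_eq using card_mono[OF finite_count_set sub] by simp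
    finally show ?case .
  qed
qed

section \<open>The Boltzmann entropy\<close>

lemma region_box:
  assumes "(e, t) \<in> region"
  obtains \<rho> where "\<rho> > 0" "\<And>e' t'. \<bar>e' - e\<bar> \<le> \<rho> \<Longrightarrow> \<bar>t' - t\<bar> \<le> \<rho> \<Longrightarrow> (e', t') \<in> region"
proof -
  obtain d where d: "d > 0" "\<And>q. dist q (e, t) < d \<Longrightarrow> q \<in> region"
    using open_region assms unfolding open_dist by blast
  show thesis
  proof (rule that[of "d / 3"])
    fix e' t' assume "\<bar>e' - e\<bar> \<le> d / 3" "\<bar>t' - t\<bar> \<le> d / 3"
    moreover have "dist (e', t') (e, t) \<le> \<bar>e' - e\<bar> + \<bar>t' - t\<bar>"
      unfolding dist_prod_def dist_real_def fst_conv snd_conv by (rule sqrt_sum_squares_le_sum) auto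
    ultimately show "(e', t') \<in> region" using d by (intro d(2)) simp
  qed (use d in simp)
qed

lemma opt_entropy_range:
  assumes "(e, t) \<in> region"
  shows "0 \<le> opt_entropy e t" "opt_entropy e t \<le> 1"
proof -
  have "0 < amp e t" "amp e t < e" "amp e t < 1 - e" using assms by (auto simp: region_def)
  then have "0 \<le> H (e - amp e t)" "H (e - amp e t) \<le> 1" "0 \<le> H (e + amp e t)" "H (e + amp e t) \<le> 1"
    by (auto intro!: H_nonneg H_le_1)
  then show "0 \<le> opt_entropy e t" "opt_entropy e t \<le> 1" by (auto simp: opt_entropy_def)
qed

text \<open>For fixed small \<delta> the limit in \<open>n\<close> is half the supremum of
  \<open>opt_entropy\<close> over the open box of radius \<delta>, and this supremum tends to the
  value at the centre by continuity. The factor 1/2 arises because edges are unordered pairs while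
  the entropy integral runs over ordered ones.\<close>

lemma has_boltzmann_entropy_region:
  assumes reg: "(e, t) \<in> region"
  shows "has_boltzmann_entropy e t (opt_entropy e t / 2)"
proof -
  obtain \<rho> where \<rho>: "\<rho> > 0" "\<And>e' t'. \<bar>e' - e\<bar> \<le> \<rho> \<Longrightarrow> \<bar>t' - t\<bar> \<le> \<rho> \<Longrightarrow> (e', t') \<in> region"
    by (rule region_box[OF reg]) blast
  define \<sigma> where "\<sigma> p = opt_entropy (fst p) (snd p)" for p
  define box where "box \<delta> = {p. \<bar>fst p - e\<bar> < \<delta> \<and> \<bar>snd p - t\<bar> < \<delta>}" for \<delta>
  define M where "M \<delta> = Sup (\<sigma> ` box \<delta>)" for \<delta>
  define K where "K = {e - \<rho>..e + \<rho>} \<times> {t - \<rho>..t + \<rho>}"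
  have K: "p \<in> K \<longleftrightarrow> \<bar>fst p - e\<bar> \<le> \<rho> \<and> \<bar>snd p - t\<bar> \<le> \<rho>" for p
    by (cases p) (auto simp: K_def abs_le_iff)
  have KR: "p \<in> region" if "p \<in> K" for p
    using \<rho>(2)[of "fst p" "snd p"] that unfolding K by simp
  have boxK: "box \<delta> \<subseteq> K" if "\<delta> \<le> \<rho>" for \<delta>
    using that by (auto simp: box_def K)
  have \<sigma>01: "0 \<le> \<sigma> p" "\<sigma> p \<le> 1" if "p \<in> K" for p
    using opt_entropy_range[of "fst p" "snd p"] KR[OF that] by (auto simp: \<sigma>_def)
  have bdd: "bdd_above (\<sigma> ` box \<delta>)" if "\<delta> \<le> \<rho>" for \<delta>
    using boxK[OF that] \<sigma>01 by (intro bdd_aboveI[of _ 1]) auto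
  have cbox: "(e, t) \<in> box \<delta>" if "\<delta> > 0" for \<delta> using that by (simp add: box_def)
  have upM: "\<sigma> p \<le> M \<delta>" if "\<delta> \<le> \<rho>" "p \<in> box \<delta>" for p \<delta>
    unfolding M_def by (rule cSUP_upper[OF that(2) bdd[OF that(1)]])
  have "continuous_on K \<sigma>"
    unfolding \<sigma>_def using continuous_on_opt_entropy
    by (rule continuous_on_subset) (use KR region_subset in blast)
  moreover have "compact K" unfolding K_def by (intro compact_Times compact_Icc)
  ultimately have uc: "uniformly_continuous_on K \<sigma>" by (rule compact_uniformly_continuous)
  have dle: "dist p q \<le> \<bar>fst p - fst q\<bar> + \<bar>snd p - snd q\<bar>" for p q :: "real \<times> real"
    unfolding dist_prod_def dist_real_def by (rule sqrt_sum_squares_le_sum) auto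
  have lower: "\<forall>\<^sub>F n in sequentially. exp ((M \<delta> / 2 - \<eta>) * (real n)\<^sup>2) \<le> real (graph_count n \<delta> e t)"
    if \<delta>: "0 < \<delta>" "\<delta> < \<rho>" and \<eta>: "\<eta> > 0" for \<delta> \<eta>
  proof -
    have "(M \<delta> - \<eta> < M \<delta>) = (\<exists>x\<in>box \<delta>. M \<delta> - \<eta> < \<sigma> x)"
      unfolding M_def using cbox[OF \<delta>(1)] bdd[of \<delta>] \<delta>(2) by (intro less_cSUP_iff) auto
    then obtain p where p: "p \<in> box \<delta>" "M \<delta> - \<eta> < \<sigma> p" using \<eta> by auto
    have "p \<in> K" using p(1) boxK[of \<delta>] \<delta>(2) by auto
    then have "p \<in> amp_domain" using KR region_subset by blast
    then have "(fst p, snd p) \<in> amp_domain" by simp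
    moreover have "\<bar>fst p - e\<bar> < \<delta>" "\<bar>snd p - t\<bar> < \<delta>" using p(1) by (auto simp: box_def)
    ultimately have "\<forall>\<^sub>F n in sequentially. exp ((opt_entropy (fst p) (snd p) / 2 - \<eta> / 2) * (real n)\<^sup>2) \<le> real (graph_count n \<delta> e t)"
      using \<eta> by (intro graph_count_lower) auto
    then show ?thesis
    proof eventually_elim
      case (elim n)
      have "(M \<delta> / 2 - \<eta>) * (real n)\<^sup>2 \<le> (opt_entropy (fst p) (snd p) / 2 - \<eta> / 2) * (real n)\<^sup>2"
        using p(2) by (intro mult_right_mono) (auto simp: \<sigma>_def)
      then show ?case using elim by (meson exp_le_cancel_iff order_trans)
    qed
  qed
  have upper: "\<forall>\<^sub>F n in sequentially. real (graph_count n \<delta> e t) \<le> exp ((M \<delta> / 2 + \<eta>) * (real n)\<^sup>2)"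
    if \<delta>: "0 < \<delta>" "\<delta> < \<rho>" and \<eta>: "\<eta> > 0" for \<delta> \<eta>
  proof -
    obtain \<kappa> where \<kappa>: "\<kappa> > 0" "\<And>p q. p \<in> K \<Longrightarrow> q \<in> K \<Longrightarrow> dist q p < \<kappa> \<Longrightarrow> dist (\<sigma> q) (\<sigma> p) < \<eta>"
      using uc \<eta> unfolding uniformly_continuous_on_def by blast
    \<comment> \<open>The upper bound looks at a slightly larger closed box. Each of its points is
      moved back into the open box by at most \<open>4 * (\<delta>' - \<delta>)\<close>, which is at
      most \<open>4 * \<kappa> / 5\<close> and so within the modulus of continuity.\<close>
    define \<delta>' where "\<delta>' = min \<rho> (\<delta> + \<kappa> / 5)"
    have \<delta>': "\<delta> < \<delta>'" "\<delta>' \<le> \<rho>" "\<delta>' \<le> \<delta> + \<kappa> / 5" using \<delta> \<kappa>(1) by (auto simp: \<delta>'_def)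
    have "\<forall>\<^sub>F n in sequentially. real (graph_count n \<delta> e t) \<le> exp (((M \<delta> + \<eta>) / 2 + \<eta> / 2) * (real n)\<^sup>2)"
    proof (rule graph_count_upper[OF _ \<delta>(1) \<delta>'(1)])
      fix e' t' assume et: "\<bar>e' - e\<bar> \<le> \<delta>'" "\<bar>t' - t\<bar> \<le> \<delta>'"
      \<comment> \<open>Scaling by \<open>\<delta> / \<delta>'\<close> would only reach the closed
        box of radius \<delta>; the square lands strictly inside it.\<close>
      define l where "l = (\<delta> / \<delta>')\<^sup>2"
      have \<delta>'0: "\<delta>' > 0" using \<delta> \<delta>' by linarith
      have q1: "\<delta> / \<delta>' < 1" using \<delta> \<delta>' \<delta>'0 by simp
      have q0: "0 < \<delta> / \<delta>'" using \<delta> \<delta>'0 by simp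
      have l: "0 < l" "l < 1"
        unfolding l_def power2_eq_square using mult_pos_pos[OF q0 q0] mult_strict_left_mono[OF q1 q0] q1 by linarith+
      have l\<delta>: "l * \<delta>' < \<delta>"
      proof -
        have "l * \<delta>' = \<delta> * (\<delta> / \<delta>')" using \<delta>'0 by (simp add: l_def power2_eq_square)
        also have "\<dots> < \<delta> * 1" using q1 \<delta>(1) by (intro mult_strict_left_mono)
        finally show ?thesis by simp
      qed
      have ml: "(1 - l) * \<delta>' \<le> 2 * (\<delta>' - \<delta>)"
      proof -
        have "1 - l \<le> 2 * (1 - \<delta> / \<delta>')"
          using zero_le_power2[of "1 - \<delta> / \<delta>'"] by (simp add: l_def power2_eq_square algebra_simps)
        then have "(1 - l) * \<delta>' \<le> 2 * (1 - \<delta> / \<delta>') * \<delta>'" using \<delta>'0 by (intro mult_right_mono) auto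
        also have "\<dots> = 2 * (\<delta>' - \<delta>)" using \<delta>'0 by (simp add: algebra_simps)
        finally show ?thesis .
      qed
      define q where "q = (e + l * (e' - e), t + l * (t' - t))"
      have shrink: "\<bar>l * x\<bar> < \<delta>" "\<bar>x - l * x\<bar> \<le> 2 * (\<delta>' - \<delta>)" if "\<bar>x\<bar> \<le> \<delta>'" for x
      proof -
        have "\<bar>l * x\<bar> \<le> l * \<delta>'" using l that by (simp add: abs_mult)
        then show "\<bar>l * x\<bar> < \<delta>" using l\<delta> by linarith
        have "x - l * x = (1 - l) * x" by (simp add: left_diff_distrib)
        then have "\<bar>x - l * x\<bar> = (1 - l) * \<bar>x\<bar>" using l by (simp add: abs_mult)
        also have "\<dots> \<le> (1 - l) * \<delta>'" using l that by (intro mult_left_mono) auto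
        finally show "\<bar>x - l * x\<bar> \<le> 2 * (\<delta>' - \<delta>)" using ml by linarith
      qed
      have qb: "q \<in> box \<delta>" using shrink(1)[OF et(1)] shrink(1)[OF et(2)] by (simp add: q_def box_def)
      then have qK: "q \<in> K" using boxK[of \<delta>] \<delta>(2) by auto
      have pK: "(e', t') \<in> K" using et \<delta>'(2) unfolding K by simp
      have "dist (e', t') q \<le> \<bar>(e' - e) - l * (e' - e)\<bar> + \<bar>(t' - t) - l * (t' - t)\<bar>"
        using dle[of "(e', t')" q] by (simp add: q_def algebra_simps)
      also have "\<dots> \<le> 2 * (\<delta>' - \<delta>) + 2 * (\<delta>' - \<delta>)"
        using shrink(2)[OF et(1)] shrink(2)[OF et(2)] by (rule add_mono)
      also have "\<dots> < \<kappa>" using \<delta>'(3) \<kappa>(1) by simp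
      finally have "dist (\<sigma> (e', t')) (\<sigma> q) < \<eta>" by (intro \<kappa>(2) qK pK)
      then have "\<sigma> (e', t') \<le> \<sigma> q + \<eta>" by (simp add: dist_real_def abs_less_iff)
      also have "\<dots> \<le> M \<delta> + \<eta>" using upM[OF _ qb] \<delta>(2) by simp
      finally show "(e', t') \<in> region \<and> opt_entropy e' t' \<le> M \<delta> + \<eta>"
        using KR[OF pK] by (simp add: \<sigma>_def)
    qed (use \<eta> in simp)
    moreover have "(M \<delta> + \<eta>) / 2 + \<eta> / 2 = M \<delta> / 2 + \<eta>" by (simp add: add_divide_distrib)
    ultimately show ?thesis by simp
  qed
  have lim: "(\<lambda>n. ln (real (graph_count n \<delta> e t)) / (real n)\<^sup>2) \<longlonglongrightarrow> M \<delta> / 2"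
    and pos: "\<forall>\<^sub>F n in sequentially. graph_count n \<delta> e t > 0" if \<delta>: "0 < \<delta>" "\<delta> < \<rho>" for \<delta>
  proof -
    have posr: "real (graph_count n \<delta> e t) > 0" if "exp x \<le> real (graph_count n \<delta> e t)" for n x
      using that exp_gt_zero[of x] by linarith
    show "\<forall>\<^sub>F n in sequentially. graph_count n \<delta> e t > 0"
      using lower[OF \<delta> zero_less_one] 
    proof eventually_elim
      case (elim n)
      show ?case using posr[OF elim] by simp
    qed
    show "(\<lambda>n. ln (real (graph_count n \<delta> e t)) / (real n)\<^sup>2) \<longlonglongrightarrow> M \<delta> / 2"
    proof (rule tendstoI)
      fix \<epsilon> :: real assume "\<epsilon> > 0"
      then have \<eta>: "\<epsilon> / 2 > 0" by simp
      show "\<forall>\<^sub>F n in sequentially. dist (ln (real (graph_count n \<delta> e t)) / (real n)\<^sup>2) (M \<delta> / 2) < \<epsilon>"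
        using lower[OF \<delta> \<eta>] upper[OF \<delta> \<eta>] eventually_gt_at_top[of "0::nat"]
      proof eventually_elim
        case (elim n)
        have n2: "(real n)\<^sup>2 > 0" using elim(3) by simp
        note p = posr[OF elim(1)]
        have "(M \<delta> / 2 - \<epsilon> / 2) * (real n)\<^sup>2 \<le> ln (real (graph_count n \<delta> e t))"
          using elim(1) p by (simp add: ln_ge_iff)
        then have 1: "M \<delta> / 2 - \<epsilon> / 2 \<le> ln (real (graph_count n \<delta> e t)) / (real n)\<^sup>2"
          using n2 by (simp only: pos_le_divide_eq)
        have "ln (real (graph_count n \<delta> e t)) \<le> ln (exp ((M \<delta> / 2 + \<epsilon> / 2) * (real n)\<^sup>2))"
          using elim(2) p by (subst ln_le_cancel_iff) auto
        then have "ln (real (graph_count n \<delta> e t)) \<le> (M \<delta> / 2 + \<epsilon> / 2) * (real n)\<^sup>2" by simp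
        then have 2: "ln (real (graph_count n \<delta> e t)) / (real n)\<^sup>2 \<le> M \<delta> / 2 + \<epsilon> / 2"
          using n2 by (simp only: pos_divide_le_eq)
        show ?case unfolding dist_real_def abs_less_iff using 1 2 \<open>\<epsilon> > 0\<close> by (intro conjI) linarith+
      qed
    qed
  qed
  have "((\<lambda>\<delta>. M \<delta> / 2) \<longlongrightarrow> opt_entropy e t / 2) (at_right 0)"
  proof (rule tendstoI)
    fix \<epsilon> :: real assume \<epsilon>: "\<epsilon> > 0"
    obtain \<kappa> where \<kappa>: "\<kappa> > 0" "\<And>p q. p \<in> K \<Longrightarrow> q \<in> K \<Longrightarrow> dist q p < \<kappa> \<Longrightarrow> dist (\<sigma> q) (\<sigma> p) < \<epsilon>"
      using uc \<epsilon> unfolding uniformly_continuous_on_def by blast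
    have "\<forall>\<^sub>F \<delta> in at_right 0. \<delta> < min \<rho> (\<kappa> / 2)"
      using eventually_at_right_real[of 0 "min \<rho> (\<kappa> / 2)"] \<rho>(1) \<kappa>(1) by (auto elim: eventually_mono)
    then show "\<forall>\<^sub>F \<delta> in at_right 0. dist (M \<delta> / 2) (opt_entropy e t / 2) < \<epsilon>"
      using eventually_at_right_less[of "0::real"]
    proof eventually_elim
      case (elim \<delta>)
      have cK: "(e, t) \<in> K" using \<rho>(1) unfolding K by simp
      have le: "\<sigma> p \<le> \<sigma> (e, t) + \<epsilon>" if p: "p \<in> box \<delta>" for p
      proof -
        have "p \<in> K" using boxK[of \<delta>] elim p by auto
        moreover have "dist p (e, t) < \<kappa>"
          using dle[of p "(e, t)"] p elim by (simp add: box_def)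
        ultimately have "dist (\<sigma> p) (\<sigma> (e, t)) < \<epsilon>" by (intro \<kappa>(2) cK)
        then show ?thesis by (simp add: dist_real_def abs_less_iff)
      qed
      have "M \<delta> \<le> \<sigma> (e, t) + \<epsilon>"
        unfolding M_def using cbox[of \<delta>] elim(2) le by (intro cSUP_least) auto
      moreover have "\<sigma> (e, t) \<le> M \<delta>" using elim by (intro upM cbox) auto
      ultimately show ?case using \<epsilon> by (simp add: dist_real_def \<sigma>_def abs_less_iff)
    qed
  qed
  moreover have "\<forall>\<^sub>F \<delta> in at_right 0. (\<forall>\<^sub>F n in sequentially. graph_count n \<delta> e t > 0) \<and>
      (\<lambda>n. ln (real (graph_count n \<delta> e t)) / (real n)\<^sup>2) \<longlonglongrightarrow> M \<delta> / 2"
    using eventually_at_right_real[OF \<rho>(1)]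
  proof eventually_elim
    case (elim \<delta>)
    then have \<delta>: "0 < \<delta>" "\<delta> < \<rho>" by auto
    show ?case using lim[OF \<delta>] pos[OF \<delta>] by simp
  qed
  ultimately show ?thesis
    unfolding has_boltzmann_entropy_def by (intro exI[of _ "\<lambda>\<delta>. M \<delta> / 2"]) simp
qed

lemma boltzmann_entropy_region:
  "(e, t) \<in> region \<Longrightarrow> boltzmann_entropy e t = opt_entropy e t / 2"
  by (rule boltzmann_entropy_eq) (rule has_boltzmann_entropy_region)

lemma analytic_boltzmann_entropy: "real_analytic_on boltzmann_entropy region"
proof (rule real_analytic_onI)
  fix e t assume reg: "(e, t) \<in> region"
  obtain \<rho> where \<rho>: "\<rho> > 0" "\<And>e' t'. \<bar>e' - e\<bar> \<le> \<rho> \<Longrightarrow> \<bar>t' - t\<bar> \<le> \<rho> \<Longrightarrow> (e', t') \<in> region"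
    by (rule region_box[OF reg]) blast
  have "analytic_at2 (\<lambda>e t. 1/2 * opt_entropy e t) e t"
    using reg region_subset by (intro analytic_at2_cmult analytic_at2_opt_entropy) auto
  then show "analytic_at2 boltzmann_entropy e t"
    by (rule analytic_at2_cong[OF _ \<rho>(1)]) (simp add: boltzmann_entropy_region \<rho>(2))
qed

theorem corollary2:
  "\<exists>U :: (real \<times> real) set. open U \<and> {1/2} \<times> {0<..<1/8} \<subseteq> U \<and>
     (\<forall>(e, t)\<in>U.
        entropy_maximizer e t (bipodal_graphon e t) \<and>
        (\<forall>g h. entropy_maximizer e t g \<and> entropy_maximizer e t h \<longrightarrow> graphon_equiv g h) \<and>
        has_boltzmann_entropy e t (boltzmann_entropy e t)) \<and>
     real_analytic_on boltzmann_entropy U \<and>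
     (\<forall>k E. simple_graph k E \<longrightarrow>
        real_analytic_on (\<lambda>e t. subgraph_density k E (bipodal_graphon e t)) U)"
proof (intro exI[of _ region] conjI allI impI)
  show "open region" by (rule open_region)
  show "{1/2} \<times> {0<..<1/8} \<subseteq> region" by (rule half_line_in_region)
  show "\<forall>(e, t)\<in>region. entropy_maximizer e t (bipodal_graphon e t) \<and>
        (\<forall>g h. entropy_maximizer e t g \<and> entropy_maximizer e t h \<longrightarrow> graphon_equiv g h) \<and>
        has_boltzmann_entropy e t (boltzmann_entropy e t)"
  proof clarify
    fix e t assume reg: "(e, t) \<in> region"
    have "graphon_equiv g h" if "entropy_maximizer e t g" "entropy_maximizer e t h" for g h
      by (rule entropy_maximizer_unique[OF reg that])
    moreover have "has_boltzmann_entropy e t (boltzmann_entropy e t)"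
      unfolding boltzmann_entropy_region[OF reg] by (rule has_boltzmann_entropy_region[OF reg])
    ultimately show "entropy_maximizer e t (bipodal_graphon e t) \<and>
        (\<forall>g h. entropy_maximizer e t g \<and> entropy_maximizer e t h \<longrightarrow> graphon_equiv g h) \<and>
        has_boltzmann_entropy e t (boltzmann_entropy e t)"
      using bipodal_entropy_maximizer(1)[OF reg] by simp
  qed
  show "real_analytic_on boltzmann_entropy region" by (rule analytic_boltzmann_entropy)
  show "real_analytic_on (\<lambda>e t. subgraph_density k E (bipodal_graphon e t)) region"
    if "simple_graph k E" for k E
  proof (rule real_analytic_onI)
    fix e t assume "(e, t) \<in> region"
    then show "analytic_at2 (\<lambda>e t. subgraph_density k E (bipodal_graphon e t)) e t"
      by (intro analytic_subgraph_density[OF that] subsetD[OF region_subset])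
  qed
qed

end
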